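(* Let $k$ be a perfect field of characteristic different from $3$ and $K=k(x)$. The bi-twists (up to bi-isomorphism over $k$) of the cubic extension of $K$ defined by $y^3=x(x-1)$ are in bijective correspondence with the pairs $(\ell,[c])$, where $\ell$ is an isomorphism class of field extensions of $k$ of degree at most three and $[c]\in k^*/(k^* )^3$. Given $(\ell,[c])$, a corresponding bi-twist is given by $y^3=c\,x(x-1)$ if $\ell=k$, and by $y^3=c\,f(x)$ if $\ell\ne k$, where $f$ is the minimal polynomial over $k$ of a generator of $\ell/k$. In particular, all these bi-twists are purely cubic, and they are Galois if and only if $k$ contains a primitive third root of unity $\zeta_3$.
   Context: Two cubic extensions $L_1/K_1$, $L_2/K_2$ of function fields over $k$ are bi-isomorphic if there exist field isomorphisms $L_1\to L_2$ and $K_1\to K_2$ compatible with the inclusions. A cubic extension is a bi-twist of $L/K$ if it becomes bi-isomorphic to $L/K$ after base change to $\overline k$. A cubic extension is purely cubic if it is generated by a root of some $X^3-\beta$. *)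

theory Defs
  imports "HOL-Algebra.Algebraic_Closure_Type" "HOL-Algebra.Generated_Fields"
    "HOL-Computational_Algebra.Polynomial_Factorial"
begin

text \<open>
  The ground field \<open>k\<close> is a type \<open>'k\<close> of class \<open>field\<close>, and
  \<open>'k alg_closure\<close> is its algebraic closure. Field extensions of \<open>k\<close> are given by
  an embedding \<open>e\<close> of \<open>'k\<close> into an ambient field type \<open>'u\<close> together with subfields of \<open>'u\<close>
  that contain the image of \<open>e\<close>; the ambient type may differ from extension to extension.
\<close>

abbreviation amb :: "'u::field ring"
  where "amb \<equiv> ring_of_type_algebra"

abbreviation sub_fld :: "'u::field set \<Rightarrow> 'u ring"
  where "sub_fld F \<equiv> amb\<lparr>carrier := F\<rparr>"

definition perfect_field :: "'k::field itself \<Rightarrow> bool"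
  where "perfect_field _ \<longleftrightarrow> CHAR('k) = 0 \<or> surj (\<lambda>a::'k. a ^ CHAR('k))"

definition transcendental_over :: "('k::field \<Rightarrow> 'u::field) \<Rightarrow> 'u \<Rightarrow> bool"
  where "transcendental_over e t \<longleftrightarrow> (\<forall>p::'k poly. p \<noteq> 0 \<longrightarrow> poly (map_poly e p) t \<noteq> 0)"

text \<open>
  Function fields are in one variable and have full constant field \<open>k\<close> (the last conjunct).
  For perfect \<open>k\<close> this makes the compositum of \<open>F\<close> with an algebraic closure of \<open>k\<close> the base
  change (tensor product) of \<open>F\<close>.
\<close>

definition function_field :: "('k::field \<Rightarrow> 'u::field) \<Rightarrow> 'u set \<Rightarrow> bool"
  where "function_field e F \<longleftrightarrow>
    e \<in> ring_hom amb amb \<and> subfield F amb \<and> range e \<subseteq> F \<and>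
    (\<exists>t\<in>F. transcendental_over e t \<and>
       (\<exists>n. ring.dimension amb n (generate_field amb (insert t (range e))) F)) \<and>
    (\<forall>z\<in>F. \<not> transcendental_over e z \<longrightarrow> z \<in> range e)"

text \<open>A triple \<open>(e, K, L)\<close> stands for the extension \<open>L/K\<close> of fields over \<open>k\<close>.\<close>

type_synonym ('k, 'u) extn = "('k \<Rightarrow> 'u) \<times> 'u set \<times> 'u set"

fun cubic_extension :: "('k::field, 'u::field) extn \<Rightarrow> bool"
  where "cubic_extension (e, K, L) \<longleftrightarrow>
    function_field e K \<and> function_field e L \<and> K \<subseteq> L \<and> ring.dimension amb 3 K L"

fun bi_isomorphic :: "('k::field, 'u::field) extn \<Rightarrow> ('k, 'v::field) extn \<Rightarrow> bool"
  where "bi_isomorphic (e1, K1, L1) (e2, K2, L2) \<longleftrightarrow>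
    (\<exists>\<phi> \<psi>. \<phi> \<in> ring_iso (sub_fld L1) (sub_fld L2) \<and> \<psi> \<in> ring_iso (sub_fld K1) (sub_fld K2) \<and>
       (\<forall>z\<in>K1. \<phi> z = \<psi> z) \<and> (\<forall>a. \<phi> (e1 a) = e2 a))"

text \<open>
  Base change to the algebraic closure of \<open>k\<close>: the composita of \<open>K\<close> and of \<open>L\<close> with it, formed in an
  algebraic closure of the ambient field, as fields over \<open>'k alg_closure\<close> via an embedding \<open>E\<close>
  that extends \<open>e\<close>. In the situation above the result does not depend on \<open>E\<close> up to isomorphism
  over \<open>'k alg_closure\<close>.
\<close>

fun base_change :: "('k::field, 'u::field) extn \<Rightarrow> ('k alg_closure, 'u alg_closure) extn \<Rightarrow> bool"
  where "base_change (e, K, L) (E, K', L') \<longleftrightarrow>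
    E \<in> ring_hom amb amb \<and> (\<forall>a. E (to_ac a) = to_ac (e a)) \<and>
    K' = generate_field amb (to_ac ` K \<union> range E) \<and>
    L' = generate_field amb (to_ac ` L \<union> range E)"

definition bi_twist :: "('k::field, 'u::field) extn \<Rightarrow> ('k, 'v::field) extn \<Rightarrow> bool"
  where "bi_twist M M0 \<longleftrightarrow> cubic_extension M \<and>
    (\<exists>N N0. base_change M N \<and> base_change M0 N0 \<and> bi_isomorphic N N0)"

fun purely_cubic :: "('k::field, 'u::field) extn \<Rightarrow> bool"
  where "purely_cubic (e, K, L) \<longleftrightarrow>
    (\<exists>\<beta>\<in>K. \<exists>y\<in>L. y ^ 3 = \<beta> \<and> L = generate_field amb (insert y K))"

fun is_galois :: "('k::field, 'u::field) extn \<Rightarrow> bool"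
  where "is_galois (e, K, L) \<longleftrightarrow>
    {z \<in> L. \<forall>\<sigma> \<in> ring_iso (sub_fld L) (sub_fld L). (\<forall>a\<in>K. \<sigma> a = a) \<longrightarrow> \<sigma> z = z} = K"

definition bi_twists :: "('k::field, 'v::field) extn \<Rightarrow> ('k, 'u::field) extn set"
  where "bi_twists M0 = {M. bi_twist M M0}"

definition bi_iso_rel :: "('k::field, 'v::field) extn \<Rightarrow> (('k, 'u::field) extn \<times> ('k, 'u) extn) set"
  where "bi_iso_rel M0 = {(M, M'). M \<in> bi_twists M0 \<and> M' \<in> bi_twists M0 \<and> bi_isomorphic M M'}"

text \<open>
  \<open>'k poly fract\<close> is \<open>K = k(x)\<close>, and \<open>'k ratfun_ac\<close> an algebraic closure of it. Every function field
  over \<open>k\<close> embeds over \<open>k\<close> into the latter, which therefore serves as a universe.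
\<close>

type_synonym 'k ratfun_ac = "'k poly fract alg_closure"

definition const_emb :: "'k::field \<Rightarrow> 'k ratfun_ac"
  where "const_emb a = to_ac (to_fract [:a:])"

definition cbrt_extn :: "'k::field ratfun_ac \<Rightarrow> ('k, 'k ratfun_ac) extn"
  where "cbrt_extn y = (const_emb, range to_ac, generate_field amb (insert y (range to_ac)))"

definition defined_by_cube :: "('k::field, 'k ratfun_ac) extn \<Rightarrow> 'k poly \<Rightarrow> bool"
  where "defined_by_cube M h \<longleftrightarrow> (\<exists>y. y ^ 3 = to_ac (to_fract h) \<and> M = cbrt_extn y)"

definition small_exts :: "'k::field alg_closure set set"
  where "small_exts = {l. subfield l amb \<and> range to_ac \<subseteq> l \<and>
    (\<exists>n\<le>3. ring.dimension amb n (range to_ac) l)}"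

definition ext_iso_rel :: "('k::field alg_closure set \<times> 'k alg_closure set) set"
  where "ext_iso_rel = {(l, m). l \<in> small_exts \<and> m \<in> small_exts \<and>
    (\<exists>\<phi> \<in> ring_iso (sub_fld l) (sub_fld m). \<forall>a. \<phi> (to_ac a) = to_ac a)}"

definition cube_rel :: "('k::field \<times> 'k) set"
  where "cube_rel = {(c, d). c \<noteq> 0 \<and> d \<noteq> 0 \<and> (\<exists>b. b \<noteq> 0 \<and> d = c * b ^ 3)}"

definition ext_classes :: "'k::field alg_closure set set set"
  where "ext_classes = small_exts // ext_iso_rel"

definition cube_classes :: "'k::field set set"
  where "cube_classes = {c. c \<noteq> 0} // cube_rel"

definition is_min_poly :: "'k::field poly \<Rightarrow> 'k alg_closure \<Rightarrow> bool"
  where "is_min_poly f \<alpha> \<longleftrightarrow>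
    Polynomial.lead_coeff f = 1 \<and> poly (map_poly to_ac f) \<alpha> = 0 \<and>
    (\<forall>g. g \<noteq> 0 \<and> poly (map_poly to_ac g) \<alpha> = 0 \<longrightarrow> Polynomial.degree f \<le> Polynomial.degree g)"

text \<open>
  A choice of a generator for (a representative of) every isomorphism class. Different choices
  may attach different bi-twists to the same pair \<open>(\<ell>, [c])\<close>: replacing a generator \<open>\<alpha>\<close> of a
  quadratic extension by \<open>a \<alpha>\<close> changes \<open>[c]\<close> by \<open>[a\<^sup>2]\<close>.
\<close>

definition generator_choice :: "('k::field alg_closure set set \<Rightarrow> 'k alg_closure) \<Rightarrow> bool"
  where "generator_choice g \<longleftrightarrow>
    (\<forall>C\<in>ext_classes. generate_field amb (insert (g C) (range to_ac)) \<in> C)"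

definition twist_poly ::
    "('k::field alg_closure set set \<Rightarrow> 'k alg_closure) \<Rightarrow> 'k alg_closure set set \<Rightarrow> 'k poly \<Rightarrow> bool"
  where "twist_poly g C f \<longleftrightarrow>
    (if range to_ac \<in> C then f = [:0, 1:] * [:-1, 1:] else is_min_poly f (g C))"

end

theory Submission
  imports Defs
begin

text \<open>
  Over an algebraic closure of \<open>k\<close> every bi-twist is \<open>w\<^sup>3 = t (t - 1)\<close>, a cubic cover of the line that is
  branched at three points. If a Galois automorphism sends \<open>t\<close> to the Moebius transform
  \<open>(a t + b) / (c t + d)\<close>, then by Kummer theory it sends \<open>w\<close> to a constant times \<open>w / (c t + d)\<close>. Hence the
  two-dimensional space of all \<open>(\<lambda> + \<mu> t) / w\<close> is Galois-stable and has a basis \<open>y\<^sub>1, y\<^sub>2\<close> in \<open>L\<close>. With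
  \<open>x = y\<^sub>2 / y\<^sub>1\<close> and \<open>y = 1 / y\<^sub>1\<close> one gets \<open>K = k(x)\<close>, \<open>L = K(y)\<close> and \<open>y\<^sup>3 = F(x)\<close>, where \<open>F\<close> is a polynomial
  over \<open>k\<close> that is a binary cubic form of nonzero discriminant.

  Two such extensions are bi-isomorphic iff their forms agree up to \<open>GL\<^sub>2(k)\<close> and cubes of \<open>k\<^sup>*\<close>; that the
  Kummer generator is not inverted follows because all three branch points have multiplicity one.
  The orbit of the roots of \<open>F\<close> determines \<open>\<ell>\<close>, since any two generators of an extension of degree at
  most three differ by a Moebius transformation. If \<open>F\<close> is carried to \<open>m F\<close> by a matrix of
  determinant \<open>\<delta>\<close>, comparing discriminants gives \<open>\<delta>\<^sup>6 = m\<^sup>4\<close>, so that \<open>m\<close> is a cube and \<open>[c]\<close> is determined too.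
\<close>

hide_const (open) Polynomials.degree Polynomials.lead_coeff up_ring.monom up_ring.coeff module.smult

subsection \<open>Subfields and field homomorphisms\<close>

text \<open>Descent cannot start from \<open>t\<close>: a Galois automorphism preserves the three
  branch points only as a set, and a conic without rational point could a priori replace the line.
  The way out is that \<open>t\<close> and \<open>w\<close> acquire the same denominator, which
  cancels in \<open>1 / w\<close> and \<open>t / w\<close>; a plane of functions inside the field
  itself is thus stable, and semilinear descent for vector spaces always succeeds. Reading quadratic
  polynomials as cubic forms with a root at infinity treats all \<ell> alike: trivial \<ell> means
  three rational roots, quadratic \<ell> one rational root (moved to infinity) and a conjugate pair,
  cubic \<ell> a conjugate triple. The discriminant has integer coefficients, so characteristic 2
  needs no separate treatment. Perfectness supplies separable minimal polynomials; characteristic 3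
  is excluded because of the factor 3 in the cube of a general element of \<open>L\<close>.
  Presentations are compared without adjoining roots of unity, so the results hold over
  \<open>k\<close> directly.\<close>

lemma amb_simps [simp]:
  "carrier (amb :: 'a::field ring) = UNIV"
  "x \<otimes>\<^bsub>amb\<^esub> y = x * y" "x \<oplus>\<^bsub>amb\<^esub> y = x + y"
  "\<one>\<^bsub>amb\<^esub> = 1" "\<zero>\<^bsub>amb\<^esub> = 0"
  by (simp_all add: ring_of_type_algebra_def)

lemma field_amb: "Ring.field (amb :: 'a::field ring)"
  by (rule field_from_type_algebra)

lemma ring_amb: "Ring.ring (amb :: 'a::field ring)"
  by (rule ring_from_type_algebra)

lemma a_inv_amb [simp]: "\<ominus>\<^bsub>amb\<^esub> x = - (x :: 'a::field)"
proof -
  interpret Ring.field "amb :: 'a ring" by (rule field_amb)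
  show ?thesis using minus_equality[of "- x" x] by simp
qed

lemma m_inv_amb [simp]: "x \<noteq> 0 \<Longrightarrow> inv\<^bsub>amb\<^esub> x = inverse (x :: 'a::field)"
proof -
  assume x: "x \<noteq> 0"
  interpret Ring.field "amb :: 'a ring" by (rule field_amb)
  show ?thesis using x comm_inv_char[of x "inverse x"] by simp
qed

text \<open>Phrased with the type class operations; since \<open>inverse 0 = 0\<close>, closure
  under \<open>inverse\<close> needs no case distinction.\<close>

definition sfield :: "'a::field set \<Rightarrow> bool" where
  "sfield F \<longleftrightarrow> 1 \<in> F \<and> (\<forall>a\<in>F. \<forall>b\<in>F. a - b \<in> F \<and> a * b \<in> F) \<and> (\<forall>a\<in>F. inverse a \<in> F)"

lemma sfieldD:
  assumes "sfield F"
  shows sfield_0: "0 \<in> F" and sfield_1: "1 \<in> F"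
    and sfield_diff: "\<And>a b. a \<in> F \<Longrightarrow> b \<in> F \<Longrightarrow> a - b \<in> F"
    and sfield_minus: "\<And>a. a \<in> F \<Longrightarrow> - a \<in> F"
    and sfield_add: "\<And>a b. a \<in> F \<Longrightarrow> b \<in> F \<Longrightarrow> a + b \<in> F"
    and sfield_mult: "\<And>a b. a \<in> F \<Longrightarrow> b \<in> F \<Longrightarrow> a * b \<in> F"
    and sfield_inverse: "\<And>a. a \<in> F \<Longrightarrow> inverse a \<in> F"
    and sfield_divide: "\<And>a b. a \<in> F \<Longrightarrow> b \<in> F \<Longrightarrow> a / b \<in> F"
proof -
  show 1: "1 \<in> F" and d: "\<And>a b. a \<in> F \<Longrightarrow> b \<in> F \<Longrightarrow> a - b \<in> F"
    and m: "\<And>a b. a \<in> F \<Longrightarrow> b \<in> F \<Longrightarrow> a * b \<in> F" and i: "\<And>a. a \<in> F \<Longrightarrow> inverse a \<in> F"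
    using assms by (auto simp: sfield_def)
  show 0: "0 \<in> F" using d[OF 1 1] by simp
  show n: "- a \<in> F" if "a \<in> F" for a using d[OF 0 that] by simp
  show "a + b \<in> F" if "a \<in> F" "b \<in> F" for a b using d[OF that(1) n[OF that(2)]] by simp
  show "a / b \<in> F" if "a \<in> F" "b \<in> F" for a b
    using m[OF that(1) i[OF that(2)]] by (simp add: divide_inverse)
qed

lemmas sfield_intros = sfield_0 sfield_1 sfield_diff sfield_minus sfield_add sfield_mult
  sfield_inverse sfield_divide

lemma sfield_power: "sfield F \<Longrightarrow> a \<in> F \<Longrightarrow> a ^ n \<in> F"
  by (induction n) (auto intro: sfield_intros)

lemma sfield_sum: "sfield F \<Longrightarrow> (\<And>i. i \<in> A \<Longrightarrow> f i \<in> F) \<Longrightarrow> sum f A \<in> F"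
  by (induction A rule: infinite_finite_induct) (auto intro: sfield_intros)

lemma sfield_UNIV [simp]: "sfield UNIV"
  by (simp add: sfield_def)

lemma subfield_amb_iff: "subfield F (amb :: 'a::field ring) \<longleftrightarrow> sfield F"
proof
  interpret Ring.field "amb :: 'a ring" by (rule field_amb)
  assume F: "subfield F (amb :: 'a ring)"
  note sr = subfieldE(1)[OF F]
  have "inverse a \<in> F" if "a \<in> F" for a
    using subfield_m_inv(1)[OF F, of a] that subringE(2)[OF sr] by (cases "a = 0") auto
  moreover have "a - b \<in> F" if "a \<in> F" "b \<in> F" for a b
    using subringE(7)[OF sr, of a "- b"] subringE(5)[OF sr, of b] that by auto
  ultimately show "sfield F"
    using subringE(3,6)[OF sr] by (auto simp: sfield_def)
next
  interpret Ring.field "amb :: 'a ring" by (rule field_amb)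
  assume F: "sfield F"
  have sr: "subring F (amb :: 'a ring)"
    by (rule subringI) (auto intro: sfield_intros[OF F])
  show "subfield F (amb :: 'a ring)"
    by (rule subfieldI'[OF sr]) (auto intro: sfield_intros[OF F])
qed

abbreviation gen :: "'a::field set \<Rightarrow> 'a set" where
  "gen S \<equiv> generate_field amb S"

lemma sfield_gen [simp]: "sfield (gen S)"
proof -
  interpret Ring.field "amb :: 'a ring" by (rule field_amb)
  show ?thesis
    using generate_field_is_subfield[of S] by (simp add: subfield_amb_iff)
qed

lemma gen_incl: "a \<in> S \<Longrightarrow> a \<in> gen S"
  by (rule generate_field.incl)

lemma gen_superset: "S \<subseteq> gen S"
  by (auto intro: gen_incl)

lemma gen_least: "sfield F \<Longrightarrow> S \<subseteq> F \<Longrightarrow> gen S \<subseteq> F"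
proof -
  interpret Ring.field "amb :: 'a ring" by (rule field_amb)
  show "sfield F \<Longrightarrow> S \<subseteq> F \<Longrightarrow> gen S \<subseteq> F"
    using generate_field_min_subfield1[of S F] by (simp add: subfield_amb_iff)
qed

lemma gen_mono: "S \<subseteq> T \<Longrightarrow> gen S \<subseteq> gen T"
  by (rule gen_least) (use gen_superset in auto)

text \<open>Only the values on \<open>F\<close> are constrained, so one function on the ambient type
  can be restricted, extended and compared on different subfields. \<open>h 1 = 1\<close> excludes
  the zero map and so makes \<open>h\<close> injective on a subfield.\<close>

definition hom_on :: "'a::field set \<Rightarrow> ('a \<Rightarrow> 'b::field) \<Rightarrow> bool" where
  "hom_on F h \<longleftrightarrow> h 1 = 1 \<and> (\<forall>a\<in>F. \<forall>b\<in>F. h (a + b) = h a + h b \<and> h (a * b) = h a * h b)"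

lemma hom_onD:
  assumes "sfield F" "hom_on F h"
  shows hom_on_0: "h 0 = 0" and hom_on_1: "h 1 = 1"
    and hom_on_add: "\<And>a b. a \<in> F \<Longrightarrow> b \<in> F \<Longrightarrow> h (a + b) = h a + h b"
    and hom_on_mult: "\<And>a b. a \<in> F \<Longrightarrow> b \<in> F \<Longrightarrow> h (a * b) = h a * h b"
    and hom_on_minus: "\<And>a. a \<in> F \<Longrightarrow> h (- a) = - h a"
    and hom_on_diff: "\<And>a b. a \<in> F \<Longrightarrow> b \<in> F \<Longrightarrow> h (a - b) = h a - h b"
    and hom_on_eq_0_iff: "\<And>a. a \<in> F \<Longrightarrow> h a = 0 \<longleftrightarrow> a = 0"
    and hom_on_inverse: "\<And>a. a \<in> F \<Longrightarrow> h (inverse a) = inverse (h a)"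
    and hom_on_divide: "\<And>a b. a \<in> F \<Longrightarrow> b \<in> F \<Longrightarrow> h (a / b) = h a / h b"
    and hom_on_power: "\<And>a n. a \<in> F \<Longrightarrow> h (a ^ n) = h a ^ n"
    and hom_on_inj: "\<And>a b. a \<in> F \<Longrightarrow> b \<in> F \<Longrightarrow> h a = h b \<longleftrightarrow> a = b"
proof -
  note F = sfield_intros[OF assms(1)]
  show 1: "h 1 = 1" and add: "\<And>a b. a \<in> F \<Longrightarrow> b \<in> F \<Longrightarrow> h (a + b) = h a + h b"
    and mult: "\<And>a b. a \<in> F \<Longrightarrow> b \<in> F \<Longrightarrow> h (a * b) = h a * h b"
    using assms(2) by (auto simp: hom_on_def)
  show 0: "h 0 = 0" using add[OF F(1) F(1)] by (metis add_cancel_right_right add_0)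
  show mi: "h (- a) = - h a" if "a \<in> F" for a
    using add[OF that F(4)[OF that]] 0 by (simp add: eq_neg_iff_add_eq_0 add.commute)
  show di: "h (a - b) = h a - h b" if "a \<in> F" "b \<in> F" for a b
    using add[OF that(1) F(4)[OF that(2)]] mi[OF that(2)] by simp
  have iv: "h a * h (inverse a) = 1" if "a \<in> F" "a \<noteq> 0" for a
    using mult[OF that(1) F(7)[OF that(1)]] that 1 by simp
  show z: "h a = 0 \<longleftrightarrow> a = 0" if "a \<in> F" for a
    using iv[OF that] 0 by (metis mult_zero_left zero_neq_one)
  show inv: "h (inverse a) = inverse (h a)" if "a \<in> F" for a
    using iv[OF that] 0 by (cases "a = 0") (auto dest: inverse_unique)
  show "h (a / b) = h a / h b" if "a \<in> F" "b \<in> F" for a b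
    using mult[OF that(1) F(7)[OF that(2)]] inv[OF that(2)] by (simp add: divide_inverse)
  show "h (a ^ n) = h a ^ n" if "a \<in> F" for a n
    by (induction n) (auto simp: 1 mult that sfield_power[OF assms(1)])
  show "h a = h b \<longleftrightarrow> a = b" if "a \<in> F" "b \<in> F" for a b
    using z[OF F(3)[OF that]] di[OF that] by auto
qed

lemma hom_on_subset: "hom_on F h \<Longrightarrow> G \<subseteq> F \<Longrightarrow> hom_on G h"
  by (auto simp: hom_on_def)

lemma hom_on_sum:
  "sfield F \<Longrightarrow> hom_on F h \<Longrightarrow> (\<And>i. i \<in> A \<Longrightarrow> f i \<in> F) \<Longrightarrow> h (sum f A) = (\<Sum>i\<in>A. h (f i))"
  by (induction A rule: infinite_finite_induct)
     (auto simp: hom_on_0 hom_on_add sfield_sum)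

lemma hom_on_image: "sfield F \<Longrightarrow> hom_on F h \<Longrightarrow> sfield (h ` F)"
proof -
  assume F: "sfield F" and h: "hom_on F h"
  note H = hom_onD[OF F h] and S = sfield_intros[OF F]
  show ?thesis
    unfolding sfield_def
  proof (intro conjI ballI)
    show "1 \<in> h ` F" using S(2) H(2) by (metis imageI)
    fix a assume "a \<in> h ` F"
    then obtain a' where a: "a' \<in> F" "a = h a'" by auto
    show "inverse a \<in> h ` F" using a S(7) H(8) by (metis imageI)
    fix b assume "b \<in> h ` F"
    then obtain b' where b: "b' \<in> F" "b = h b'" by auto
    show "a - b \<in> h ` F" using a b S(3) H(6) by (metis imageI)
    show "a * b \<in> h ` F" using a b S(6) H(4) by (metis imageI)
  qed
qed

lemma hom_on_comp: "hom_on F h \<Longrightarrow> hom_on G g \<Longrightarrow> h ` F \<subseteq> G \<Longrightarrow> hom_on F (\<lambda>x. g (h x))"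
  unfolding hom_on_def by (simp add: image_subset_iff)

lemma hom_on_to_ac [simp]: "hom_on F to_ac"
  by (simp add: hom_on_def)

lemma ring_hom_amb_iff: "e \<in> Ring.ring_hom amb amb \<longleftrightarrow> hom_on UNIV e"
  by (auto simp: Ring.ring_hom_def hom_on_def)

lemma ring_hom_sub_fld_iff:
  "h \<in> Ring.ring_hom (sub_fld F) (sub_fld G) \<longleftrightarrow> hom_on F h \<and> h ` F \<subseteq> G"
  by (auto simp: Ring.ring_hom_def hom_on_def)

text \<open>Field homomorphisms are injective, so only the image has to be checked.\<close>

lemma ring_iso_sub_fld_iff:
  assumes "sfield F"
  shows "h \<in> ring_iso (sub_fld F) (sub_fld G) \<longleftrightarrow> hom_on F h \<and> h ` F = G"
  unfolding ring_iso_def mem_Collect_eq ring_hom_sub_fld_iff bij_betw_def inj_on_def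
  using hom_on_inj[OF assms] by auto

subsection \<open>Simple extensions and extension of homomorphisms\<close>

text \<open>Polynomials over a subfield stay in the polynomial type of the ambient field, so
  evaluation and divisibility need no change of type; the price is that membership of the
  coefficients is carried along.\<close>

definition polyF :: "'a::field set \<Rightarrow> 'a poly set" where
  "polyF F = {p. \<forall>i. coeff p i \<in> F}"

lemma polyFD: "p \<in> polyF F \<Longrightarrow> coeff p i \<in> F"
  by (simp add: polyF_def)

lemma polyF_UNIV [simp]: "polyF UNIV = UNIV"
  by (simp add: polyF_def)

lemma polyF_mono: "F \<subseteq> G \<Longrightarrow> polyF F \<subseteq> polyF G"
  by (auto simp: polyF_def)

lemma polyF_intros:
  assumes "sfield F"
  shows polyF_0: "0 \<in> polyF F" and polyF_1: "1 \<in> polyF F"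
    and polyF_add: "\<And>p q. p \<in> polyF F \<Longrightarrow> q \<in> polyF F \<Longrightarrow> p + q \<in> polyF F"
    and polyF_diff: "\<And>p q. p \<in> polyF F \<Longrightarrow> q \<in> polyF F \<Longrightarrow> p - q \<in> polyF F"
    and polyF_minus: "\<And>p. p \<in> polyF F \<Longrightarrow> - p \<in> polyF F"
    and polyF_mult: "\<And>p q. p \<in> polyF F \<Longrightarrow> q \<in> polyF F \<Longrightarrow> p * q \<in> polyF F"
    and polyF_smult: "\<And>a p. a \<in> F \<Longrightarrow> p \<in> polyF F \<Longrightarrow> smult a p \<in> polyF F"
    and polyF_monom: "\<And>a n. a \<in> F \<Longrightarrow> monom a n \<in> polyF F"
    and polyF_pCons: "\<And>a p. a \<in> F \<Longrightarrow> p \<in> polyF F \<Longrightarrow> pCons a p \<in> polyF F"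
  using sfield_intros[OF assms]
  by (auto simp: polyF_def coeff_mult coeff_1 coeff_pCons split: nat.split intro!: sfield_sum[OF assms])

lemma polyF_poly: "sfield F \<Longrightarrow> p \<in> polyF F \<Longrightarrow> z \<in> F \<Longrightarrow> poly p z \<in> F"
  by (auto simp: poly_altdef polyF_def intro!: sfield_sum sfield_intros sfield_power)

lemma coeff_map_poly_hom:
  "sfield F \<Longrightarrow> hom_on F h \<Longrightarrow> coeff (map_poly h p) i = h (coeff p i)"
  by (simp add: coeff_map_poly hom_on_0)

lemma map_poly_hom:
  assumes "sfield F" "hom_on F h"
  shows map_poly_hom_add: "\<And>p q. p \<in> polyF F \<Longrightarrow> q \<in> polyF F \<Longrightarrow>
      map_poly h (p + q) = map_poly h p + map_poly h q"
    and map_poly_hom_diff: "\<And>p q. p \<in> polyF F \<Longrightarrow> q \<in> polyF F \<Longrightarrow>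
      map_poly h (p - q) = map_poly h p - map_poly h q"
    and map_poly_hom_mult: "\<And>p q. p \<in> polyF F \<Longrightarrow> q \<in> polyF F \<Longrightarrow>
      map_poly h (p * q) = map_poly h p * map_poly h q"
    and map_poly_hom_pCons: "\<And>a p. map_poly h (pCons a p) = pCons (h a) (map_poly h p)"
    and map_poly_hom_smult: "\<And>a p. a \<in> F \<Longrightarrow> p \<in> polyF F \<Longrightarrow>
      map_poly h (smult a p) = smult (h a) (map_poly h p)"
    and map_poly_hom_degree: "\<And>p. p \<in> polyF F \<Longrightarrow> degree (map_poly h p) = degree p"
    and map_poly_hom_eq_0: "\<And>p. p \<in> polyF F \<Longrightarrow> map_poly h p = 0 \<longleftrightarrow> p = 0"
proof -
  note c = coeff_map_poly_hom[OF assms] and H = hom_onD[OF assms]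
  show "map_poly h (p + q) = map_poly h p + map_poly h q" if "p \<in> polyF F" "q \<in> polyF F" for p q
    by (rule poly_eqI) (simp add: c H polyFD[OF that(1)] polyFD[OF that(2)])
  show "map_poly h (p - q) = map_poly h p - map_poly h q" if "p \<in> polyF F" "q \<in> polyF F" for p q
    by (rule poly_eqI) (simp add: c H polyFD[OF that(1)] polyFD[OF that(2)])
  show "map_poly h (p * q) = map_poly h p * map_poly h q" if "p \<in> polyF F" "q \<in> polyF F" for p q
    by (rule poly_eqI)
      (simp add: c H coeff_mult polyFD[OF that(1)] polyFD[OF that(2)] hom_on_sum[OF assms]
        sfield_mult[OF assms(1)])
  show "map_poly h (pCons a p) = pCons (h a) (map_poly h p)" for a p
    by (rule poly_eqI) (simp add: c H coeff_pCons split: nat.split)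
  show "map_poly h (smult a p) = smult (h a) (map_poly h p)" if "a \<in> F" "p \<in> polyF F" for a p
    by (rule poly_eqI) (simp add: c H that polyFD[OF that(2)])
  show "degree (map_poly h p) = degree p" if "p \<in> polyF F" for p
  proof (rule antisym)
    show "degree (map_poly h p) \<le> degree p" by (rule degree_le) (simp add: c H coeff_eq_0)
    show "degree p \<le> degree (map_poly h p)"
      by (cases "p = 0") (auto intro!: le_degree simp: c H(7)[OF polyFD[OF that]])
  qed
  show "map_poly h p = 0 \<longleftrightarrow> p = 0" if "p \<in> polyF F" for p
    by (simp add: poly_eq_iff c H polyFD[OF that])
qed

lemma hom_on_poly:
  assumes "sfield F" "hom_on F h" "p \<in> polyF F" "z \<in> F"
  shows "h (poly p z) = poly (map_poly h p) (h z)"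
  by (simp add: poly_altdef map_poly_hom_degree[OF assms(1-3)] coeff_map_poly_hom[OF assms(1,2)]
      hom_on_sum[OF assms(1,2)] sfield_mult[OF assms(1)] polyFD[OF assms(3)]
      sfield_power[OF assms(1,4)] hom_onD[OF assms(1,2)] assms(4))

lemma polyF_map_poly: "sfield F \<Longrightarrow> hom_on F h \<Longrightarrow> p \<in> polyF F \<Longrightarrow> map_poly h p \<in> polyF (h ` F)"
  by (auto simp: polyF_def coeff_map_poly_hom)

text \<open>Long division only ever forms quotients of leading coefficients, and these stay in
  \<open>F\<close>.\<close>

lemma polyF_division:
  assumes "sfield F" "p \<in> polyF F" "p \<noteq> 0" "q \<in> polyF F"
  obtains s r where "s \<in> polyF F" "r \<in> polyF F" "q = s * p + r" "r = 0 \<or> degree r < degree p"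
proof -
  have "\<exists>s\<in>polyF F. \<exists>r\<in>polyF F. q = s * p + r \<and> (r = 0 \<or> degree r < degree p)"
    using assms(4)
  proof (induction "degree q" arbitrary: q rule: less_induct)
    case less
    show ?case
    proof (cases "q = 0 \<or> degree q < degree p")
      case True
      then show ?thesis using less.prems polyF_0[OF assms(1)] by force
    next
      case False
      define t where "t = monom (lead_coeff q / lead_coeff p) (degree q - degree p)"
      have t: "t \<in> polyF F" unfolding t_def
        by (rule polyF_monom[OF assms(1)])
           (rule sfield_divide[OF assms(1) polyFD[OF less.prems] polyFD[OF assms(2)]])
      have q': "q - t * p \<in> polyF F"
        by (intro polyF_intros[OF assms(1)] t assms(2) less.prems)
      have dt: "degree (t * p) = degree q" "lead_coeff (t * p) = lead_coeff q"
      proof -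
        have "t \<noteq> 0" using False assms(3) by (simp add: t_def)
        then show "degree (t * p) = degree q"
          using False assms(3) by (subst degree_mult_eq) (auto simp: t_def degree_monom_eq)
        show "lead_coeff (t * p) = lead_coeff q"
          using assms(3) unfolding lead_coeff_mult t_def lead_coeff_monom by simp
      qed
      have "q - t * p = 0 \<or> degree (q - t * p) < degree q"
      proof (rule disjCI)
        assume a: "\<not> degree (q - t * p) < degree q"
        have le: "degree (q - t * p) \<le> degree q"
          using degree_diff_le[of q "degree q" "t * p"] dt by simp
        then have "lead_coeff (q - t * p) = 0"
          using a dt by (metis cancel_comm_monoid_add_class.diff_cancel coeff_diff le_antisym linorder_not_less)
        then show "q - t * p = 0" using leading_coeff_0_iff by blast
      qed
      then show ?thesis
      proof
        assume "q - t * p = 0"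
        then show ?thesis using t polyF_0[OF assms(1)] by (intro bexI[of _ t] bexI[of _ 0]) auto
      next
        assume "degree (q - t * p) < degree q"
        from less.hyps[OF this q'] obtain s r where sr: "s \<in> polyF F" "r \<in> polyF F"
          "q - t * p = s * p + r" "r = 0 \<or> degree r < degree p" by blast
        then have "q = (t + s) * p + r" by (simp add: algebra_simps)
        then show ?thesis using sr polyF_add[OF assms(1) t sr(1)] by blast
      qed
    qed
  qed
  then show ?thesis using that by blast
qed

definition alg_over :: "'a::field set \<Rightarrow> 'a \<Rightarrow> bool" where
  "alg_over F z \<longleftrightarrow> (\<exists>p\<in>polyF F. p \<noteq> 0 \<and> poly p z = 0)"

lemma alg_over_mono: "alg_over F z \<Longrightarrow> F \<subseteq> G \<Longrightarrow> alg_over G z"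
  using polyF_mono unfolding alg_over_def by blast

definition min_poly_over :: "'a::field set \<Rightarrow> 'a \<Rightarrow> 'a poly \<Rightarrow> bool" where
  "min_poly_over F z p \<longleftrightarrow> p \<in> polyF F \<and> lead_coeff p = 1 \<and> poly p z = 0 \<and>
     (\<forall>q\<in>polyF F. q \<noteq> 0 \<longrightarrow> poly q z = 0 \<longrightarrow> degree p \<le> degree q)"

lemma min_poly_over_exists:
  assumes "sfield F" "alg_over F z"
  obtains p where "min_poly_over F z p"
proof -
  obtain p where p: "p \<in> polyF F \<and> p \<noteq> 0 \<and> poly p z = 0"
    and m: "\<And>q. q \<in> polyF F \<and> q \<noteq> 0 \<and> poly q z = 0 \<Longrightarrow> degree p \<le> degree q"
    using ex_has_least_nat[of "\<lambda>p. p \<in> polyF F \<and> p \<noteq> 0 \<and> poly p z = 0" _ degree] assms(2)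
    unfolding alg_over_def by metis
  have "min_poly_over F z (smult (inverse (lead_coeff p)) p)"
    using p m unfolding min_poly_over_def
    by (auto intro!: polyF_smult[OF assms(1)] sfield_inverse[OF assms(1)] polyFD)
  then show ?thesis by (rule that)
qed

lemma min_poly_over_dvd:
  assumes "sfield F" "min_poly_over F z p" "q \<in> polyF F" "poly q z = 0"
  obtains s where "s \<in> polyF F" "q = s * p"
proof -
  have p: "p \<in> polyF F" "p \<noteq> 0" "poly p z = 0"
    using assms(2) by (auto simp: min_poly_over_def)
  obtain s r where sr: "s \<in> polyF F" "r \<in> polyF F" "q = s * p + r" "r = 0 \<or> degree r < degree p"
    by (rule polyF_division[OF assms(1) p(1,2) assms(3)])
  have "poly r z = 0" using sr(3) p(3) assms(4) by simp
  then have "r = 0" using sr(2,4) assms(2) by (auto simp: min_poly_over_def)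
  then show ?thesis using that sr by simp
qed

lemma min_poly_over_degree_pos:
  assumes "min_poly_over F z p" shows "degree p > 0"
proof (rule ccontr)
  assume "\<not> degree p > 0"
  then obtain c where "p = [:c:]" using degree_eq_zeroE by blast
  then show False using assms by (auto simp: min_poly_over_def)
qed

lemma simple_alg_extension:
  assumes F: "sfield F" and "alg_over F z"
  shows "gen (insert z F) = {poly q z |q. q \<in> polyF F}"
proof -
  let ?S = "{poly q z |q. q \<in> polyF F}"
  obtain p where p: "min_poly_over F z p" using min_poly_over_exists[OF assms] .
  then have pF: "p \<in> polyF F" "p \<noteq> 0" "poly p z = 0" by (auto simp: min_poly_over_def)
  have inv: "inverse u \<in> ?S" if "u \<in> ?S" for u
  proof (cases "u = 0")
    case True
    then show ?thesis using polyF_0[OF F] by (auto intro!: exI[of _ 0])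
  next
    case False
    obtain q where q: "q \<in> polyF F" "u = poly q z" using \<open>u \<in> ?S\<close> by auto
    \<comment> \<open>\<open>r\<close> ranges over polynomials of degree below \<open>p\<close>
      whose value at \<open>z\<close> is a multiple of \<open>u\<close>. One of least degree divides
      \<open>p\<close>, since the remainder of \<open>p\<close> would be a smaller one; minimality
      of \<open>p\<close> then forces it to be constant, which exhibits
      \<open>inverse u\<close>.\<close>
    let ?P = "\<lambda>r. r \<in> polyF F \<and> r \<noteq> 0 \<and> degree r < degree p \<and> (\<exists>a\<in>polyF F. poly r z = poly a z * u)"
    obtain s r where sr: "s \<in> polyF F" "r \<in> polyF F" "q = s * p + r" "r = 0 \<or> degree r < degree p"
      by (rule polyF_division[OF F pF(1,2) q(1)])
    have "poly r z = u" using sr pF q by simp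
    then have "?P r" using sr False polyF_1[OF F] by (auto intro!: bexI[of _ 1])
    then obtain r where r: "?P r" and m: "\<And>r'. ?P r' \<Longrightarrow> degree r \<le> degree r'"
      using ex_has_least_nat[of ?P r degree] by blast
    then obtain a where a: "a \<in> polyF F" "poly r z = poly a z * u" by blast
    obtain s r2 where s: "s \<in> polyF F" "r2 \<in> polyF F" "p = s * r + r2" "r2 = 0 \<or> degree r2 < degree r"
      using polyF_division[OF F, of r p] r pF by metis
    have "poly r2 z = poly (- s * a) z * u" using s(3) pF(3) a(2) by (simp add: eq_neg_iff_add_eq_0 algebra_simps)
    moreover have "- s * a \<in> polyF F" by (intro polyF_intros[OF F] s a)
    ultimately have "r2 = 0" using m[of r2] s r by fastforce
    have rz: "poly r z \<noteq> 0" using r p by (auto simp: min_poly_over_def)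
    then have "poly s z = 0" using s(3) \<open>r2 = 0\<close> pF(3) by simp
    moreover have "s \<noteq> 0" using s(3) \<open>r2 = 0\<close> pF(2) by auto
    ultimately have "degree p \<le> degree s" using p s(1) by (auto simp: min_poly_over_def)
    then have "degree r = 0" using s(3) \<open>r2 = 0\<close> \<open>s \<noteq> 0\<close> r by (simp add: degree_mult_eq)
    then obtain c where c: "r = [:c:]" using degree_eq_zeroE by blast
    then have "c \<noteq> 0" "c \<in> F" using r polyFD[of r F 0] by auto
    have "c = poly a z * u" using a(2) c by simp
    then have "inverse u = poly (smult (inverse c) a) z"
      using \<open>c \<noteq> 0\<close> False by (simp add: field_simps)
    moreover have "smult (inverse c) a \<in> polyF F"
      by (intro polyF_intros[OF F] sfield_inverse[OF F] \<open>c \<in> F\<close> a)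
    ultimately show ?thesis by blast
  qed
  have S: "sfield ?S"
    unfolding sfield_def
  proof (intro conjI ballI inv)
    show "1 \<in> ?S" using polyF_1[OF F] by (auto intro!: exI[of _ 1])
  next
    fix a b assume "a \<in> ?S" "b \<in> ?S"
    then obtain q r where "q \<in> polyF F" "r \<in> polyF F" "a = poly q z" "b = poly r z" by auto
    then show "a - b \<in> ?S" "a * b \<in> ?S"
      using polyF_diff[OF F, of q r] polyF_mult[OF F, of q r] by (force simp flip: poly_mult)+
  qed
  show ?thesis
  proof
    show "gen (insert z F) \<subseteq> ?S"
    proof (rule gen_least[OF S], rule subsetI)
      fix a assume "a \<in> insert z F"
      then consider "a = z" | "a \<in> F" by auto
      then show "a \<in> ?S"
      proof cases
        case 1
        then show ?thesis using polyF_pCons[OF F sfield_0[OF F] polyF_1[OF F]]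
          by (auto intro!: exI[of _ "pCons 0 1"])
      next
        case 2
        then show ?thesis using polyF_pCons[OF F 2 polyF_0[OF F]] by (auto intro!: exI[of _ "[:a:]"])
      qed
    qed
    have "polyF F \<subseteq> polyF (gen (insert z F))"
      using gen_superset[of "insert z F"] by (intro polyF_mono) auto
    then show "?S \<subseteq> gen (insert z F)"
      using polyF_poly[OF sfield_gen, of _ "insert z F" z] gen_incl[of z "insert z F"] by auto
  qed
qed

text \<open>Polynomials with equal values at \<open>z\<close> differ by a multiple of
  \<open>p\<close>, and the image of \<open>p\<close> vanishes at \<open>z'\<close>; so the value of
  the mapped polynomial at \<open>z'\<close> does not depend on the polynomial that represents an
  element.\<close>

lemma hom_extend_simple:
  assumes F: "sfield F" and h: "hom_on F h" and p: "min_poly_over F z p"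
    and z': "poly (map_poly h p) z' = 0"
  obtains h' where "hom_on (gen (insert z F)) h'" "\<And>a. a \<in> F \<Longrightarrow> h' a = h a" "h' z = z'"
proof -
  have wd: "poly (map_poly h q) z' = poly (map_poly h r) z'"
    if qF: "q \<in> polyF F" and rF: "r \<in> polyF F" and eq: "poly q z = poly r z" for q r
  proof -
    obtain s where s: "s \<in> polyF F" "q - r = s * p"
      using min_poly_over_dvd[OF F p polyF_diff[OF F qF rF]] eq by (metis poly_diff right_minus_eq)
    have pF: "p \<in> polyF F" using p by (simp add: min_poly_over_def)
    have "map_poly h q - map_poly h r = map_poly h s * map_poly h p"
      using map_poly_hom_mult[OF F h s(1) pF] map_poly_hom_diff[OF F h qF rF] s(2) by simp
    then have "poly (map_poly h q) z' - poly (map_poly h r) z' = 0"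
      using z' by (metis mult_zero_right poly_diff poly_mult)
    then show ?thesis by simp
  qed
  have alg: "alg_over F z"
    using p leading_coeff_0_iff[of p] unfolding min_poly_over_def alg_over_def
    by (metis zero_neq_one)
  define h' where "h' u = poly (map_poly h (SOME q. q \<in> polyF F \<and> poly q z = u)) z'" for u
  have h': "h' (poly q z) = poly (map_poly h q) z'" if "q \<in> polyF F" for q
    unfolding h'_def
    by (rule wd) (use someI[of "\<lambda>r. r \<in> polyF F \<and> poly r z = poly q z" q] that in auto)
  show ?thesis
  proof
    show "hom_on (gen (insert z F)) h'"
      unfolding hom_on_def simple_alg_extension[OF F alg]
    proof (intro conjI ballI)
      show "h' 1 = 1" using h'[OF polyF_1[OF F]] hom_on_1[OF F h] by simp
    next
      fix a b assume "a \<in> {poly q z |q. q \<in> polyF F}" "b \<in> {poly q z |q. q \<in> polyF F}"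
      then obtain q r where qr: "q \<in> polyF F" "r \<in> polyF F" "a = poly q z" "b = poly r z" by auto
      show "h' (a + b) = h' a + h' b"
        using h'[OF polyF_add[OF F qr(1,2)]] h'[OF qr(1)] h'[OF qr(2)] qr
        by (simp add: map_poly_hom_add[OF F h])
      show "h' (a * b) = h' a * h' b"
        using h'[OF polyF_mult[OF F qr(1,2)]] h'[OF qr(1)] h'[OF qr(2)] qr
        by (simp add: map_poly_hom_mult[OF F h])
    qed
    show "h' a = h a" if "a \<in> F" for a
      using h'[OF polyF_pCons[OF F that polyF_0[OF F]]] by (simp add: map_poly_hom_pCons[OF F h])
    show "h' z = z'"
      using h'[OF polyF_pCons[OF F sfield_0[OF F] polyF_1[OF F]]] hom_onD(1,2)[OF F h]
      by (simp add: map_poly_hom_pCons[OF F h])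
  qed
qed

section \<open>Graphs of homomorphisms and extension by Zorn's lemma\<close>

definition hom_graph :: "('a::field \<times> 'b::field) set \<Rightarrow> bool" where
  "hom_graph \<Gamma> \<longleftrightarrow> (\<exists>F h. sfield F \<and> hom_on F h \<and> \<Gamma> = (\<lambda>a. (a, h a)) ` F)"

text \<open>These conditions involve at most two pairs at a time and therefore survive unions of
  chains. Single-valuedness is reduced to the fibre over 0 by taking differences.\<close>

lemma hom_graph_iff:
  "hom_graph \<Gamma> \<longleftrightarrow> (1, 1) \<in> \<Gamma> \<and> (\<forall>b. (0, b) \<in> \<Gamma> \<longrightarrow> b = 0) \<and>
     (\<forall>a b c d. (a, b) \<in> \<Gamma> \<longrightarrow> (c, d) \<in> \<Gamma> \<longrightarrow>
        (a - c, b - d) \<in> \<Gamma> \<and> (a * c, b * d) \<in> \<Gamma> \<and> (inverse a, inverse b) \<in> \<Gamma>)"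
  (is "_ \<longleftrightarrow> ?R")
proof
  assume "hom_graph \<Gamma>"
  then obtain F h where F: "sfield F" and h: "hom_on F h" and \<Gamma>: "\<Gamma> = (\<lambda>a. (a, h a)) ` F"
    by (auto simp: hom_graph_def)
  show ?R unfolding \<Gamma>
  proof (intro conjI allI impI)
    note H = hom_onD[OF F h] and S = sfield_intros[OF F]
    have mem: "(a, b) \<in> (\<lambda>a. (a, h a)) ` F \<longleftrightarrow> a \<in> F \<and> b = h a" for a b by auto
    show "(1, 1) \<in> (\<lambda>a. (a, h a)) ` F" unfolding mem using H(2) S(2) by simp
    show "b = 0" if "(0, b) \<in> (\<lambda>a. (a, h a)) ` F" for b using that H(1) unfolding mem by simp
    fix a b c d assume "(a, b) \<in> (\<lambda>a. (a, h a)) ` F" "(c, d) \<in> (\<lambda>a. (a, h a)) ` F"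
    then have "a \<in> F" "b = h a" "c \<in> F" "d = h c" unfolding mem by auto
    then show "(a - c, b - d) \<in> (\<lambda>a. (a, h a)) ` F" "(a * c, b * d) \<in> (\<lambda>a. (a, h a)) ` F"
      "(inverse a, inverse b) \<in> (\<lambda>a. (a, h a)) ` F"
      unfolding mem using H(4,6,8) S(3,6,7) by simp_all
  qed
next
  assume R: ?R
  then have one: "(1, 1) \<in> \<Gamma>" and z: "\<And>b. (0, b) \<in> \<Gamma> \<Longrightarrow> b = 0"
    and di: "\<And>a b c d. (a, b) \<in> \<Gamma> \<Longrightarrow> (c, d) \<in> \<Gamma> \<Longrightarrow> (a - c, b - d) \<in> \<Gamma>"
    and mu: "\<And>a b c d. (a, b) \<in> \<Gamma> \<Longrightarrow> (c, d) \<in> \<Gamma> \<Longrightarrow> (a * c, b * d) \<in> \<Gamma>"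
    and iv: "\<And>a b. (a, b) \<in> \<Gamma> \<Longrightarrow> (inverse a, inverse b) \<in> \<Gamma>" by blast+
  have sv: "b = d" if "(a, b) \<in> \<Gamma>" "(a, d) \<in> \<Gamma>" for a b d
    using z[of "b - d"] di[OF that] by simp
  define h where "h a = (THE b. (a, b) \<in> \<Gamma>)" for a
  have h: "h a = b" if "(a, b) \<in> \<Gamma>" for a b
    unfolding h_def using that sv by (intro the_equality) auto
  have z0: "(0, 0) \<in> \<Gamma>" using di[OF one one] by simp
  have ad: "(a + c, b + d) \<in> \<Gamma>" if "(a, b) \<in> \<Gamma>" "(c, d) \<in> \<Gamma>" for a b c d
    using di[OF that(1) di[OF z0 that(2)]] by simp
  have "sfield (Domain \<Gamma>)"
    unfolding sfield_def
  proof (intro conjI ballI)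
    show "1 \<in> Domain \<Gamma>" using one by (rule DomainI)
    fix a assume "a \<in> Domain \<Gamma>"
    then obtain b where ab: "(a, b) \<in> \<Gamma>" by auto
    show "inverse a \<in> Domain \<Gamma>" by (rule DomainI[OF iv[OF ab]])
    fix c assume "c \<in> Domain \<Gamma>"
    then obtain d where cd: "(c, d) \<in> \<Gamma>" by auto
    show "a - c \<in> Domain \<Gamma>" by (rule DomainI[OF di[OF ab cd]])
    show "a * c \<in> Domain \<Gamma>" by (rule DomainI[OF mu[OF ab cd]])
  qed
  moreover have "hom_on (Domain \<Gamma>) h"
    unfolding hom_on_def
  proof (intro conjI ballI)
    show "h 1 = 1" by (rule h[OF one])
    fix a c assume "a \<in> Domain \<Gamma>" "c \<in> Domain \<Gamma>"
    then obtain b d where "(a, b) \<in> \<Gamma>" "(c, d) \<in> \<Gamma>" by auto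
    then show "h (a + c) = h a + h c" "h (a * c) = h a * h c"
      using h[of a b] h[of c d] h[OF ad[of a b c d]] h[OF mu[of a b c d]] by simp_all
  qed
  moreover have "\<Gamma> = (\<lambda>a. (a, h a)) ` Domain \<Gamma>"
  proof (intro equalityI subsetI)
    fix u assume "u \<in> \<Gamma>"
    then show "u \<in> (\<lambda>a. (a, h a)) ` Domain \<Gamma>" using h[of "fst u" "snd u"] by (cases u) auto
  next
    fix u assume "u \<in> (\<lambda>a. (a, h a)) ` Domain \<Gamma>"
    then obtain a b where "(a, b) \<in> \<Gamma>" "u = (a, h a)" by auto
    then show "u \<in> \<Gamma>" using h by simp
  qed
  ultimately show "hom_graph \<Gamma>" unfolding hom_graph_def by blast
qed

lemma hom_graph_chain_Union:
  assumes "CC \<noteq> {}" "\<And>\<Gamma> \<Delta>. \<Gamma> \<in> CC \<Longrightarrow> \<Delta> \<in> CC \<Longrightarrow> \<Gamma> \<subseteq> \<Delta> \<or> \<Delta> \<subseteq> \<Gamma>" "\<And>\<Gamma>. \<Gamma> \<in> CC \<Longrightarrow> hom_graph \<Gamma>"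
  shows "hom_graph (\<Union> CC)"
  unfolding hom_graph_iff
proof (intro conjI allI impI)
  show "(1, 1) \<in> \<Union> CC"
    using assms(1,3) by (auto simp: hom_graph_iff)
  show "b = 0" if b: "(0, b) \<in> \<Union> CC" for b
  proof -
    obtain \<Gamma> where "\<Gamma> \<in> CC" "(0, b) \<in> \<Gamma>" using b by blast
    then show ?thesis using assms(3)[of \<Gamma>] by (simp add: hom_graph_iff)
  qed
  fix a b c d assume "(a, b) \<in> \<Union> CC" "(c, d) \<in> \<Union> CC"
  then obtain \<Gamma>1 \<Gamma>2 where "\<Gamma>1 \<in> CC" "(a, b) \<in> \<Gamma>1" "\<Gamma>2 \<in> CC" "(c, d) \<in> \<Gamma>2" by blast
  with assms(2)[of \<Gamma>1 \<Gamma>2] obtain \<Gamma> where g: "\<Gamma> \<in> CC" "(a, b) \<in> \<Gamma>" "(c, d) \<in> \<Gamma>" by blast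
  have "(a - c, b - d) \<in> \<Gamma> \<and> (a * c, b * d) \<in> \<Gamma> \<and> (inverse a, inverse b) \<in> \<Gamma>"
    using assms(3)[OF g(1)] g(2,3) unfolding hom_graph_iff by simp
  then show "(a - c, b - d) \<in> \<Union> CC" "(a * c, b * d) \<in> \<Union> CC" "(inverse a, inverse b) \<in> \<Union> CC"
    using g(1) by blast+
qed

text \<open>The domain of a maximal extension contains \<open>T\<close>: a missing element would be
  algebraic over it, the mapped minimal polynomial has a root in the algebraically closed target,
  and \<open>hom_extend_simple\<close> would give a larger graph.\<close>

lemma hom_extend_algebraic:
  fixes h :: "'a::field \<Rightarrow> 'b::alg_closed_field"
  assumes F: "sfield F" and h: "hom_on F h" and alg: "\<And>z. z \<in> T \<Longrightarrow> alg_over F z"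
  obtains h' where "hom_on (gen (F \<union> T)) h'" "\<And>a. a \<in> F \<Longrightarrow> h' a = h a"
proof -
  define A where "A = gen (F \<union> T)"
  have A: "sfield A" "F \<subseteq> A" "T \<subseteq> A" unfolding A_def by (auto intro: gen_incl)
  let ?G = "(\<lambda>a. (a, h a)) ` F"
  define AA where "AA = {\<Gamma>. hom_graph \<Gamma> \<and> ?G \<subseteq> \<Gamma> \<and> Domain \<Gamma> \<subseteq> A}"
  have "?G \<in> AA" using F h A by (auto simp: AA_def hom_graph_def)
  have "\<exists>M\<in>AA. \<forall>Y\<in>AA. M \<subseteq> Y \<longrightarrow> Y = M"
  proof (rule subset_Zorn_nonempty)
    show "AA \<noteq> {}" using \<open>?G \<in> AA\<close> by auto
    fix CC assume CC: "CC \<noteq> {}" "subset.chain AA CC"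
    then have "hom_graph (\<Union> CC)"
      by (intro hom_graph_chain_Union) (auto simp: subset_chain_def AA_def)
    moreover have "?G \<subseteq> \<Union> CC" "Domain (\<Union> CC) \<subseteq> A"
      using CC unfolding AA_def subset_chain_def by blast+
    ultimately show "\<Union> CC \<in> AA" unfolding AA_def by blast
  qed
  then obtain M where M: "M \<in> AA" and max: "\<And>Y. Y \<in> AA \<Longrightarrow> M \<subseteq> Y \<Longrightarrow> Y = M" by blast
  obtain S g where S: "sfield S" and g: "hom_on S g" and Meq: "M = (\<lambda>a. (a, g a)) ` S"
    using M by (auto simp: AA_def hom_graph_def)
  have mem: "(a, b) \<in> M \<longleftrightarrow> a \<in> S \<and> b = g a" for a b unfolding Meq by auto
  have GM: "(a, h a) \<in> M" if "a \<in> F" for a using M that unfolding AA_def by blast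
  then have FS: "F \<subseteq> S" and gh: "\<And>a. a \<in> F \<Longrightarrow> g a = h a" unfolding mem by auto
  have SA: "S \<subseteq> A"
  proof
    fix a assume "a \<in> S"
    then have "a \<in> Domain M" by (intro DomainI[of a "g a"]) (simp add: mem)
    then show "a \<in> A" using M by (auto simp: AA_def)
  qed
  have "z \<in> S" if zT: "z \<in> T" for z
  proof -
    have z: "z \<in> A" using zT A(3) by auto
    obtain p where p: "min_poly_over S z p"
      using min_poly_over_exists[OF S alg_over_mono[OF alg[OF zT] FS]] .
    have "degree (map_poly g p) > 0"
      using min_poly_over_degree_pos[OF p] p map_poly_hom_degree[OF S g, of p]
      by (simp add: min_poly_over_def)
    then obtain z' where "poly (map_poly g p) z' = 0"
      using alg_closed_imp_poly_has_root by blast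
    then obtain g' where g': "hom_on (gen (insert z S)) g'" "\<And>a. a \<in> S \<Longrightarrow> g' a = g a"
      using hom_extend_simple[OF S g p] by metis
    let ?Y = "(\<lambda>a. (a, g' a)) ` gen (insert z S)"
    have sub: "insert z S \<subseteq> gen (insert z S)" by (rule gen_superset)
    have "gen (insert z S) \<subseteq> A" by (rule gen_least) (use A z SA in auto)
    moreover have "(a, h a) \<in> ?Y" if "a \<in> F" for a
      using that FS sub g'(2)[of a] gh[OF that] by (intro image_eqI[of _ _ a]) auto
    moreover have "hom_graph ?Y"
      unfolding hom_graph_def using g'(1) sfield_gen by blast
    ultimately have "?Y \<in> AA" by (auto simp: AA_def)
    moreover have "(a, g a) \<in> ?Y" if "a \<in> S" for a
      using that sub g'(2)[of a] by (intro image_eqI[of _ _ a]) auto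
    then have "M \<subseteq> ?Y" unfolding Meq by blast
    ultimately have "?Y = M" by (rule max)
    moreover have "(z, g' z) \<in> ?Y" using sub by blast
    ultimately show "z \<in> S" using mem by blast
  qed
  then have "A \<subseteq> S" unfolding A_def using FS by (intro gen_least[OF S]) auto
  then show ?thesis using that hom_on_subset[OF g] gh unfolding A_def by blast
qed

subsection \<open>Rational functions and Moebius transformations\<close>

abbreviation ev :: "('k::field \<Rightarrow> 'u::field) \<Rightarrow> 'k poly \<Rightarrow> 'u \<Rightarrow> 'u" where
  "ev e p x \<equiv> poly (map_poly e p) x"

lemma ev_hom:
  assumes e: "hom_on UNIV e"
  shows "ev e 0 x = 0" "ev e 1 x = 1"
    "\<And>p q. ev e (p + q) x = ev e p x + ev e q x"
    "\<And>p q. ev e (p - q) x = ev e p x - ev e q x"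
    "\<And>p q. ev e (p * q) x = ev e p x * ev e q x"
    "\<And>a p. ev e (smult a p) x = e a * ev e p x"
    "\<And>a p. ev e (pCons a p) x = e a + x * ev e p x"
    "\<And>p n. ev e (p ^ n) x = ev e p x ^ n"
proof -
  note U = sfield_UNIV
  show 0: "ev e 0 x = 0" "ev e 1 x = 1" using hom_on_1[OF U e] by simp_all
  show "\<And>p q. ev e (p + q) x = ev e p x + ev e q x" "\<And>p q. ev e (p - q) x = ev e p x - ev e q x"
    by (simp_all add: map_poly_hom_add[OF U e] map_poly_hom_diff[OF U e])
  show m: "\<And>p q. ev e (p * q) x = ev e p x * ev e q x"
    by (simp add: map_poly_hom_mult[OF U e])
  show "\<And>a p. ev e (smult a p) x = e a * ev e p x" "\<And>a p. ev e (pCons a p) x = e a + x * ev e p x"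
    by (simp_all add: map_poly_hom_smult[OF U e] map_poly_hom_pCons[OF U e])
  show "\<And>p n. ev e (p ^ n) x = ev e p x ^ n"
    subgoal for p n using 0 m by (induction n) auto
    done
qed

lemma ev_sum: "hom_on UNIV e \<Longrightarrow> ev e (sum f A) x = (\<Sum>i\<in>A. ev e (f i) x)"
  by (induction A rule: infinite_finite_induct) (auto simp: ev_hom)

lemma ev_const: "hom_on UNIV e \<Longrightarrow> ev e p (e a) = e (poly p a)"
  using hom_on_poly[OF sfield_UNIV, of e p a] by simp

lemma sfield_range: "hom_on UNIV e \<Longrightarrow> sfield (range e)"
  by (rule hom_on_image) auto

lemma ev_mem_gen: "hom_on UNIV e \<Longrightarrow> ev e p x \<in> gen (insert x (range e))"
proof -
  assume e: "hom_on UNIV e"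
  have "map_poly e p \<in> polyF (range e)" using polyF_map_poly[OF sfield_UNIV e] by simp
  moreover have "range e \<subseteq> gen (insert x (range e))" by (auto intro: gen_incl)
  ultimately have "map_poly e p \<in> polyF (gen (insert x (range e)))" using polyF_mono by blast
  then show ?thesis by (rule polyF_poly[OF sfield_gen]) (simp add: gen_incl)
qed

lemma transcendentalD: "transcendental_over e x \<Longrightarrow> p \<noteq> 0 \<Longrightarrow> ev e p x \<noteq> 0"
  by (simp add: transcendental_over_def)

lemma ev_eq_iff:
  assumes "hom_on UNIV e" "transcendental_over e x"
  shows "ev e p x = ev e q x \<longleftrightarrow> p = q"
  using transcendentalD[OF assms(2), of "p - q"] by (auto simp: ev_hom[OF assms(1)])

lemma rational_functions:
  assumes e: "hom_on UNIV e" and x: "transcendental_over e x"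
  shows "gen (insert x (range e)) = {ev e p x / ev e q x |p q. q \<noteq> 0}" (is "_ = ?S")
proof
  note E = ev_hom[OF e] and T = transcendentalD[OF x]
  have "sfield ?S"
    unfolding sfield_def
  proof (intro conjI ballI)
    show "1 \<in> ?S" using E(2) by (auto intro!: exI[of _ 1])
  next
    fix a assume "a \<in> ?S"
    then obtain p q where a: "a = ev e p x / ev e q x" "q \<noteq> 0" by auto
    have "inverse a = ev e q x / ev e p x" using a by simp
    then show "inverse a \<in> ?S"
    proof (cases "p = 0")
      case True
      then have "inverse a = ev e 0 x / ev e 1 x" using a by (simp add: E)
      then show ?thesis using one_neq_zero by blast
    qed blast
    fix b assume "b \<in> ?S"
    then obtain r s where b: "b = ev e r x / ev e s x" "s \<noteq> 0" by auto
    have "a - b = ev e (p * s - r * q) x / ev e (q * s) x"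
      using T[OF a(2)] T[OF b(2)] unfolding a(1) b(1) by (simp add: E diff_frac_eq)
    then show "a - b \<in> ?S" using a(2) b(2) by (intro CollectI exI[of _ "p * s - r * q"] exI[of _ "q * s"]) auto
    have "a * b = ev e (p * r) x / ev e (q * s) x"
      using a b by (simp add: E)
    then show "a * b \<in> ?S" using a(2) b(2) by (intro CollectI exI[of _ "p * r"] exI[of _ "q * s"]) auto
  qed
  moreover have "insert x (range e) \<subseteq> ?S"
  proof
    fix a assume "a \<in> insert x (range e)"
    then consider "a = x" | c where "a = e c" by auto
    then show "a \<in> ?S"
    proof cases
      case 1
      then show ?thesis using hom_onD(1,2)[OF sfield_UNIV e]
        by (intro CollectI exI[of _ "[:0, 1:]"] exI[of _ 1]) (simp add: E)
    next
      case 2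
      then show ?thesis by (intro CollectI exI[of _ "[:c:]"] exI[of _ 1]) (simp add: E)
    qed
  qed
  ultimately show "gen (insert x (range e)) \<subseteq> ?S" by (rule gen_least)
  show "?S \<subseteq> gen (insert x (range e))"
    using ev_mem_gen[OF e] sfield_divide[OF sfield_gen] by blast
qed

lemma rational_functionE:
  assumes "hom_on UNIV e" "transcendental_over e x" "z \<in> gen (insert x (range e))"
  obtains p q where "q \<noteq> 0" "ev e q x \<noteq> 0" "z = ev e p x / ev e q x"
  using assms(3) transcendentalD[OF assms(2)] unfolding rational_functions[OF assms(1,2)] by blast

section \<open>Reduced fractions and homogenization\<close>

lemma poly_bezout:
  fixes p q :: "'k::field poly"
  assumes "q \<noteq> 0"
  obtains d p' q' u v where "d \<noteq> 0" "p = p' * d" "q = q' * d" "u * p' + v * q' = 1"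
proof -
  \<comment> \<open>A nonzero element of least degree in the ideal of \<open>p\<close> and
    \<open>q\<close>: it divides both, and cancelling it in its own representation leaves coprime
    cofactors.\<close>
  let ?P = "\<lambda>d. d \<noteq> 0 \<and> (\<exists>u v. d = u * p + v * q)"
  have "q = 0 * p + 1 * q" by simp
  then have "?P q" using assms by blast
  then obtain d where d: "?P d" and m: "\<And>d'. ?P d' \<Longrightarrow> degree d \<le> degree d'"
    using ex_has_least_nat[of ?P q degree] by blast
  then obtain u v where uv: "d = u * p + v * q" by blast
  have dv: "d dvd f" if ex: "\<exists>a b. f = a * p + b * q" for f
  proof (rule ccontr)
    assume n: "\<not> d dvd f"
    obtain a b where f: "f = a * p + b * q" using ex by blast
    have "f mod d = (a - (f div d) * u) * p + (b - (f div d) * v) * q"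
      using minus_div_mult_eq_mod[of f d] f uv by (simp add: algebra_simps)
    moreover have "f mod d \<noteq> 0" using n by (simp add: dvd_eq_mod_eq_0)
    ultimately have "degree d \<le> degree (f mod d)" using m by blast
    then show False using degree_mod_less'[of d f] d n by (simp add: dvd_eq_mod_eq_0)
  qed
  have "p = 1 * p + 0 * q" by simp
  then have "d dvd p" using dv by blast
  then obtain p' where p': "p = d * p'" by (rule dvdE)
  have "d dvd q" using dv \<open>q = 0 * p + 1 * q\<close> by blast
  then obtain q' where q': "q = d * q'" by (rule dvdE)
  have "d * (u * p' + v * q') = d * 1" using uv p' q' by (simp add: algebra_simps)
  then have "u * p' + v * q' = 1" using d by (subst (asm) mult_cancel_left) auto
  then show ?thesis using that[of d p' q' u v] d p' q' by (simp add: mult.commute)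
qed

lemma rational_function_reducedE:
  assumes "hom_on UNIV e" "transcendental_over e x" "z \<in> gen (insert x (range e))"
  obtains p q u v where "q \<noteq> 0" "ev e q x \<noteq> 0" "z = ev e p x / ev e q x" "u * p + v * q = 1"
proof -
  obtain p q where pq: "q \<noteq> 0" "ev e q x \<noteq> 0" "z = ev e p x / ev e q x"
    by (rule rational_functionE[OF assms])
  obtain d p' q' u v where d: "d \<noteq> 0" "p = p' * d" "q = q' * d" "u * p' + v * q' = 1"
    by (rule poly_bezout[OF pq(1)])
  show ?thesis
    by (rule that[OF _ _ _ d(4)])
      (use pq d transcendentalD[OF assms(2)] in \<open>auto simp: ev_hom[OF assms(1)]\<close>)
qed

text \<open>Multiplying the Bezout identity by the remaining product drops one power of
  \<open>q\<close> at a time.\<close>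

lemma bezout_dvd_power_cancel:
  fixes p q :: "'k::field poly"
  assumes "u * p + v * q = 1" "p dvd q ^ n * m"
  shows "p dvd m"
  using assms(2)
proof (induction n)
  case (Suc n)
  have "q ^ n * m = p * (u * q ^ n * m) + v * (q ^ Suc n * m)"
    using arg_cong[OF assms(1), of "\<lambda>z. z * (q ^ n * m)"] by (simp add: algebra_simps)
  then have "p dvd q ^ n * m"
    using Suc.prems by (metis dvd_add dvd_mult dvd_triv_left)
  then show ?case by (rule Suc.IH)
qed simp

text \<open>The form of degree \<open>n\<close> with the coefficients of \<open>f\<close>, evaluated
  at the pair \<open>(p, q)\<close>. If \<open>n\<close> exceeds the degree of \<open>f\<close>, the
  surplus counts as roots at infinity.\<close>

definition homogenize :: "nat \<Rightarrow> 'k::field poly \<Rightarrow> 'k poly \<Rightarrow> 'k poly \<Rightarrow> 'k poly" where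
  "homogenize n f p q = (\<Sum>i\<le>n. smult (coeff f i) (p ^ i * q ^ (n - i)))"

lemma ev_homogenize:
  assumes e: "hom_on UNIV e" and "degree f \<le> n" "ev e q x \<noteq> 0"
  shows "ev e (homogenize n f p q) x = ev e q x ^ n * ev e f (ev e p x / ev e q x)"
proof -
  have "ev e f z = (\<Sum>i\<le>n. e (coeff f i) * z ^ i)" for z
  proof -
    have "ev e f z = (\<Sum>i\<le>degree f. e (coeff f i) * z ^ i)"
      using map_poly_hom_degree[OF sfield_UNIV e, of f] coeff_map_poly_hom[OF sfield_UNIV e]
      by (simp add: poly_altdef)
    also have "\<dots> = (\<Sum>i\<le>n. e (coeff f i) * z ^ i)"
      by (rule sum.mono_neutral_left)
        (use assms(2) hom_on_0[OF sfield_UNIV e] in \<open>auto simp: coeff_eq_0\<close>)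
    finally show ?thesis .
  qed
  then show ?thesis
    unfolding homogenize_def ev_sum[OF e]
    by (simp add: ev_hom[OF e] sum_distrib_left power_divide power_diff assms(3))
       (simp add: ac_simps)
qed

text \<open>Modulo \<open>p\<close> only the term of index 0 survives; in the next lemma, modulo
  \<open>q\<close>, only the term of index \<open>n\<close> does.\<close>

lemma homogenize_dvd_first:
  "p dvd homogenize n f p q - smult (coeff f 0) (q ^ n)"
proof -
  have "homogenize n f p q - smult (coeff f 0) (q ^ n) =
      (\<Sum>i\<in>{..n} - {0}. smult (coeff f i) (p ^ i * q ^ (n - i)))"
    unfolding homogenize_def by (subst sum.remove[of "{..n}" 0]) auto
  also have "p dvd \<dots>"
    by (rule dvd_sum) (auto intro!: dvd_smult dvd_mult2 dvd_power)
  finally show ?thesis .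
qed

lemma homogenize_dvd_second:
  "q dvd homogenize n f p q - smult (coeff f n) (p ^ n)"
proof -
  have "homogenize n f p q - smult (coeff f n) (p ^ n) =
      (\<Sum>i\<in>{..n} - {n}. smult (coeff f i) (p ^ i * q ^ (n - i)))"
    unfolding homogenize_def by (subst sum.remove[of "{..n}" n]) auto
  also have "q dvd \<dots>"
    by (rule dvd_sum) (auto intro!: dvd_smult dvd_mult dvd_power)
  finally show ?thesis .
qed

text \<open>Both \<open>s\<close> and \<open>t\<close> are reduced fractions in each other; comparing the two shows that numerator
  and denominator of \<open>s\<close> divide polynomials of degree at most one.\<close>

lemma mutually_rational_moebius:
  fixes e :: "'k::field \<Rightarrow> 'u::field"
  assumes e: "hom_on UNIV e" and t: "transcendental_over e t" and s: "transcendental_over e s"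
    and st: "s \<in> gen (insert t (range e))" and ts: "t \<in> gen (insert s (range e))"
  obtains a b c d where "a * d - b * c \<noteq> 0" "e c * t + e d \<noteq> 0" "s * (e c * t + e d) = e a * t + e b"
proof -
  note E = ev_hom[OF e] and H = hom_onD[OF sfield_UNIV e]
  obtain p q u v where pq: "q \<noteq> 0" "ev e q t \<noteq> 0" "s = ev e p t / ev e q t" "u * p + v * q = 1"
    by (rule rational_function_reducedE[OF e t st])
  obtain P Q u' v' where PQ: "Q \<noteq> 0" "ev e Q s \<noteq> 0" "t = ev e P s / ev e Q s" "u' * P + v' * Q = 1"
    by (rule rational_function_reducedE[OF e s ts])
  define n where "n = max (degree P) (degree Q)"
  let ?P = "homogenize n P p q" and ?Q = "homogenize n Q p q"
  have "ev e ?P t = ev e q t ^ n * ev e P s" "ev e ?Q t = ev e q t ^ n * ev e Q s"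
    using ev_homogenize[OF e _ pq(2), of _ n p] unfolding pq(3)[symmetric] n_def by simp_all
  moreover have "t * ev e Q s = ev e P s" using PQ(2,3) by (metis nonzero_eq_divide_eq)
  ultimately have "ev e ([:0, 1:] * ?Q) t = ev e ?P t"
    unfolding E(5) by (simp add: E H ac_simps)
  \<comment> \<open>This is \<open>t * Q(s) = P(s)\<close> with the denominator \<open>q ^ n\<close>
    cleared; it is an identity of polynomials because \<open>t\<close> is transcendental.\<close>
  then have eq: "[:0, 1:] * ?Q = ?P" by (simp only: ev_eq_iff[OF e t])
  have lin: "degree ([:0, 1:] * [:B:] - [:A:] :: 'k poly) \<le> 1" for A B :: 'k
    by simp
  \<comment> \<open>Modulo \<open>p\<close> the identity leaves \<open>q ^ n\<close> times a linear
    polynomial, and \<open>q\<close> is coprime to \<open>p\<close>. The argument modulo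
    \<open>q\<close> below uses the coefficients of index \<open>n\<close>; they do not both vanish,
    as \<open>n\<close> is the larger degree.\<close>
  have "p dvd [:0, 1:] * (?Q - smult (coeff Q 0) (q ^ n)) - (?P - smult (coeff P 0) (q ^ n))"
    by (intro dvd_diff dvd_mult homogenize_dvd_first)
  also have "\<dots> = - (q ^ n * ([:0, 1:] * [:coeff Q 0:] - [:coeff P 0:]))"
    using eq by (simp add: algebra_simps)
  finally have "p dvd q ^ n * ([:0, 1:] * [:coeff Q 0:] - [:coeff P 0:])"
    by (subst (asm) dvd_minus_iff)
  then have "p dvd [:0, 1:] * [:coeff Q 0:] - [:coeff P 0:]"
    by (rule bezout_dvd_power_cancel[OF pq(4)])
  moreover have "[:0, 1:] * [:coeff Q 0:] - [:coeff P 0:] \<noteq> 0"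
    using arg_cong[OF PQ(4), of "\<lambda>f. coeff f 0"] by (auto simp: coeff_mult)
  ultimately have dp: "degree p \<le> 1"
    using dvd_imp_degree_le lin order_trans by blast
  have "q dvd [:0, 1:] * (?Q - smult (coeff Q n) (p ^ n)) - (?P - smult (coeff P n) (p ^ n))"
    by (intro dvd_diff dvd_mult homogenize_dvd_second)
  also have "\<dots> = - (p ^ n * ([:0, 1:] * [:coeff Q n:] - [:coeff P n:]))"
    using eq by (simp add: algebra_simps)
  finally have "q dvd p ^ n * ([:0, 1:] * [:coeff Q n:] - [:coeff P n:])"
    by (subst (asm) dvd_minus_iff)
  moreover have "v * q + u * p = 1" using pq(4) by (simp add: add.commute)
  ultimately have "q dvd [:0, 1:] * [:coeff Q n:] - [:coeff P n:]"
    using bezout_dvd_power_cancel by blast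
  moreover have "[:0, 1:] * [:coeff Q n:] - [:coeff P n:] \<noteq> 0"
  proof
    assume "[:0, 1:] * [:coeff Q n:] - [:coeff P n:] = 0"
    then have "coeff P n = 0" "coeff Q n = 0" by auto
    then have "P = 0 \<or> Q = 0" unfolding n_def max_def by (auto split: if_splits)
    then have "P = 0" using PQ(1) by simp
    then have "n = degree Q" by (simp add: n_def)
    then show False using \<open>coeff Q n = 0\<close> PQ(1) by simp
  qed
  ultimately have dq: "degree q \<le> 1"
    using dvd_imp_degree_le lin order_trans by blast
  define a b c d where abcd: "a = coeff p 1" "b = coeff p 0" "c = coeff q 1" "d = coeff q 0"
  have deg1: "f = [:coeff f 0, coeff f 1:]" if "degree f \<le> 1" for f :: "'k poly"
    using that by (intro poly_eqI) (auto simp: coeff_pCons coeff_eq_0 split: nat.split)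
  have p: "p = [:b, a:]" and q: "q = [:d, c:]"
    using deg1[OF dp] deg1[OF dq] by (simp_all add: abcd)
  have evp: "ev e p t = e a * t + e b" and evq: "ev e q t = e c * t + e d"
    unfolding p q by (simp_all add: E H algebra_simps)
  have nc: "s \<noteq> e r" for r
    using transcendentalD[OF s, of "[:-r, 1:]"] by (auto simp: E H)
  have "a * d - b * c \<noteq> 0"
  proof
    assume det: "a * d - b * c = 0"
    show False
    proof (cases "c = 0")
      case True
      then have "d \<noteq> 0" using pq(1) q by auto
      then have "a = 0" using det True by auto
      then have "s = e (b / d)" using pq(3) evp evq True by (simp add: H)
      then show False using nc by blast
    next
      case False
      then have "b = a * d / c" using det by (simp add: field_simps)
      then have "smult (a / c) q = p" unfolding p q using False by simp
      then have "ev e p t = e (a / c) * ev e q t" using E(6)[of "a / c" q t] by simp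
      then have "s = e (a / c)" using pq(2,3) by simp
      then show False using nc by blast
    qed
  qed
  moreover have "e c * t + e d \<noteq> 0" "s * (e c * t + e d) = e a * t + e b"
    using pq(2,3) evp evq by (simp_all add: field_simps)
  ultimately show ?thesis by (rule that)
qed

subsection \<open>Binary cubic forms\<close>

text \<open>Discriminant of the binary cubic form \<open>f\<^sub>3 X\<^sup>3 + f\<^sub>2 X\<^sup>2 Z + f\<^sub>1 X Z\<^sup>2 + f\<^sub>0 Z\<^sup>3\<close>; a polynomial of
  degree two counts as a cubic form with a root at infinity.\<close>

definition cubic_disc :: "'k::field \<Rightarrow> 'k \<Rightarrow> 'k \<Rightarrow> 'k \<Rightarrow> 'k" where
  "cubic_disc f0 f1 f2 f3 =
     f1^2 * f2^2 - 4 * f0 * f2^3 - 4 * f1^3 * f3 + 18 * f0 * f1 * f2 * f3 - 27 * f0^2 * f3^2"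

definition form_disc :: "'k::field poly \<Rightarrow> 'k" where
  "form_disc F = cubic_disc (coeff F 0) (coeff F 1) (coeff F 2) (coeff F 3)"

definition nondegenerate :: "'k::field poly \<Rightarrow> bool" where
  "nondegenerate F \<longleftrightarrow> degree F \<le> 3 \<and> form_disc F \<noteq> 0"

text \<open>Substitution of \<open>(a X + b Z, c X + d Z)\<close> into the binary cubic form. The
  degree 3 is fixed, so a quadratic \<open>F\<close> may become cubic and conversely.\<close>

definition act :: "'k::field \<Rightarrow> 'k \<Rightarrow> 'k \<Rightarrow> 'k \<Rightarrow> 'k poly \<Rightarrow> 'k poly" where
  "act a b c d F = homogenize 3 F [:b, a:] [:d, c:]"

text \<open>The discriminant of binary cubics is an invariant of weight 6; the four arguments are
  the coefficients of the transformed form.\<close>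

lemma cubic_disc_act:
  fixes a b c d :: "'k::field"
  shows "cubic_disc (f0 * d^3 + f1 * b * d^2 + f2 * b^2 * d + f3 * b^3)
   (3 * f0 * c * d^2 + f1 * (a * d^2 + 2 * b * c * d) + f2 * (2 * a * b * d + b^2 * c) + 3 * f3 * a * b^2)
   (3 * f0 * c^2 * d + f1 * (2 * a * c * d + b * c^2) + f2 * (a^2 * d + 2 * a * b * c) + 3 * f3 * a^2 * b)
   (f0 * c^3 + f1 * a * c^2 + f2 * a^2 * c + f3 * a^3) = (a * d - b * c)^6 * cubic_disc f0 f1 f2 f3"
  unfolding cubic_disc_def by Groebner_Basis.algebra

lemma degree_le_3_eq: "degree F \<le> 3 \<Longrightarrow> F = [:coeff F 0, coeff F 1, coeff F 2, coeff F 3:]"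
  by (rule poly_eqI)
    (auto simp: coeff_pCons coeff_eq_0 numeral_2_eq_2 numeral_3_eq_3 split: nat.split)

lemma act_pCons:
  "act a b c d [:f0, f1, f2, f3:] =
   [:f0 * d^3 + f1 * b * d^2 + f2 * b^2 * d + f3 * b^3,
     3 * f0 * c * d^2 + f1 * (a * d^2 + 2 * b * c * d) + f2 * (2 * a * b * d + b^2 * c) + 3 * f3 * a * b^2,
     3 * f0 * c^2 * d + f1 * (2 * a * c * d + b * c^2) + f2 * (a^2 * d + 2 * a * b * c) + 3 * f3 * a^2 * b,
     f0 * c^3 + f1 * a * c^2 + f2 * a^2 * c + f3 * a^3:]"
proof -
  have s: "{..3::nat} = {0, 1, 2, 3}" by auto
  show ?thesis
    unfolding act_def homogenize_def s
    by (simp add: power2_eq_square power3_eq_cube coeff_pCons numeral_2_eq_2 numeral_3_eq_3 algebra_simps)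
qed

lemma degree_act: "degree (act a b c d F) \<le> 3"
proof -
  have "degree (smult (coeff F i) ([:b, a:] ^ i * [:d, c:] ^ (3 - i))) \<le> 3" if "i \<le> 3" for i
  proof -
    have l: "degree [:u, v:] \<le> 1" for u v :: 'a by simp
    have "degree ([:b, a:] ^ i * [:d, c:] ^ (3 - i)) \<le> degree ([:b, a:] ^ i) + degree ([:d, c:] ^ (3 - i))"
      by (rule degree_mult_le)
    also have "\<dots> \<le> 1 * i + 1 * (3 - i)"
      using degree_power_le[of "[:b, a:]" i] degree_power_le[of "[:d, c:]" "3 - i"] l
      by (intro add_mono) (meson mult_le_mono1 order_trans)+
    also have "\<dots> = 3" using that by simp
    finally show ?thesis using degree_smult_le order_trans by blast
  qed
  then show ?thesis unfolding act_def homogenize_def by (intro degree_sum_le) auto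
qed

lemma form_disc_act:
  assumes "degree F \<le> 3"
  shows "form_disc (act a b c d F) = (a * d - b * c)^6 * form_disc F"
  by (subst degree_le_3_eq[OF assms])
    (simp only: act_pCons form_disc_def coeff_pCons numeral_2_eq_2 numeral_3_eq_3 One_nat_def
      nat.case cubic_disc_act[unfolded numeral_2_eq_2 numeral_3_eq_3])

lemma nondegenerate_act: "nondegenerate F \<Longrightarrow> a * d - b * c \<noteq> 0 \<Longrightarrow> nondegenerate (act a b c d F)"
  by (simp add: nondegenerate_def degree_act form_disc_act)

lemma ev_act:
  assumes e: "hom_on UNIV e" and "degree F \<le> 3" "e c * x + e d \<noteq> 0" "s * (e c * x + e d) = e a * x + e b"
  shows "ev e (act a b c d F) x = (e c * x + e d) ^ 3 * ev e F s"
proof -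
  have q: "ev e [:d, c:] x = e c * x + e d" and p: "ev e [:b, a:] x = e a * x + e b"
    by (simp_all add: ev_hom[OF e] algebra_simps hom_on_0[OF sfield_UNIV e])
  have "s = (e a * x + e b) / (e c * x + e d)" using assms(3,4) by (simp add: field_simps)
  then show ?thesis
    unfolding act_def using ev_homogenize[OF e assms(2), of "[:d, c:]" x "[:b, a:]"] assms(3)
    unfolding p q by simp
qed

text \<open>Degree 4 in the coefficients, against weight 6 under substitution: this pair of
  exponents later makes the multiplier of a self-equivalence a cube.\<close>

lemma form_disc_smult: "form_disc (smult c F) = c ^ 4 * form_disc F"
  unfolding form_disc_def cubic_disc_def by simp Groebner_Basis.algebra

lemma nondegenerate_smult: "c \<noteq> 0 \<Longrightarrow> nondegenerate F \<Longrightarrow> nondegenerate (smult c F)"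
  by (auto simp: nondegenerate_def form_disc_smult)

lemma nondegenerate_smult_iff: "c \<noteq> 0 \<Longrightarrow> nondegenerate (smult c F) \<longleftrightarrow> nondegenerate F"
  using nondegenerate_smult[of "inverse c" "smult c F"] nondegenerate_smult[of c F] by auto

lemma hom_of_nat:
  assumes e: "hom_on UNIV e" shows "e (of_nat m) = of_nat m"
  by (induction m) (auto simp: hom_onD[OF sfield_UNIV e])

lemma hom_numeral: "hom_on UNIV e \<Longrightarrow> e (numeral n) = numeral n"
  using hom_of_nat[of e "numeral n"] by simp

text \<open>The discriminant is an integer polynomial in the coefficients and so commutes with
  embeddings; roots can therefore be studied over the algebraic closure.\<close>

lemma nondegenerate_map_poly:
  assumes e: "hom_on UNIV e" shows "nondegenerate (map_poly e F) \<longleftrightarrow> nondegenerate F"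
proof -
  note H = hom_onD[OF sfield_UNIV e] hom_numeral[OF e]
  have "form_disc (map_poly e F) = e (form_disc F)"
    unfolding form_disc_def cubic_disc_def by (simp add: coeff_map_poly_hom[OF sfield_UNIV e] H)
  then show ?thesis
    using map_poly_hom_degree[OF sfield_UNIV e, of F] by (simp add: nondegenerate_def H)
qed

text \<open>If both top coefficients vanish, the form has a double root at infinity and discriminant
  zero.\<close>

lemma nondegenerate_degree: "nondegenerate F \<Longrightarrow> 2 \<le> degree F" "nondegenerate F \<Longrightarrow> degree F \<le> 3" "nondegenerate F \<Longrightarrow> F \<noteq> 0"
proof -
  show *: "2 \<le> degree F" if "nondegenerate F"
  proof (rule ccontr)
    assume "\<not> 2 \<le> degree F"
    then have "coeff F 2 = 0" "coeff F 3 = 0" by (auto intro!: coeff_eq_0)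
    then show False using that by (simp add: nondegenerate_def form_disc_def cubic_disc_def)
  qed
  show "nondegenerate F \<Longrightarrow> degree F \<le> 3" by (simp add: nondegenerate_def)
  show "nondegenerate F \<Longrightarrow> F \<noteq> 0" using * by auto
qed

section \<open>Orders of vanishing at the roots of a form\<close>

lemma nondegenerate_order_le_1:
  assumes "nondegenerate F" shows "order a F \<le> 1"
proof (rule ccontr)
  assume "\<not> order a F \<le> 1"
  then have "[:-a, 1:] ^ 2 dvd F" using order_divides[of a 2 F] by auto
  then obtain r where r: "F = [:-a, 1:] ^ 2 * r" by (rule dvdE)
  have F0: "F \<noteq> 0" and F3: "degree F \<le> 3" using assms nondegenerate_degree by auto
  then have "r \<noteq> 0" using r by auto
  then have "degree F = 2 + degree r" unfolding r by (subst degree_mult_eq) (auto simp: degree_power_eq)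
  then have "degree r \<le> 1" using F3 by simp
  then have "r = [:coeff r 0, coeff r 1:]"
    by (intro poly_eqI) (auto simp: coeff_pCons coeff_eq_0 split: nat.split)
  then obtain u v where uv: "r = [:u, v:]" by blast
  \<comment> \<open>The expansion of \<open>(X - a)^2 (u + v X)\<close>; for such coefficients the
    discriminant vanishes identically in \<open>a\<close>, \<open>u\<close>,
    \<open>v\<close>.\<close>
  have "F = [:a^2 * u, a^2 * v - 2 * a * u, u - 2 * a * v, v:]"
    unfolding r uv by (simp add: power2_eq_square algebra_simps)
  then have "form_disc F = cubic_disc (a^2 * u) (a^2 * v - 2 * a * u) (u - 2 * a * v) v"
    by (simp add: form_disc_def coeff_pCons numeral_2_eq_2 numeral_3_eq_3)
  also have "\<dots> = 0" unfolding cubic_disc_def by Groebner_Basis.algebra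
  finally show False using assms by (simp add: nondegenerate_def)
qed

lemma alg_closed_order_eq:
  fixes p q :: "'a::alg_closed_field poly"
  assumes "p \<noteq> 0" "q \<noteq> 0" "\<And>a. order a p = order a q"
  shows "p = smult (lead_coeff p / lead_coeff q) q"
proof -
  have fac: "f = smult (lead_coeff f) (\<Prod>x\<in>#proots f. [:-x, 1:])" if f: "f \<noteq> 0" for f :: "'a poly"
  proof -
    obtain A where A: "f = smult (lead_coeff f) (\<Prod>x\<in>#A. [:-x, 1:])"
      using alg_closed_imp_factorization[OF f] by blast
    have "proots (\<Prod>x\<in>#A. [:-x, 1:] :: 'a poly) = A"
    proof (induction A)
      case (add x A)
      have "(\<Prod>x\<in>#A. [:-x, 1:] :: 'a poly) \<noteq> 0" by (auto simp: prod_mset_zero_iff)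
      then show ?case using add.IH by (simp add: proots_mult del: mult_pCons_left)
    qed simp
    moreover have "proots f = proots (\<Prod>x\<in>#A. [:-x, 1:] :: 'a poly)"
      using proots_smult[of "lead_coeff f" "\<Prod>x\<in>#A. [:-x, 1:]"] A f by (metis leading_coeff_0_iff)
    ultimately show ?thesis using A by simp
  qed
  have "proots p = proots q"
    by (rule multiset_eqI) (use assms in simp)
  then have p: "p = smult (lead_coeff p) (\<Prod>x\<in>#proots q. [:-x, 1:])" using fac[OF assms(1)] by simp
  have "smult (lead_coeff p / lead_coeff q) q =
      smult (lead_coeff p / lead_coeff q) (smult (lead_coeff q) (\<Prod>x\<in>#proots q. [:-x, 1:]))"
    using fac[OF assms(2)] by simp
  also have "\<dots> = p" using p assms(2) by simp
  finally show ?thesis by simp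
qed

lemma order_power: "p \<noteq> 0 \<Longrightarrow> order a (p ^ n) = n * order a (p :: 'a::idom poly)"
  by (induction n) (auto simp: order_mult)

lemma map_poly_to_ac:
  "map_poly to_ac (p * q) = map_poly to_ac p * map_poly to_ac q"
  "map_poly to_ac (p ^ n) = map_poly to_ac p ^ n"
  "map_poly to_ac (smult a p) = smult (to_ac a) (map_poly to_ac p)"
  "map_poly to_ac p = 0 \<longleftrightarrow> p = 0"
  "degree (map_poly to_ac p) = degree p"
  "coeff (map_poly to_ac p) i = to_ac (coeff p i)"
proof -
  note h = hom_on_to_ac[of UNIV]
  show m: "map_poly to_ac (p * q) = map_poly to_ac p * map_poly to_ac q" for p q :: "'a poly"
    using map_poly_hom_mult[OF sfield_UNIV h] by simp
  show "map_poly to_ac (p ^ n) = map_poly to_ac p ^ n" by (induction n) (auto simp: m)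
  show "map_poly to_ac (smult a p) = smult (to_ac a) (map_poly to_ac p)"
    using map_poly_hom_smult[OF sfield_UNIV h] by simp
  show "map_poly to_ac p = 0 \<longleftrightarrow> p = 0" using map_poly_hom_eq_0[OF sfield_UNIV h] by simp
  show "degree (map_poly to_ac p) = degree p" using map_poly_hom_degree[OF sfield_UNIV h] by simp
  show "coeff (map_poly to_ac p) i = to_ac (coeff p i)"
    by (rule coeff_map_poly) simp
qed

lemma ac_poly_eq_iff: "map_poly to_ac p = map_poly to_ac q \<longleftrightarrow> p = q"
  by (simp add: poly_eq_iff map_poly_to_ac)

abbreviation ac_poly :: "'k::field poly \<Rightarrow> 'k alg_closure poly" where
  "ac_poly \<equiv> map_poly to_ac"

lemma nondegenerate_has_simple_root:
  assumes "nondegenerate F"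
  obtains a where "order a (ac_poly F) = 1"
proof -
  have g: "nondegenerate (ac_poly F)" using assms nondegenerate_map_poly[OF hom_on_to_ac] by blast
  then obtain a where "poly (ac_poly F) a = 0"
    using alg_closed_imp_poly_has_root[of "ac_poly F"] nondegenerate_degree[OF g] by auto
  then have "order a (ac_poly F) \<noteq> 0" using nondegenerate_degree(3)[OF g] by (simp add: order_root)
  then show ?thesis using that nondegenerate_order_le_1[OF g, of a] by (metis le_antisym less_one not_less)
qed

text \<open>At a simple root of \<open>F\<close> the two sides have orders 0 and 1 modulo 3.
  Consequently \<open>F(x)\<close> is not a cube in \<open>k(x)\<close>.\<close>

lemma nondegenerate_cube_times_ne:
  assumes "nondegenerate F" "p \<noteq> 0" "q \<noteq> 0"
  shows "p ^ 3 \<noteq> F * q ^ 3"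
proof
  assume eq: "p ^ 3 = F * q ^ 3"
  obtain a where a: "order a (ac_poly F) = 1" by (rule nondegenerate_has_simple_root[OF assms(1)])
  have nz: "ac_poly p \<noteq> 0" "ac_poly q \<noteq> 0" "ac_poly F \<noteq> 0"
    using assms nondegenerate_degree(3) by (auto simp: map_poly_to_ac)
  have "ac_poly p ^ 3 = ac_poly F * ac_poly q ^ 3"
    using arg_cong[OF eq, of ac_poly] by (simp add: map_poly_to_ac)
  then have "3 * order a (ac_poly p) = 1 + 3 * order a (ac_poly q)"
    using nz a order_power[OF nz(1), of a 3] order_power[OF nz(2), of a 3]
      order_mult[of "ac_poly F" "ac_poly q ^ 3" a] by simp
  then show False by presburger
qed

text \<open>At a root of \<open>G\<close> the right side has order 2 modulo 3, while
  \<open>P\<close> contributes at most 1. This excludes that one Kummer generator corresponds to the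
  square of the other.\<close>

lemma nondegenerate_compare_cube_square:
  assumes "nondegenerate P" "nondegenerate G" "p \<noteq> 0" "q \<noteq> 0"
  shows "q ^ 3 * P \<noteq> p ^ 3 * G ^ 2"
proof
  assume eq: "q ^ 3 * P = p ^ 3 * G ^ 2"
  obtain a where a: "order a (ac_poly G) = 1" by (rule nondegenerate_has_simple_root[OF assms(2)])
  have nz: "ac_poly p \<noteq> 0" "ac_poly q \<noteq> 0" "ac_poly P \<noteq> 0" "ac_poly G \<noteq> 0"
    using assms nondegenerate_degree(3) by (auto simp: map_poly_to_ac)
  have "ac_poly q ^ 3 * ac_poly P = ac_poly p ^ 3 * ac_poly G ^ 2"
    using arg_cong[OF eq, of ac_poly] by (simp add: map_poly_to_ac)
  then have "3 * order a (ac_poly q) + order a (ac_poly P) = 3 * order a (ac_poly p) + 2"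
    using nz a order_power[OF nz(1), of a 3] order_power[OF nz(2), of a 3] order_power[OF nz(4), of a 2]
      order_mult[of "ac_poly q ^ 3" "ac_poly P" a] order_mult[of "ac_poly p ^ 3" "ac_poly G ^ 2" a] by simp
  moreover have "order a (ac_poly P) \<le> 1"
    using assms(1) nondegenerate_map_poly[OF hom_on_to_ac] nondegenerate_order_le_1 by blast
  moreover have "3 * i + j = 3 * k + 2 \<Longrightarrow> j \<le> 1 \<Longrightarrow> False" for i j k :: nat by presburger
  ultimately show False by blast
qed

text \<open>Orders that are at most one and agree modulo 3 are equal, so \<open>P\<close> and
  \<open>G\<close> have the same finite roots and are proportional.\<close>

lemma nondegenerate_compare_cube:
  assumes "nondegenerate P" "nondegenerate G" "p \<noteq> 0" "q \<noteq> 0" "q ^ 3 * P = p ^ 3 * G"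
  obtains l where "l \<noteq> 0" "P = smult (l ^ 3) G"
proof -
  have nz: "ac_poly p \<noteq> 0" "ac_poly q \<noteq> 0" "ac_poly P \<noteq> 0" "ac_poly G \<noteq> 0" "P \<noteq> 0" "G \<noteq> 0"
    using assms nondegenerate_degree(3) by (auto simp: map_poly_to_ac)
  have eq: "ac_poly q ^ 3 * ac_poly P = ac_poly p ^ 3 * ac_poly G"
    using arg_cong[OF assms(5), of ac_poly] by (simp add: map_poly_to_ac)
  have "order a (ac_poly P) = order a (ac_poly G)" for a
  proof -
    have "3 * order a (ac_poly q) + order a (ac_poly P) = 3 * order a (ac_poly p) + order a (ac_poly G)"
      using eq nz order_power[OF nz(1), of a 3] order_power[OF nz(2), of a 3]
        order_mult[of "ac_poly q ^ 3" "ac_poly P" a] order_mult[of "ac_poly p ^ 3" "ac_poly G" a] by simp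
    moreover have "order a (ac_poly P) \<le> 1" "order a (ac_poly G) \<le> 1"
      using assms(1,2) nondegenerate_map_poly[OF hom_on_to_ac] nondegenerate_order_le_1 by blast+
    moreover have "3 * i + j = 3 * k + m \<Longrightarrow> j \<le> 1 \<Longrightarrow> m \<le> 1 \<Longrightarrow> j = m" for i j k m :: nat
      by presburger
    ultimately show ?thesis by blast
  qed
  from alg_closed_order_eq[OF nz(3,4) this]
  have "ac_poly P = ac_poly (smult (lead_coeff P / lead_coeff G) G)"
    by (simp add: map_poly_to_ac)
  then have P: "P = smult (lead_coeff P / lead_coeff G) G"
    by (simp only: ac_poly_eq_iff)
  \<comment> \<open>Comparing leading coefficients in the given equation shows that the factor of
    proportionality is a cube in \<open>k\<close> itself.\<close>
  let ?l = "lead_coeff p / lead_coeff q"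
  have "lead_coeff q ^ 3 * lead_coeff P = lead_coeff p ^ 3 * lead_coeff G"
    using arg_cong[OF assms(5), of lead_coeff] by (simp add: lead_coeff_mult lead_coeff_power)
  then have "lead_coeff P / lead_coeff G = ?l ^ 3"
    using nz assms(3,4) by (simp add: field_simps)
  then show ?thesis using that[of ?l] P assms(3,4) by simp
qed

subsection \<open>Kummer theory without roots of unity\<close>

text \<open>A quadratic relation gives \<open>y ^ 3 = a' b' + (b' ^ 2 - a') y\<close>: either the
  coefficient of \<open>y\<close> vanishes and \<open>y ^ 3 = b' ^ 3\<close>, or \<open>y\<close>
  lies in \<open>K\<close>. Both contradict that \<open>y ^ 3\<close> is not a cube in
  \<open>K\<close>.\<close>

lemma cube_root_independent:
  assumes K: "sfield K" and y: "\<And>u. u \<in> K \<Longrightarrow> u ^ 3 \<noteq> y ^ 3" "y ^ 3 \<in> K"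
    and abc: "a \<in> K" "b \<in> K" "c \<in> K" "a + b * y + c * y ^ 2 = 0"
  shows "a = 0 \<and> b = 0 \<and> c = 0"
proof -
  note S = sfield_intros[OF K]
  have yK: "y \<notin> K" using y(1)[of y] by auto
  have c: "c = 0"
  proof (rule ccontr)
    assume c: "c \<noteq> 0"
    define a' b' where "a' = a / c" and "b' = b / c"
    have ab: "a' \<in> K" "b' \<in> K" unfolding a'_def b'_def using abc S by auto
    have y2: "y ^ 2 = - a' - b' * y"
      using abc(4) c unfolding a'_def b'_def by (simp add: field_simps eq_neg_iff_add_eq_0)
    then have y3: "y ^ 3 = a' * b' + (b' ^ 2 - a') * y" by Groebner_Basis.algebra
    show False
    proof (cases "b' ^ 2 - a' = 0")
      case True
      then have "y ^ 3 = b' ^ 3" using y3 by Groebner_Basis.algebra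
      then show False using y(1)[OF ab(2)] by simp
    next
      case False
      then have "y = (y ^ 3 - a' * b') / (b' ^ 2 - a')" using y3 by (simp add: field_simps)
      moreover have "(y ^ 3 - a' * b') / (b' ^ 2 - a') \<in> K"
        using ab y(2) S sfield_power[OF K] by auto
      ultimately show False using yK by simp
    qed
  qed
  have b: "b = 0"
  proof (rule ccontr)
    assume "b \<noteq> 0"
    then have "y = - a / b" using abc(4) c by (simp add: field_simps eq_neg_iff_add_eq_0 add.commute)
    then show False using yK abc S by auto
  qed
  show ?thesis using abc(4) b c by simp
qed

lemma cube_root_min_poly:
  assumes K: "sfield K" and y: "\<And>u. u \<in> K \<Longrightarrow> u ^ 3 \<noteq> y ^ 3" "y ^ 3 \<in> K"
  shows "min_poly_over K y [:- (y ^ 3), 0, 0, 1:]"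
  unfolding min_poly_over_def
proof (intro conjI ballI impI)
  show "[:- (y ^ 3), 0, 0, 1:] \<in> polyF K"
    by (intro polyF_intros[OF K] sfield_intros[OF K] y(2))
  show "poly [:- (y ^ 3), 0, 0, 1:] y = 0" by (simp add: power3_eq_cube)
  fix q assume q: "q \<in> polyF K" "q \<noteq> 0" "poly q y = 0"
  show "degree [:- (y ^ 3), 0, 0, 1:] \<le> degree q"
  proof (rule ccontr)
    assume "\<not> ?thesis"
    then have d: "degree q \<le> 2" by simp
    then have qe: "q = [:coeff q 0, coeff q 1, coeff q 2:]"
      by (intro poly_eqI) (auto simp: coeff_pCons coeff_eq_0 numeral_2_eq_2 split: nat.split)
    have "poly [:coeff q 0, coeff q 1, coeff q 2:] y = 0" using q(3) qe by simp
    then have "coeff q 0 + coeff q 1 * y + coeff q 2 * y ^ 2 = 0"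
      by (simp add: power2_eq_square algebra_simps)
    from cube_root_independent[OF assms polyFD[OF q(1)] polyFD[OF q(1)] polyFD[OF q(1)] this]
    have "q = 0" using qe by simp
    then show False using q(2) by simp
  qed
qed auto

lemma cube_root_gen:
  assumes K: "sfield K" and y: "\<And>u. u \<in> K \<Longrightarrow> u ^ 3 \<noteq> y ^ 3" "y ^ 3 \<in> K"
  shows "gen (insert y K) = {a + b * y + c * y ^ 2 |a b c. a \<in> K \<and> b \<in> K \<and> c \<in> K}"
proof
  note mp = cube_root_min_poly[OF assms]
  let ?p = "[:- (y ^ 3), 0, 0, 1:]"
  have p: "?p \<in> polyF K" "?p \<noteq> 0" "poly ?p y = 0" using mp by (auto simp: min_poly_over_def)
  then have alg: "alg_over K y" unfolding alg_over_def by blast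
  show "gen (insert y K) \<subseteq> {a + b * y + c * y ^ 2 |a b c. a \<in> K \<and> b \<in> K \<and> c \<in> K}"
  proof
    fix z assume "z \<in> gen (insert y K)"
    then obtain q where q: "q \<in> polyF K" "z = poly q y" using simple_alg_extension[OF K alg] by auto
    obtain s r where sr: "s \<in> polyF K" "r \<in> polyF K" "q = s * ?p + r" "r = 0 \<or> degree r < degree ?p"
      by (rule polyF_division[OF K p(1,2) q(1)])
    have "degree r \<le> 2" using sr(4) by auto
    then have re: "r = [:coeff r 0, coeff r 1, coeff r 2:]"
      by (intro poly_eqI) (auto simp: coeff_pCons coeff_eq_0 numeral_2_eq_2 split: nat.split)
    have "z = poly r y" using q(2) sr(3) p(3) by simp
    also have "\<dots> = coeff r 0 + coeff r 1 * y + coeff r 2 * y ^ 2"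
      by (subst re) (simp add: power2_eq_square algebra_simps)
    finally show "z \<in> {a + b * y + c * y ^ 2 |a b c. a \<in> K \<and> b \<in> K \<and> c \<in> K}"
      using polyFD[OF sr(2)] by blast
  qed
  show "{a + b * y + c * y ^ 2 |a b c. a \<in> K \<and> b \<in> K \<and> c \<in> K} \<subseteq> gen (insert y K)"
  proof
    fix z assume "z \<in> {a + b * y + c * y ^ 2 |a b c. a \<in> K \<and> b \<in> K \<and> c \<in> K}"
    then obtain a b c where "a \<in> K" "b \<in> K" "c \<in> K" "z = a + b * y + c * y ^ 2" by blast
    then show "z \<in> gen (insert y K)"
      by (auto intro!: sfield_intros[OF sfield_gen] sfield_power[OF sfield_gen] intro: gen_incl)
  qed
qed

text \<open>The coefficients of \<open>y\<close> and \<open>y ^ 2\<close> in the cube of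
  \<open>a + b y + c y ^ 2\<close> carry a factor 3; once it is cancelled they give two equations
  over \<open>K\<close> that leave a single nonzero term. This stands in for the eigenspace argument
  of Kummer theory, which would need a cube root of unity.\<close>

lemma kummer_cube_roots:
  assumes K: "sfield K" and y: "\<And>u. u \<in> K \<Longrightarrow> u ^ 3 \<noteq> y ^ 3" "y ^ 3 \<in> K"
    and three: "(3::'a::field) \<noteq> 0" and z: "z \<in> gen (insert y K)" "z ^ 3 \<in> K" "(z::'a) \<notin> K"
  obtains u where "u \<in> K" "z = u * y" | u where "u \<in> K" "z = u * y ^ 2"
proof -
  note S = sfield_intros[OF K] and P = sfield_power[OF K]
  have "gen (insert y K) = {a + b * y + c * y ^ 2 |a b c. a \<in> K \<and> b \<in> K \<and> c \<in> K}"
    by (rule cube_root_gen[OF K y])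
  then obtain a b c where abc: "a \<in> K" "b \<in> K" "c \<in> K" "z = a + b * y + c * y ^ 2"
    using z(1) by blast
  define B where "B = y ^ 3"
  have BK: "B \<in> K" using y(2) by (simp add: B_def)
  let ?u = "a^3 + b^3 * B + c^3 * B^2 + 6 * a * b * c * B - z ^ 3"
  let ?v = "3 * (a^2 * b + B * b^2 * c + B * a * c^2)"
  let ?w = "3 * (a^2 * c + a * b^2 + B * b * c^2)"
  have "?u + ?v * y + ?w * y ^ 2 = 0"
    unfolding abc(4) B_def by Groebner_Basis.algebra
  moreover have num: "numeral n \<in> K" for n
  proof -
    have "of_nat m \<in> K" for m by (induction m) (auto intro: S)
    from this[of "numeral n"] show ?thesis by simp
  qed
  have "?u \<in> K" "?v \<in> K" "?w \<in> K"
    using abc BK z(2) by (auto intro!: S P num)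
  ultimately have "?v = 0 \<and> ?w = 0"
    using cube_root_independent[OF K y, of ?u ?v ?w] by blast
  then have v: "a^2 * b + B * b^2 * c + B * a * c^2 = 0" and w: "a^2 * c + a * b^2 + B * b * c^2 = 0"
    using three by (metis no_zero_divisors)+
  \<comment> \<open>\<open>c\<close> times the first equation minus \<open>b\<close> times the
    second. As \<open>B\<close> is not a cube in \<open>K\<close>, the other factor vanishes only
    for \<open>b = c = 0\<close>, and then \<open>z\<close> would lie in \<open>K\<close>.\<close>
  have "a * (B * c ^ 3 - b ^ 3) = 0" using v w by Groebner_Basis.algebra
  moreover have "B * c ^ 3 - b ^ 3 \<noteq> 0 \<or> c = 0 \<and> b = 0"
  proof (cases "c = 0")
    case False
    have "(b / c) ^ 3 \<noteq> B" using y(1)[of "b / c"] abc S unfolding B_def by auto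
    then show ?thesis using False by (auto simp: field_simps)
  qed auto
  ultimately have "a = 0" using z(3) abc by auto
  then have "b = 0 \<or> c = 0" using v y(1)[of 0] S(1) by (auto simp: B_def)
  then show ?thesis using that abc \<open>a = 0\<close> by auto
qed

subsection \<open>Cubic extensions presented by binary cubic forms\<close>

lemma three_ne_0:
  assumes e: "hom_on UNIV (e :: 'k::field \<Rightarrow> 'u::field)" and "CHAR('k) \<noteq> 3"
  shows "(3::'u) \<noteq> 0"
proof -
  have "CHAR('k) \<noteq> 1" by simp
  then have "\<not> CHAR('k) dvd 3" using assms(2) prime_nat_iff[of 3] by auto
  then have "of_nat 3 \<noteq> (0::'k)" using of_nat_eq_0_iff_char_dvd[where 'a = 'k] by blast
  then have "(3::'k) \<noteq> 0" by simp
  then show ?thesis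
    using hom_numeral[OF e, of "num.Bit1 num.One"] hom_on_eq_0_iff[OF sfield_UNIV e, of 3] by simp
qed

lemma gen_insert_eq:
  assumes "a \<in> gen (insert b S)" "b \<in> gen (insert a S)"
  shows "gen (insert a S) = gen (insert b S)"
proof
  show "gen (insert a S) \<subseteq> gen (insert b S)"
    by (rule gen_least) (use assms in \<open>auto intro: gen_incl\<close>)
  show "gen (insert b S) \<subseteq> gen (insert a S)"
    by (rule gen_least) (use assms in \<open>auto intro: gen_incl\<close>)
qed

lemma hom_on_gen_image:
  assumes h: "hom_on (gen S) h"
  shows "h ` gen S = gen (h ` S)"
proof
  note H = hom_onD[OF sfield_gen h] and G = sfield_intros[OF sfield_gen]
  have "sfield {z \<in> gen S. h z \<in> gen (h ` S)}"
    unfolding sfield_def by (auto simp: H G)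
  then have "gen S \<subseteq> {z \<in> gen S. h z \<in> gen (h ` S)}"
    by (rule gen_least) (auto intro: gen_incl)
  then show "h ` gen S \<subseteq> gen (h ` S)" by auto
  show "gen (h ` S) \<subseteq> h ` gen S"
    by (rule gen_least[OF hom_on_image[OF sfield_gen h]]) (auto intro: gen_incl)
qed

text \<open>The normal form to which everything is reduced. The generators are arguments rather than
  part of the extension, because one extension has many presentations and these have to be
  compared.\<close>

fun presented :: "('k::field, 'u::field) extn \<Rightarrow> 'k poly \<Rightarrow> 'u \<Rightarrow> 'u \<Rightarrow> bool" where
  "presented (e, K, L) F x y \<longleftrightarrow> hom_on UNIV e \<and> transcendental_over e x \<and>
     K = gen (insert x (range e)) \<and> L = gen (insert y K) \<and> y ^ 3 = ev e F x"

lemma presentedD: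
  assumes "presented (e, K, L) F x y"
  shows "hom_on UNIV e" "transcendental_over e x" "K = gen (insert x (range e))"
    "L = gen (insert y K)" "y ^ 3 = ev e F x" "sfield K" "sfield L" "K \<subseteq> L" "range e \<subseteq> K"
    "x \<in> K" "y \<in> L" "y ^ 3 \<in> K"
  using assms ev_mem_gen[of e F x] by (auto intro: gen_incl)

lemma presented_noncube:
  assumes "presented (e, K, L) F x y" "nondegenerate F" "u \<in> K"
  shows "u ^ 3 \<noteq> y ^ 3"
proof
  note D = presentedD[OF assms(1)] and E = ev_hom[OF presentedD(1)[OF assms(1)]]
  assume eq: "u ^ 3 = y ^ 3"
  obtain p q where pq: "q \<noteq> 0" "ev e q x \<noteq> 0" "u = ev e p x / ev e q x"
    using rational_functionE[OF D(1,2)] assms(3) D(3) by metis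
  have "ev e p x ^ 3 = ev e F x * ev e q x ^ 3"
    using eq pq D(5) by (simp add: field_simps)
  then have "ev e (p ^ 3) x = ev e (F * q ^ 3) x" by (simp add: E)
  then have eq2: "p ^ 3 = F * q ^ 3" by (simp only: ev_eq_iff[OF D(1,2)])
  moreover have "p \<noteq> 0" using eq2 pq(1) nondegenerate_degree(3)[OF assms(2)] by auto
  ultimately show False using nondegenerate_cube_times_ne[OF assms(2)] pq(1) by blast
qed

lemma presented_not_in_base:
  assumes "presented (e, K, L) F x y" "nondegenerate F"
  shows "y \<notin> K" "y \<noteq> 0"
  using presented_noncube[OF assms, of y] presented_noncube[OF assms, of 0] sfield_0[OF presentedD(6)[OF assms(1)]]
  by auto

text \<open>Both \<open>x\<close> and \<open>x2\<close> generate \<open>K\<close>, hence a Moebius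
  transformation; Kummer theory compares \<open>y\<close> with \<open>y2\<close>. The factor
  \<open>v\<close> is recorded besides \<open>l\<close> because \<open>v\<close> and
  \<open>e l\<close> agree only up to a cube root of unity, and descent has to know how
  \<open>y\<close> itself moves.\<close>

lemma presented_unique:
  fixes e :: "'k::field \<Rightarrow> 'u::field"
  assumes char: "CHAR('k) \<noteq> 3" and p1: "presented (e, K, L) F x y" and p2: "presented (e, K, L) G x2 y2"
    and g: "nondegenerate F" "nondegenerate G"
  obtains a b c d l v where "a * d - b * c \<noteq> 0" "e c * x2 + e d \<noteq> 0"
    "x * (e c * x2 + e d) = e a * x2 + e b" "l \<noteq> 0" "act a b c d F = smult (l ^ 3) G"
    "y * (e c * x2 + e d) = v * y2" "v \<in> K" "v ^ 3 = e l ^ 3"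
proof -
  note D1 = presentedD[OF p1] and D2 = presentedD[OF p2] and E = ev_hom[OF presentedD(1)[OF p1]]
    and H = hom_onD[OF sfield_UNIV presentedD(1)[OF p1]] and S = sfield_intros[OF presentedD(6)[OF p1]]
  obtain a b c d where abcd: "a * d - b * c \<noteq> 0" "e c * x2 + e d \<noteq> 0"
    "x * (e c * x2 + e d) = e a * x2 + e b"
    using mutually_rational_moebius[OF D1(1) D2(2) D1(2)] D1(3,10) D2(3,10) by metis
  \<comment> \<open>The denominator of the Moebius transformation: \<open>(w * y) ^ 3\<close> is a
    polynomial in \<open>x2\<close>, namely the transformed form \<open>P\<close>.\<close>
  define w where "w = e c * x2 + e d"
  have eK: "e r \<in> K" for r using D1(9) by auto
  have wK: "w \<in> K" unfolding w_def using D2(10) eK S by auto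
  define P where "P = act a b c d F"
  have gP: "nondegenerate P" unfolding P_def by (rule nondegenerate_act[OF g(1) abcd(1)])
  have evP: "ev e P x2 = w ^ 3 * y ^ 3"
    using ev_act[OF D1(1) nondegenerate_degree(2)[OF g(1)] abcd(2,3)] D1(5) by (simp add: P_def w_def)
  have w0: "w \<noteq> 0" using abcd(2) by (simp add: w_def)
  have red: "\<exists>p q. p \<noteq> 0 \<and> q \<noteq> 0 \<and> ev e q x2 \<noteq> 0 \<and> w * u = ev e p x2 / ev e q x2"
    if u: "u \<in> K" "u \<noteq> 0" for u
  proof -
    have "w * u \<in> gen (insert x2 (range e))" using wK u S D2(3) by auto
    then obtain p q where pq: "q \<noteq> 0" "ev e q x2 \<noteq> 0" "w * u = ev e p x2 / ev e q x2"
      using rational_functionE[OF D2(1,2)] by metis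
    moreover have "p \<noteq> 0" using pq w0 u by (auto simp: E)
    ultimately show ?thesis by blast
  qed
  have "y \<in> gen (insert y2 K)" using D1(11) D2(4) by simp
  then consider u where "u \<in> K" "y = u * y2" | u where "u \<in> K" "y = u * y2 ^ 2"
    using kummer_cube_roots[OF D2(6) presented_noncube[OF p2 g(2)] D2(12) three_ne_0[OF D1(1) char] _ D1(12)
        presented_not_in_base(1)[OF p1 g(1)]] by metis
  then show ?thesis
  proof cases
    case 1
    have "u \<noteq> 0" using 1 presented_not_in_base(2)[OF p1 g(1)] by auto
    then obtain p q where pq: "p \<noteq> 0" "q \<noteq> 0" "ev e q x2 \<noteq> 0" "w * u = ev e p x2 / ev e q x2"
      using red 1 by blast
    have wu: "ev e P x2 = (w * u) ^ 3 * ev e G x2" using evP 1 D2(5) by (simp add: power_mult_distrib)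
    then have "ev e (q ^ 3 * P) x2 = ev e (p ^ 3 * G) x2"
      unfolding pq(4) using pq(3) by (simp add: E field_simps)
    then have "q ^ 3 * P = p ^ 3 * G" by (simp only: ev_eq_iff[OF D2(1,2)])
    then obtain l where l: "l \<noteq> 0" "P = smult (l ^ 3) G"
      using nondegenerate_compare_cube[OF gP g(2) pq(1,2)] by blast
    have "y2 ^ 3 \<noteq> 0" using presented_not_in_base(2)[OF p2 g(2)] by simp
    then have "(w * u) ^ 3 = e l ^ 3"
      using wu l(2) D2(5) by (simp add: E H)
    moreover have "w * u \<in> K" using wK 1 S by auto
    ultimately show ?thesis
      using that[of a d b c l "w * u"] abcd l 1 unfolding P_def w_def by (simp add: ac_simps)
  next
    case 2
    have "u \<noteq> 0" using 2 presented_not_in_base(2)[OF p1 g(1)] by auto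
    then obtain p q where pq: "p \<noteq> 0" "q \<noteq> 0" "ev e q x2 \<noteq> 0" "w * u = ev e p x2 / ev e q x2"
      using red 2 by blast
    have wu: "ev e P x2 = (w * u) ^ 3 * ev e G x2 ^ 2"
      unfolding evP D2(5)[symmetric] 2 by Groebner_Basis.algebra
    then have "ev e (q ^ 3 * P) x2 = ev e (p ^ 3 * G ^ 2) x2"
      unfolding pq(4) using pq(3) by (simp add: E field_simps)
    then have "q ^ 3 * P = p ^ 3 * G ^ 2" by (simp only: ev_eq_iff[OF D2(1,2)])
    then show ?thesis using nondegenerate_compare_cube_square[OF gP g(2) pq(1,2)] by blast
  qed
qed

section \<open>Change of generators by Moebius transformations\<close>

lemma transcendental_linear_ne_0:
  assumes "hom_on UNIV e" "transcendental_over e x" "a \<noteq> 0 \<or> c \<noteq> 0"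
  shows "e a + e c * x \<noteq> 0"
proof -
  have "[:a, c:] \<noteq> 0" using assms(3) by auto
  from transcendentalD[OF assms(2) this] show ?thesis
    by (simp add: ev_hom[OF assms(1)] hom_on_0[OF sfield_UNIV assms(1)] mult.commute)
qed

lemma moebius_change:
  assumes e: "hom_on UNIV e" and x: "transcendental_over e x" and det: "a * d - b * c \<noteq> 0"
  obtains x1 where "e c * x1 + e d \<noteq> 0" "x * (e c * x1 + e d) = e a * x1 + e b"
    "transcendental_over e x1" "gen (insert x1 (range e)) = gen (insert x (range e))"
proof -
  note E = ev_hom[OF e] and H = hom_onD[OF sfield_UNIV e]
  define m where "m = e a - e c * x"
  have m0: "m \<noteq> 0"
  proof -
    have "a \<noteq> 0 \<or> - c \<noteq> 0" using det by auto
    from transcendental_linear_ne_0[OF e x this] show ?thesis by (simp add: m_def H)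
  qed
  \<comment> \<open>The inverse Moebius transform of \<open>x\<close>.\<close>
  define x1 where "x1 = (e d * x - e b) / m"
  have detu: "e a * e d - e b * e c \<noteq> 0"
    using det H(7)[of "a * d - b * c"] by (simp add: H)
  have D1: "e c * x1 + e d = (e a * e d - e b * e c) / m"
    using m0 unfolding x1_def m_def by (simp add: field_simps)
  then have D0: "e c * x1 + e d \<noteq> 0" using detu m0 by simp
  have eq: "x * (e c * x1 + e d) = e a * x1 + e b"
    unfolding D1 using m0 unfolding x1_def m_def by (simp add: field_simps)
  have "transcendental_over e x1"
    unfolding transcendental_over_def
  proof (intro allI impI notI)
    fix p assume p: "p \<noteq> 0" "ev e p x1 = 0"
    let ?h = "homogenize (degree p) p [:-b, d:] [:a, -c:]"
    have lin: "ev e [:-b, d:] z = e d * z - e b" "ev e [:a, -c:] z = e a - e c * z" for z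
      by (simp_all add: E H algebra_simps)
    have "ev e ?h x = m ^ degree p * ev e p x1"
      using ev_homogenize[OF e order_refl, of "[:a, -c:]" x p "[:-b, d:]"] m0
      unfolding lin x1_def m_def by simp
    then have h0: "?h = 0" using p(2) transcendentalD[OF x] by auto
    define n where "n = e d + e c * x"
    have n0: "n \<noteq> 0"
    proof -
      have "d \<noteq> 0 \<or> c \<noteq> 0" using det by auto
      from transcendental_linear_ne_0[OF e x this] show ?thesis by (simp add: n_def)
    qed
    \<comment> \<open>The zero polynomial \<open>?h\<close> is evaluated at the Moebius transform of
      \<open>x\<close>: substituting \<open>z\<close> into \<open>(d z - b) / (a - c z)\<close>
      returns \<open>x\<close>, so \<open>p\<close> would vanish at \<open>x\<close>.\<close>
    define z where "z = (e a * x + e b) / n"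
    have zn: "e a - e c * z = (e a * e d - e b * e c) / n"
      using n0 unfolding z_def n_def by (simp add: field_simps)
    have zn0: "e a - e c * z \<noteq> 0" unfolding zn using detu n0 by simp
    have "e d * z - e b = x * (e a - e c * z)"
      unfolding zn using n0 unfolding z_def n_def by (simp add: field_simps)
    then have "(e d * z - e b) / (e a - e c * z) = x" using zn0 by simp
    then have "ev e ?h z = (e a - e c * z) ^ degree p * ev e p x"
      using ev_homogenize[OF e order_refl, of "[:a, -c:]" z p "[:-b, d:]"] zn0
      unfolding lin by simp
    then show False using h0 zn0 transcendentalD[OF x p(1)] by simp
  qed
  moreover have "gen (insert x1 (range e)) = gen (insert x (range e))"
  proof (rule gen_insert_eq)
    show "x1 \<in> gen (insert x (range e))"
      unfolding x1_def m_def by (intro sfield_intros[OF sfield_gen] gen_incl) auto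
    have "x = (e a * x1 + e b) / (e c * x1 + e d)" using eq D0 by (simp add: field_simps)
    moreover have "(e a * x1 + e b) / (e c * x1 + e d) \<in> gen (insert x1 (range e))"
      by (intro sfield_intros[OF sfield_gen] gen_incl) auto
    ultimately show "x \<in> gen (insert x1 (range e))" by simp
  qed
  ultimately show ?thesis using that D0 eq by blast
qed

text \<open>For nondegenerate forms outside characteristic 3 this amounts to bi-isomorphism of the
  presented extensions, see \<open>presented_form_equiv_iff\<close>; symmetry is later obtained
  through the extensions and not by inverting matrices.\<close>

definition form_equiv :: "'k::field poly \<Rightarrow> 'k poly \<Rightarrow> bool" where
  "form_equiv F G \<longleftrightarrow>
     (\<exists>a b c d l. a * d - b * c \<noteq> 0 \<and> l \<noteq> 0 \<and> act a b c d F = smult (l ^ 3) G)"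

lemma presented_form_equiv:
  assumes p: "presented (e, K, L) F x y" and F: "nondegenerate F" and eq: "form_equiv F G"
  obtains x1 y1 where "presented (e, K, L) G x1 y1"
proof -
  note D = presentedD[OF p] and E = ev_hom[OF presentedD(1)[OF p]] and H = hom_onD[OF sfield_UNIV presentedD(1)[OF p]]
  obtain a b c d l where abcd: "a * d - b * c \<noteq> 0" "l \<noteq> 0" "act a b c d F = smult (l ^ 3) G"
    using eq by (auto simp: form_equiv_def)
  obtain x1 where x1: "e c * x1 + e d \<noteq> 0" "x * (e c * x1 + e d) = e a * x1 + e b"
    "transcendental_over e x1" "gen (insert x1 (range e)) = gen (insert x (range e))"
    by (rule moebius_change[OF D(1,2) abcd(1)])
  have el: "e l \<noteq> 0" using abcd(2) by (simp add: H)
  \<comment> \<open>\<open>w * y\<close> is the new cube root: its cube is \<open>F(x)\<close> times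
    \<open>(c x1 + d) ^ 3 / l ^ 3\<close>, which the equivalence of forms identifies with
    \<open>G(x1)\<close>.\<close>
  define w where "w = (e c * x1 + e d) / e l"
  have w0: "w \<noteq> 0" using x1(1) el by (simp add: w_def)
  have "x1 \<in> K" using D(3) x1(4) gen_incl[of x1 "insert x1 (range e)"] by auto
  then have wK: "w \<in> K"
    unfolding w_def using D(9) by (auto intro!: sfield_intros[OF D(6)])
  have "gen (insert (w * y) K) = gen (insert y K)"
  proof (rule gen_insert_eq)
    show "w * y \<in> gen (insert y K)"
      using wK by (intro sfield_intros[OF sfield_gen] gen_incl) auto
    have "w * y / w \<in> gen (insert (w * y) K)"
      using wK by (intro sfield_intros(8)[OF sfield_gen] gen_incl) auto
    then show "y \<in> gen (insert (w * y) K)" using w0 by simp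
  qed
  moreover have "(w * y) ^ 3 = ev e G x1"
  proof -
    have "e l ^ 3 * ev e G x1 = (e c * x1 + e d) ^ 3 * y ^ 3"
      using ev_act[OF D(1) nondegenerate_degree(2)[OF F] x1(1,2)] D(5) abcd(3) by (simp add: E H)
    then show ?thesis using el unfolding w_def power_mult_distrib power_divide by (simp add: divide_simps ac_simps)
  qed
  ultimately have "presented (e, K, L) G x1 (w * y)"
    using D x1 by simp
  then show ?thesis by (rule that)
qed

text \<open>A polynomial vanishes at one transcendental element iff it vanishes at the other, so the
  pairs of corresponding quotients form the graph of a homomorphism.\<close>

lemma rational_function_hom:
  assumes e: "hom_on UNIV e" "transcendental_over e x" and e': "hom_on UNIV e'" "transcendental_over e' x'"
  obtains h where "hom_on (gen (insert x (range e))) h" "\<And>p. h (ev e p x) = ev e' p x'"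
    "\<And>a. h (e a) = e' a" "h x = x'"
proof -
  note E = ev_hom[OF e(1)] and E' = ev_hom[OF e'(1)]
    and H = hom_onD[OF sfield_UNIV e(1)] and H' = hom_onD[OF sfield_UNIV e'(1)]
  note T = transcendentalD[OF e(2)] and T' = transcendentalD[OF e'(2)]
  define \<Gamma> where "\<Gamma> = {(ev e p x / ev e q x, ev e' p x' / ev e' q x') |p q. q \<noteq> 0}"
  have I: "(ev e p x / ev e q x, ev e' p x' / ev e' q x') \<in> \<Gamma>" if "q \<noteq> 0" for p q
    using that unfolding \<Gamma>_def by blast
  have "hom_graph \<Gamma>"
    unfolding hom_graph_iff
  proof (intro conjI allI impI)
    show "(1, 1) \<in> \<Gamma>" using I[of 1 1] by (simp add: E E')
    show "b = 0" if "(0, b) \<in> \<Gamma>" for b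
    proof -
      from that obtain p q where "q \<noteq> 0" "ev e p x / ev e q x = 0" "b = ev e' p x' / ev e' q x'"
        unfolding \<Gamma>_def by auto
      then show ?thesis using T[of p] T[of q] by (cases "p = 0") (auto simp: E')
    qed
    fix a b c d assume "(a, b) \<in> \<Gamma>" "(c, d) \<in> \<Gamma>"
    then obtain p q r s where pq: "q \<noteq> 0" "a = ev e p x / ev e q x" "b = ev e' p x' / ev e' q x'"
      and rs: "s \<noteq> 0" "c = ev e r x / ev e s x" "d = ev e' r x' / ev e' s x'" unfolding \<Gamma>_def by auto
    have qs: "q * s \<noteq> 0" using pq rs by simp
    show "(a - c, b - d) \<in> \<Gamma>"
      using I[OF qs, of "p * s - r * q"] T[OF pq(1)] T[OF rs(1)] T'[OF pq(1)] T'[OF rs(1)]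
      unfolding pq(2,3) rs(2,3) by (simp add: E E' diff_frac_eq)
    show "(a * c, b * d) \<in> \<Gamma>"
      using I[OF qs, of "p * r"] unfolding pq(2,3) rs(2,3) by (simp add: E E')
    show "(inverse a, inverse b) \<in> \<Gamma>"
    proof (cases "p = 0")
      case True
      then show ?thesis using I[of 1 0] unfolding pq(2,3) by (simp add: E E')
    next
      case False
      then show ?thesis using I[of p q] unfolding pq(2,3) by simp
    qed
  qed
  then obtain F h where F: "sfield F" "hom_on F h" "\<Gamma> = (\<lambda>a. (a, h a)) ` F"
    by (auto simp: hom_graph_def)
  have mem: "(a, b) \<in> \<Gamma> \<longleftrightarrow> a \<in> F \<and> b = h a" for a b unfolding F(3) by auto
  have "gen (insert x (range e)) \<subseteq> F"
    unfolding rational_functions[OF e] using I mem by blast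
  then have hh: "hom_on (gen (insert x (range e))) h" by (rule hom_on_subset[OF F(2)])
  have hev: "h (ev e p x) = ev e' p x'" for p
    using I[of 1 p] unfolding mem by (simp add: E E')
  show ?thesis
    by (rule that[OF hh hev]) (use hev[of "[:_:]"] hev[of "[:0, 1:]"] in \<open>simp_all add: E E' H H'\<close>)
qed

section \<open>Bi-isomorphisms of presented extensions\<close>

lemma bi_isomorphicI:
  assumes "sfield K" "sfield L" "K \<subseteq> L" "hom_on L h" "h ` L = L'" "h ` K = K'" "\<And>a. h (e a) = e' a"
  shows "bi_isomorphic (e, K, L) (e', K', L')"
  using assms hom_on_subset[OF assms(4,3)]
  by (auto simp: ring_iso_sub_fld_iff intro!: exI[of _ h])

text \<open>Above the isomorphism of rational function fields, \<open>y\<close> may be sent to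
  \<open>y'\<close>, since its minimal polynomial \<open>X ^ 3 - F(x)\<close> is mapped to one with
  root \<open>y'\<close>.\<close>

lemma presented_bi_isomorphic:
  assumes p: "presented (e, K, L) F x y" and p': "presented (e', K', L') F x' y'" and F: "nondegenerate F"
  shows "bi_isomorphic (e, K, L) (e', K', L')"
proof -
  note D = presentedD[OF p] and D' = presentedD[OF p']
  obtain h where h: "hom_on (gen (insert x (range e))) h" "\<And>p. h (ev e p x) = ev e' p x'"
    "\<And>a. h (e a) = e' a" "h x = x'"
    using rational_function_hom[OF D(1,2) D'(1,2)] by metis
  have hK: "hom_on K h" using h(1) D(3) by simp
  note HK = hom_onD[OF D(6) hK]
  have "poly (map_poly h [:- (y ^ 3), 0, 0, 1:]) y' = 0"
    using h(2)[of F] D(5,12) D'(5) HK(1,2,5)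
    by (simp add: map_poly_hom_pCons[OF D(6) hK]) (simp add: power3_eq_cube mult.assoc)
  then obtain g where g: "hom_on (gen (insert y K)) g" "\<And>a. a \<in> K \<Longrightarrow> g a = h a" "g y = y'"
    using hom_extend_simple[OF D(6) hK cube_root_min_poly[OF D(6) presented_noncube[OF p F] D(12)]] by metis
  have hKi: "h ` K = K'"
    using hom_on_gen_image[OF h(1)] h(3,4) D(3) D'(3) by (simp add: image_image)
  have gKi: "g ` K = K'" using hKi g(2) by auto
  show ?thesis
  proof (rule bi_isomorphicI[of K L g])
    show "hom_on L g" using g(1) D(4) by simp
    show "g ` L = L'"
      using hom_on_gen_image[OF g(1)] gKi g(3) D(4) D'(4) by simp
    show "g (e a) = e' a" for a using g(2)[of "e a"] h(3)[of a] D(9) by auto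
  qed (use D gKi in auto)
qed

text \<open>What symmetry and transitivity of bi-isomorphism rely on. It is weaker than
  \<open>cubic_extension\<close> and so applies to base changes, for which nothing more is known at
  first.\<close>

fun wf_extn :: "('k::field, 'u::field) extn \<Rightarrow> bool" where
  "wf_extn (e, K, L) \<longleftrightarrow> hom_on UNIV e \<and> sfield K \<and> sfield L \<and> range e \<subseteq> K \<and> K \<subseteq> L"

lemma presented_wf: "presented M F x y \<Longrightarrow> wf_extn M"
  using presentedD[of "fst M" "fst (snd M)" "snd (snd M)" F x y] by (cases M) auto

lemma cubic_extension_wf: "cubic_extension M \<Longrightarrow> wf_extn M"
  by (cases M) (auto simp: function_field_def ring_hom_amb_iff subfield_amb_iff)

lemma bi_isomorphicE:
  assumes "bi_isomorphic (e, K, L) (e', K', L')" "wf_extn (e, K, L)"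
  obtains h where "hom_on L h" "h ` L = L'" "h ` K = K'" "\<And>a. h (e a) = e' a"
proof -
  obtain h g where h: "hom_on L h" "h ` L = L'" "hom_on K g" "g ` K = K'" "\<forall>z\<in>K. h z = g z"
    "\<forall>a. h (e a) = e' a"
    using assms by (auto simp: ring_iso_sub_fld_iff)
  have "h ` K = K'" using h(4,5) by auto
  then show ?thesis using that h by blast
qed

lemma bi_isomorphic_wf:
  assumes "bi_isomorphic M M'" "wf_extn M"
  shows "wf_extn M'"
proof -
  obtain e K L e' K' L' where M: "M = (e, K, L)" "M' = (e', K', L')" by (metis prod_cases3)
  obtain h where h: "hom_on L h" "h ` L = L'" "h ` K = K'" "\<And>a. h (e a) = e' a"
    using bi_isomorphicE assms M by metis
  have w: "hom_on UNIV e" "sfield K" "sfield L" "range e \<subseteq> K" "K \<subseteq> L" using assms(2) M by auto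
  have "e' = (\<lambda>a. h (e a))" using h(4) by auto
  then have "hom_on UNIV e'" using hom_on_comp[OF w(1) h(1)] w by auto
  moreover have "sfield K'" "sfield L'"
    using hom_on_image[OF w(2) hom_on_subset[OF h(1) w(5)]] hom_on_image[OF w(3) h(1)] h by auto
  moreover have "range e' \<subseteq> K'" using h(3,4) w(4) by (metis image_subset_iff imageI rangeI)
  moreover have "K' \<subseteq> L'" using h(2,3) w(5) by blast
  ultimately show ?thesis using M by simp
qed

lemma hom_on_inv_into:
  assumes "sfield L" "hom_on L h"
  shows "hom_on (h ` L) (inv_into L h)"
proof -
  note H = hom_onD[OF assms] and S = sfield_intros[OF assms(1)]
  have inj: "inj_on h L" using H(11) by (auto simp: inj_on_def)
  have i: "inv_into L h (h a) = a" if "a \<in> L" for a using inj that by (rule inv_into_f_f)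
  show ?thesis
    unfolding hom_on_def
  proof (intro conjI ballI)
    show "inv_into L h 1 = 1" using i[OF S(2)] H(2) by simp
    fix a b assume "a \<in> h ` L" "b \<in> h ` L"
    then obtain a' b' where ab: "a' \<in> L" "b' \<in> L" "a = h a'" "b = h b'" by auto
    show "inv_into L h (a + b) = inv_into L h a + inv_into L h b"
      using i[OF S(5)[OF ab(1,2)]] ab i H by simp
    show "inv_into L h (a * b) = inv_into L h a * inv_into L h b"
      using i[OF S(6)[OF ab(1,2)]] ab i H by simp
  qed
qed

lemma bi_isomorphic_sym:
  assumes "bi_isomorphic M M'" "wf_extn M"
  shows "bi_isomorphic M' M"
proof -
  obtain e K L e' K' L' where M: "M = (e, K, L)" "M' = (e', K', L')" by (metis prod_cases3)
  obtain h where h: "hom_on L h" "h ` L = L'" "h ` K = K'" "\<And>a. h (e a) = e' a"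
    using bi_isomorphicE assms M by metis
  have w: "hom_on UNIV e" "sfield K" "sfield L" "range e \<subseteq> K" "K \<subseteq> L" using assms(2) M by auto
  have w': "wf_extn (e', K', L')" using bi_isomorphic_wf[OF assms] M by simp
  have inj: "inj_on h L" using hom_onD(11)[OF w(3) h(1)] by (auto simp: inj_on_def)
  have i: "inv_into L h (h a) = a" if "a \<in> L" for a using inj that by (rule inv_into_f_f)
  have iK: "inv_into L h ` (h ` A) = A" if "A \<subseteq> L" for A
    using that i by (force simp: image_image)
  show ?thesis
    unfolding M
  proof (rule bi_isomorphicI[of K' L' "inv_into L h"])
    show "hom_on L' (inv_into L h)" using hom_on_inv_into[OF w(3) h(1)] h(2) by simp
    show "inv_into L h ` L' = L" "inv_into L h ` K' = K" using iK w(5) h(2,3) by auto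
    show "inv_into L h (e' a) = e a" for a using i[of "e a"] h(4) w(4,5) by auto
  qed (use w' in auto)
qed

lemma bi_isomorphic_trans:
  assumes "bi_isomorphic M M'" "bi_isomorphic M' M''" "wf_extn M"
  shows "bi_isomorphic M M''"
proof -
  obtain e K L e' K' L' e'' K'' L'' where M: "M = (e, K, L)" "M' = (e', K', L')" "M'' = (e'', K'', L'')"
    by (metis prod_cases3)
  obtain h where h: "hom_on L h" "h ` L = L'" "h ` K = K'" "\<And>a. h (e a) = e' a"
    using bi_isomorphicE assms M by metis
  have "wf_extn (e', K', L')" using bi_isomorphic_wf[OF assms(1,3)] M by simp
  then obtain g where g: "hom_on L' g" "g ` L' = L''" "g ` K' = K''" "\<And>a. g (e' a) = e'' a"
    using bi_isomorphicE assms M by metis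
  have w: "hom_on UNIV e" "sfield K" "sfield L" "range e \<subseteq> K" "K \<subseteq> L" using assms(3) M by auto
  show ?thesis
    unfolding M
  proof (rule bi_isomorphicI[of K L "\<lambda>z. g (h z)"])
    show "hom_on L (\<lambda>z. g (h z))" using hom_on_comp[OF h(1) g(1)] h(2) by simp
    show "(\<lambda>z. g (h z)) ` L = L''" "(\<lambda>z. g (h z)) ` K = K''"
      using h(2,3) g(2,3) by (auto simp flip: image_image)
  qed (use w h g in auto)
qed

text \<open>Transport of structure: the generators go to their images, and the form stays because
  its coefficients lie in \<open>k\<close>.\<close>

lemma presented_bi_isomorphic_transfer:
  assumes "bi_isomorphic M M'" "presented M F x y"
  obtains x' y' where "presented M' F x' y'"
proof -
  obtain e K L e' K' L' where M: "M = (e, K, L)" "M' = (e', K', L')" by (metis prod_cases3)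
  have p: "presented (e, K, L) F x y" using assms(2) M by simp
  note D = presentedD[OF p]
  obtain h where h: "hom_on L h" "h ` L = L'" "h ` K = K'" "\<And>a. h (e a) = e' a"
    using bi_isomorphicE assms(1) presented_wf[OF p] M by metis
  have hK: "hom_on K h" by (rule hom_on_subset[OF h(1) D(8)])
  have e'h: "e' = (\<lambda>a. h (e a))" using h(4) by auto
  have e': "hom_on UNIV e'"
    using hom_on_comp[OF D(1) hK] D(9) unfolding e'h by auto
  have he: "h (ev e p x) = ev e' p (h x)" for p
  proof -
    have "map_poly e p \<in> polyF K"
      using polyF_map_poly[OF sfield_UNIV D(1), of p] polyF_mono[OF D(9)] by auto
    from hom_on_poly[OF D(6) hK this D(10)] show ?thesis
      unfolding e'h by (simp add: map_poly_map_poly hom_on_0[OF D(6) hK] hom_on_0[OF sfield_UNIV D(1)] comp_def)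
  qed
  have "transcendental_over e' (h x)"
    unfolding transcendental_over_def
  proof (intro allI impI)
    fix p :: "'a poly" assume "p \<noteq> 0"
    then have "ev e p x \<noteq> 0" by (rule transcendentalD[OF D(2)])
    moreover have "ev e p x \<in> K" using ev_mem_gen[OF D(1)] D(3) by simp
    ultimately show "ev e' p (h x) \<noteq> 0" using he hom_on_eq_0_iff[OF D(6) hK] by metis
  qed
  moreover have "K' = gen (insert (h x) (range e'))"
    using hom_on_gen_image[of "insert x (range e)" h] hK D(3) h(3,4) by (simp add: image_image)
  moreover have "L' = gen (insert (h y) K')"
    using hom_on_gen_image[of "insert y K" h] h D(4) by simp
  moreover have "h y ^ 3 = ev e' F (h x)"
    using D(5) he[of F] hom_on_power[OF D(7) h(1) D(11), of 3] by simp
  ultimately have "presented M' F (h x) (h y)" using e' M by simp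
  then show ?thesis by (rule that)
qed

text \<open>An isomorphism carries the presentation by \<open>F\<close> to the other extension,
  where it meets the one by \<open>G\<close> and \<open>presented_unique\<close> compares them.
  Conversely an equivalence changes the generators of one extension until both are presented by the
  same form.\<close>

lemma presented_form_equiv_iff:
  fixes M :: "('k::field, 'u::field) extn" and M' :: "('k, 'v::field) extn"
  assumes char: "CHAR('k) \<noteq> 3" and p: "presented M F x y" "presented M' G x' y'" and g: "nondegenerate F" "nondegenerate G"
  shows "bi_isomorphic M M' \<longleftrightarrow> form_equiv F G"
proof
  obtain e K L e' K' L' where M: "M = (e, K, L)" "M' = (e', K', L')" by (metis prod_cases3)
  show "form_equiv F G" if "bi_isomorphic M M'"
  proof -
    from presented_bi_isomorphic_transfer[OF that p(1)]
    obtain x1 y1 where "presented M' F x1 y1" by metis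
    then show ?thesis using presented_unique[OF char _ _ g, of e' K' L' x1 y1 x' y'] p(2) M
      unfolding form_equiv_def by metis
  qed
  show "bi_isomorphic M M'" if FG: "form_equiv F G"
  proof -
    obtain x1 y1 where "presented M G x1 y1"
      using presented_form_equiv[of e K L F x y G] p(1) g(1) FG M by metis
    then show ?thesis using presented_bi_isomorphic[of e K L G x1 y1 e' K' L' x' y'] p(2) g(2) M by simp
  qed
qed

subsection \<open>Base change and constants\<close>

lemma dimension_simple_extension:
  assumes F: "sfield F" and p: "min_poly_over F z p"
  shows "ring.dimension amb (degree p) F (gen (insert z F))"
proof -
  interpret R: Ring.ring "amb :: 'a ring" by (rule ring_amb)
  have pF: "p \<in> polyF F" "p \<noteq> 0" "poly p z = 0" using p by (auto simp: min_poly_over_def)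
  \<comment> \<open>The span of \<open>1, z, ..., z ^ (m - 1)\<close>. While \<open>m\<close> is
    below the degree of the minimal polynomial, \<open>z ^ m\<close> lies outside and adds one
    dimension.\<close>
  define S where "S m = {poly q z |q. q \<in> polyF F \<and> (\<forall>i\<ge>m. coeff q i = 0)}" for m
  have "R.dimension m F (S m)" if "m \<le> degree p" for m
    using that
  proof (induction m)
    case 0
    have "S 0 = {0}"
    proof
      show "S 0 \<subseteq> {0}" by (auto simp: S_def) (metis coeff_0 poly_0 poly_eqI)
      show "{0} \<subseteq> S 0" using polyF_0[OF F] by (auto simp: S_def intro!: exI[of _ 0])
    qed
    then show ?case using R.zero_dim[of F] by simp
  next
    case (Suc m)
    have "z ^ m \<notin> S m"
    proof
      assume "z ^ m \<in> S m"
      then obtain q where q: "q \<in> polyF F" "\<forall>i\<ge>m. coeff q i = 0" "z ^ m = poly q z"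
        by (auto simp: S_def)
      let ?r = "monom 1 m - q"
      have "coeff ?r m = 1" using q(2) by simp
      then have "?r \<noteq> 0" by auto
      moreover have "?r \<in> polyF F" by (intro polyF_intros[OF F] sfield_1[OF F] q(1))
      moreover have "poly ?r z = 0" using q(3) by (simp add: poly_monom)
      ultimately have "degree p \<le> degree ?r" using p by (auto simp: min_poly_over_def)
      moreover have "degree ?r \<le> m" by (rule degree_le) (use q(2) in auto)
      ultimately show False using Suc.prems by simp
    qed
    moreover have "R.line_extension F (z ^ m) (S m) = S (Suc m)"
    proof (intro equalityI subsetI)
      fix u assume "u \<in> R.line_extension F (z ^ m) (S m)"
      then obtain k q where kq: "k \<in> F" "q \<in> polyF F" "\<forall>i\<ge>m. coeff q i = 0" "u = k * z ^ m + poly q z"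
        by (auto simp: R.line_extension_mem_iff S_def)
      have "monom k m + q \<in> polyF F" by (intro polyF_intros[OF F] kq)
      moreover have "u = poly (monom k m + q) z" using kq(4) by (simp add: poly_monom)
      ultimately show "u \<in> S (Suc m)" unfolding S_def using kq(3) by (force intro!: exI[of _ "monom k m + q"])
    next
      fix u assume "u \<in> S (Suc m)"
      then obtain q where q: "q \<in> polyF F" "\<forall>i\<ge>Suc m. coeff q i = 0" "u = poly q z" by (auto simp: S_def)
      let ?r = "q - monom (coeff q m) m"
      have "?r \<in> polyF F" by (intro polyF_intros[OF F] q(1) polyFD[OF q(1)])
      moreover have "coeff ?r i = 0" if "i \<ge> m" for i using q(2) that by (cases "i = m") auto
      ultimately have "poly ?r z \<in> S m" unfolding S_def by blast
      moreover have "u = coeff q m * z ^ m + poly ?r z" using q(3) by (simp add: poly_monom)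
      ultimately show "u \<in> R.line_extension F (z ^ m) (S m)"
        using polyFD[OF q(1)] by (auto simp: R.line_extension_mem_iff)
    qed
    ultimately show ?case using R.Suc_dim[of "z ^ m" "S m" m F] Suc by simp
  qed
  from this[of "degree p"] have "R.dimension (degree p) F (S (degree p))" by simp
  moreover have "S (degree p) = gen (insert z F)"
  proof -
    have alg: "alg_over F z" using pF unfolding alg_over_def by blast
    have "poly q z \<in> S (degree p)" if q: "q \<in> polyF F" for q
    proof -
      obtain s r where sr: "s \<in> polyF F" "r \<in> polyF F" "q = s * p + r" "r = 0 \<or> degree r < degree p"
        by (rule polyF_division[OF F pF(1,2) q])
      have "coeff r i = 0" if "i \<ge> degree p" for i
        using sr(4) that by (auto intro: coeff_eq_0)
      moreover have "poly q z = poly r z" using sr(3) pF(3) by simp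
      ultimately show ?thesis unfolding S_def using sr(2) by blast
    qed
    then show ?thesis unfolding simple_alg_extension[OF F alg] S_def by blast
  qed
  ultimately show ?thesis by simp
qed

text \<open>A polynomial over an algebraically closed field splits there, so a larger field contains
  no further roots. This is how elements are recognised as constants below.\<close>

lemma alg_closed_root_in_range:
  fixes E :: "'k::alg_closed_field \<Rightarrow> 'u::field"
  assumes E: "hom_on UNIV E" and "P \<noteq> 0" "ev E P w = 0"
  shows "w \<in> range E"
  using assms(2,3)
proof (induction "degree P" arbitrary: P)
  case 0
  then obtain c where "P = [:c:]" using degree_eq_zeroE by metis
  then show ?case using 0 hom_onD(1,7)[OF sfield_UNIV E] by (simp add: ev_hom[OF E])
next
  case (Suc n)
  then obtain r where "poly P r = 0" using alg_closed_imp_poly_has_root[of P] by auto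
  then have "[:-r, 1:] dvd P" using poly_eq_0_iff_dvd by blast
  then obtain Q where Q: "P = [:-r, 1:] * Q" by (rule dvdE)
  then have "Q \<noteq> 0" using Suc by auto
  then have "degree P = Suc (degree Q)" unfolding Q by (subst degree_mult_eq) auto
  then have dQ: "n = degree Q" using Suc by simp
  have "ev E [:-r, 1:] w * ev E Q w = 0" using Suc.prems(2) Q ev_hom(5)[OF E] by metis
  then have "w - E r = 0 \<or> ev E Q w = 0"
    by (simp add: ev_hom[OF E] hom_onD[OF sfield_UNIV E])
  then show ?case using Suc.hyps(1)[OF dQ \<open>Q \<noteq> 0\<close>] by auto
qed

definition ac_lift :: "('k::field \<Rightarrow> 'u::field) \<Rightarrow> ('k alg_closure \<Rightarrow> 'u alg_closure) \<Rightarrow> bool" where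
  "ac_lift e E \<longleftrightarrow> hom_on UNIV e \<and> hom_on UNIV E \<and> (\<forall>a. E (to_ac a) = to_ac (e a))"

text \<open>The map on \<open>k\<close> extends to its closure, all of whose elements are algebraic,
  because the target is algebraically closed; \<open>of_ac\<close> inverts \<open>to_ac\<close> on
  the copy of \<open>k\<close>.\<close>

lemma ac_lift_exists:
  fixes e :: "'k::field \<Rightarrow> 'u::field"
  assumes e: "hom_on UNIV e"
  obtains E where "ac_lift e E"
proof -
  let ?F = "range (to_ac :: 'k \<Rightarrow> 'k alg_closure)"
  have F: "sfield ?F" by (rule sfield_range) simp
  have "hom_on ?F (\<lambda>z. to_ac (e (of_ac z)) :: 'u alg_closure)"
    unfolding hom_on_def
  proof (intro conjI ballI)
    note H = hom_onD[OF sfield_UNIV e]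
    show "to_ac (e (of_ac 1)) = 1" by (simp add: H)
    fix a b :: "'k alg_closure" assume "a \<in> ?F" "b \<in> ?F"
    then obtain a' b' where ab: "a = to_ac a'" "b = to_ac b'" by auto
    show "to_ac (e (of_ac (a + b))) = to_ac (e (of_ac a)) + to_ac (e (of_ac b))"
      unfolding ab to_ac_add[symmetric] of_ac_to_ac by (simp add: H)
    show "to_ac (e (of_ac (a * b))) = to_ac (e (of_ac a)) * to_ac (e (of_ac b))"
      unfolding ab to_ac_mult[symmetric] of_ac_to_ac by (simp add: H)
  qed
  moreover have "alg_over ?F z" for z
  proof -
    obtain p :: "'k poly" where p: "p \<noteq> 0" "poly (map_poly to_ac p) z = 0"
      by (rule alg_closure_algebraic)
    have "ac_poly p \<in> polyF ?F" by (simp add: polyF_def map_poly_to_ac)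
    then show ?thesis using p by (auto simp: alg_over_def map_poly_to_ac intro!: bexI[of _ "ac_poly p"])
  qed
  ultimately obtain E where E: "hom_on (gen (?F \<union> UNIV)) E" "\<And>a. a \<in> ?F \<Longrightarrow> E a = to_ac (e (of_ac a))"
    using hom_extend_algebraic[OF F, where T = UNIV] by metis
  have "gen (?F \<union> UNIV) = UNIV" using gen_superset[of "?F \<union> UNIV"] by auto
  with E(1) have "hom_on UNIV E" by simp
  then have "ac_lift e E" using e E(2) by (simp add: ac_lift_def)
  then show ?thesis by (rule that)
qed

lemma ac_lift_ev:
  assumes "ac_lift e E"
  shows "ev E (ac_poly p) (to_ac x) = to_ac (ev e p x)"
proof -
  note l = assms[unfolded ac_lift_def]
  have "map_poly E (ac_poly p) = map_poly to_ac (map_poly e p)"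
    by (rule poly_eqI)
      (simp add: coeff_map_poly_hom[OF sfield_UNIV] l hom_on_to_ac coeff_map_poly hom_on_0[OF sfield_UNIV conjunct1[OF l]])
  then show ?thesis using hom_on_poly[OF sfield_UNIV hom_on_to_ac, of "map_poly e p" x] by simp
qed

text \<open>If \<open>to_ac x\<close> were algebraic over the closure of \<open>k\<close>, it would
  be a constant and \<open>x\<close> would be algebraic over \<open>k\<close>.\<close>

lemma ac_lift_transcendental:
  assumes "ac_lift e E" "transcendental_over e x"
  shows "transcendental_over E (to_ac x)"
  unfolding transcendental_over_def
proof (intro allI impI notI)
  have E: "hom_on UNIV E" using assms(1) by (simp add: ac_lift_def)
  fix P assume "P \<noteq> 0" "ev E P (to_ac x) = 0"
  then have "to_ac x \<in> range E" by (rule alg_closed_root_in_range[OF E])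
  then obtain r where r: "to_ac x = E r" by auto
  obtain p where p: "p \<noteq> 0" "poly (ac_poly p) r = 0" by (rule alg_closure_algebraic)
  have "to_ac (ev e p x) = ev E (ac_poly p) (E r)" using ac_lift_ev[OF assms(1), of p x] unfolding r by simp
  also have "\<dots> = 0" using ev_const[OF E] p(2) hom_on_0[OF sfield_UNIV E] by simp
  finally show False using transcendentalD[OF assms(2) p(1)] by simp
qed

lemma gen_gen_Un: "gen (gen S \<union> T) = gen (S \<union> T)"
proof
  have "gen S \<subseteq> gen (S \<union> T)" by (rule gen_mono) auto
  then show "gen (gen S \<union> T) \<subseteq> gen (S \<union> T)"
    by (intro gen_least) (auto intro: gen_incl)
  show "gen (S \<union> T) \<subseteq> gen (gen S \<union> T)"
    by (rule gen_mono) (auto intro: gen_incl)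
qed

lemma gen_insert_gen: "gen (insert y (gen S)) = gen (insert y S)"
  using gen_gen_Un[of S "{y}"] by (simp add: Un_commute)

lemma base_change_ac_lift:
  assumes "base_change (e, K, L) (E, K', L')" "hom_on UNIV e"
  shows "ac_lift e E"
  using assms by (simp add: ac_lift_def ring_hom_amb_iff)

text \<open>Generators survive base change and the form is merely read over the closure, so a base
  change can be handled through its presentation.\<close>

lemma presented_base_change:
  assumes p: "presented (e, K, L) F x y" and b: "base_change (e, K, L) (E, K', L')"
  shows "presented (E, K', L') (ac_poly F) (to_ac x) (to_ac y)"
proof -
  note D = presentedD[OF p]
  have l: "ac_lift e E" by (rule base_change_ac_lift[OF b D(1)])
  then have E: "hom_on UNIV E" by (simp add: ac_lift_def)
  have sub: "to_ac ` range e \<subseteq> range E" using l by (auto simp: ac_lift_def image_iff) metis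
  have K: "to_ac ` K = gen (insert (to_ac x) (to_ac ` range e))"
    unfolding D(3) by (subst hom_on_gen_image) auto
  have L: "to_ac ` L = gen (insert (to_ac y) (to_ac ` K))"
    unfolding D(4) by (subst hom_on_gen_image) auto
  have K': "K' = gen (insert (to_ac x) (range E))"
    using b sub unfolding base_change.simps K gen_gen_Un by (simp add: Un_absorb1)
  have "L' = gen (gen (insert (to_ac y) (to_ac ` K)) \<union> range E)"
    using b L by simp
  also have "\<dots> = gen (insert (to_ac y) (to_ac ` K \<union> range E))"
    unfolding gen_gen_Un by simp
  also have "\<dots> = gen (insert (to_ac y) K')"
    using b by (simp add: gen_insert_gen)
  finally have "L' = gen (insert (to_ac y) K')" .
  moreover have "to_ac y ^ 3 = ev E (ac_poly F) (to_ac x)"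
    using ac_lift_ev[OF l] D(5) by (metis to_ac_power)
  ultimately show ?thesis using E ac_lift_transcendental[OF l D(2)] K' by simp
qed

lemma base_change_exists:
  assumes "hom_on UNIV e"
  obtains N where "base_change (e, K, L) N"
proof -
  obtain E where "ac_lift e E" by (rule ac_lift_exists[OF assms])
  then have "base_change (e, K, L) (E, gen (to_ac ` K \<union> range E), gen (to_ac ` L \<union> range E))"
    by (simp add: ac_lift_def ring_hom_amb_iff)
  then show ?thesis by (rule that)
qed

lemma presented_base_change_exists:
  assumes p: "presented (e, K, L) F x y"
  obtains E K' L' where "base_change (e, K, L) (E, K', L')" "presented (E, K', L') (ac_poly F) (to_ac x) (to_ac y)"
  using base_change_exists[OF presentedD(1)[OF p]] presented_base_change[OF p] by (metis prod_cases3)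

lemma rational_constants:
  assumes p: "presented (e, K, L) F x y" and E: "ac_lift e E" and z: "z \<in> K" "to_ac z \<in> range E"
  shows "z \<in> range e"
proof -
  note D = presentedD[OF p]
  have EH: "hom_on UNIV E" using E by (simp add: ac_lift_def)
  obtain r where r: "to_ac z = E r" using z(2) by auto
  obtain f g where fg: "g \<noteq> 0" "ev e g x \<noteq> 0" "z = ev e f x / ev e g x"
    using rational_functionE[OF D(1,2)] z(1) D(3) by metis
  have "ev E (ac_poly f) (to_ac x) = E r * ev E (ac_poly g) (to_ac x)"
    using fg(2,3) unfolding ac_lift_ev[OF E] r[symmetric] by simp
  then have "ev E (ac_poly f) (to_ac x) = ev E (smult r (ac_poly g)) (to_ac x)"
    by (simp add: ev_hom[OF EH])
  then have eq: "ac_poly f = smult r (ac_poly g)"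
    by (simp only: ev_eq_iff[OF EH ac_lift_transcendental[OF E D(2)]])
  \<comment> \<open>By \<open>f = r g\<close> the constant \<open>r\<close> is a quotient of
    coefficients of polynomials over \<open>k\<close>.\<close>
  define s where "s = coeff f (degree g) / lead_coeff g"
  have "to_ac (coeff f (degree g)) = r * to_ac (lead_coeff g)"
    using arg_cong[OF eq, of "\<lambda>h. coeff h (degree g)"] by (simp add: map_poly_to_ac)
  then have "r = to_ac s" using fg(1) by (simp add: s_def)
  then have "to_ac z = to_ac (e s)" using r E by (simp add: ac_lift_def)
  then show ?thesis by simp
qed

text \<open>An algebraic \<open>z\<close> becomes a constant after base change. There
  \<open>1, y, y ^ 2\<close> are still independent over \<open>K'\<close>, since the form stays
  nondegenerate and \<open>y ^ 3\<close> stays a noncube; comparing coefficients puts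
  \<open>z\<close> into \<open>K\<close>, where the constants are those of \<open>k\<close>.\<close>

lemma presented_constants:
  assumes p: "presented (e, K, L) F x y" and F: "nondegenerate F" and z: "z \<in> L" "\<not> transcendental_over e z"
  shows "z \<in> range e"
proof -
  note D = presentedD[OF p]
  obtain E K' L' where b: "base_change (e, K, L) (E, K', L')"
    and p': "presented (E, K', L') (ac_poly F) (to_ac x) (to_ac y)"
    by (rule presented_base_change_exists[OF p])
  note D' = presentedD[OF p']
  have l: "ac_lift e E" by (rule base_change_ac_lift[OF b D(1)])
  obtain f where f: "f \<noteq> 0" "ev e f z = 0" using z(2) by (auto simp: transcendental_over_def)
  then have "ev E (ac_poly f) (to_ac z) = 0" using ac_lift_ev[OF l] by simp
  then have zE: "to_ac z \<in> range E"
    using alg_closed_root_in_range[OF D'(1)] f(1) by (metis map_poly_to_ac(4))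
  have "gen (insert y K) = {a + b * y + c * y ^ 2 |a b c. a \<in> K \<and> b \<in> K \<and> c \<in> K}"
    by (rule cube_root_gen[OF D(6) presented_noncube[OF p F] D(12)])
  then obtain a b' c where abc: "a \<in> K" "b' \<in> K" "c \<in> K" "z = a + b' * y + c * y ^ 2"
    using z(1) D(4) by blast
  have KK': "to_ac u \<in> K'" if "u \<in> K" for u
    using b that by (auto intro: gen_incl)
  have g': "nondegenerate (ac_poly F)" using F nondegenerate_map_poly[OF hom_on_to_ac] by blast
  have "(to_ac a - to_ac z) + to_ac b' * to_ac y + to_ac c * to_ac y ^ 2 = 0"
    unfolding abc(4) by simp
  moreover have "to_ac a - to_ac z \<in> K'" using KK'[OF abc(1)] zE D'(9) sfield_diff[OF D'(6)] by blast
  ultimately have "to_ac a - to_ac z = 0 \<and> to_ac b' = 0 \<and> to_ac c = 0"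
    using cube_root_independent[OF D'(6) presented_noncube[OF p' g'] D'(12)] KK' abc(2,3) by blast
  then have "z \<in> K" using abc(1) by simp
  then show ?thesis using rational_constants[OF p l _ zE] by simp
qed

lemma presented_cubic_extension:
  assumes p: "presented (e, K, L) F x y" and F: "nondegenerate F"
  shows "cubic_extension (e, K, L)"
proof -
  interpret R: Ring.ring "amb :: 'b ring" by (rule ring_amb)
  note D = presentedD[OF p]
  have dL: "ring.dimension amb 3 K L"
    using dimension_simple_extension[OF D(6) cube_root_min_poly[OF D(6) presented_noncube[OF p F] D(12)]] D(4)
    by (simp add: numeral_3_eq_3)
  have dK: "ring.dimension amb 1 K K"
    using R.dimension_one[of K] D(6) by (simp add: subfield_amb_iff)
  have K: "gen (insert x (range e)) = K" using D(3) by simp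
  have "function_field e K"
    unfolding function_field_def ring_hom_amb_iff subfield_amb_iff
    using D dK K presented_constants[OF p F] by (intro conjI bexI[of _ x] exI[of _ 1]) auto
  moreover have "function_field e L"
    unfolding function_field_def ring_hom_amb_iff subfield_amb_iff
    using D dL K presented_constants[OF p F] by (intro conjI bexI[of _ x] exI[of _ 3]) auto
  ultimately show ?thesis using D dL by simp
qed

section \<open>Normal forms and bi-twists from forms\<close>

lemma act_id: "degree F \<le> 3 \<Longrightarrow> act 1 0 0 1 F = F"
  using degree_le_3_eq[of F] act_pCons[of 1 0 0 1 "coeff F 0" "coeff F 1" "coeff F 2" "coeff F 3"]
  by simp

lemma form_equiv_smult_cube: "nondegenerate F \<Longrightarrow> l \<noteq> 0 \<Longrightarrow> form_equiv (smult (l ^ 3) F) F"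
  unfolding form_equiv_def
  by (intro exI[of _ 1] exI[of _ 0] exI[of _ l]) (auto simp: act_id nondegenerate_degree)

lemma presented_smult_cube:
  assumes "presented (e, K, L) (smult (l ^ 3) F) x y" "nondegenerate F" "l \<noteq> 0"
  obtains x' y' where "presented (e, K, L) F x' y'"
  using presented_form_equiv[OF assms(1) nondegenerate_smult form_equiv_smult_cube] assms by (metis power_not_zero)

lemma form_equiv_nondegenerate: "form_equiv F G \<Longrightarrow> nondegenerate F \<Longrightarrow> nondegenerate G"
  unfolding form_equiv_def using nondegenerate_act nondegenerate_smult_iff by (metis power_not_zero)

lemma form_equiv_root_to_infinity:
  assumes F: "nondegenerate F" and r: "poly F r = 0"
  obtains G where "nondegenerate G" "degree G = 2" "form_equiv F G"
proof -
  \<comment> \<open>The substitution \<open>r + 1 / X\<close> sends infinity to \<open>r\<close>;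
    the new coefficient of \<open>X ^ 3\<close> is \<open>F(r) = 0\<close>, so the degree drops to
    two.\<close>
  define G where "G = act r 1 1 0 F"
  have eq: "form_equiv F G"
    unfolding form_equiv_def G_def by (intro exI[of _ r] exI[of _ 1] exI[of _ 0]) auto
  have g: "nondegenerate G" by (rule form_equiv_nondegenerate[OF eq F])
  obtain f0 f1 f2 f3 where f: "F = [:f0, f1, f2, f3:]" using degree_le_3_eq[OF nondegenerate_degree(2)[OF F]] by blast
  have "f0 + f1 * r + f2 * r^2 + f3 * r^3 = 0"
    using r unfolding f by (simp add: power2_eq_square power3_eq_cube algebra_simps)
  then have "coeff G 3 = 0"
    unfolding G_def f act_pCons by (simp add: coeff_pCons numeral_2_eq_2 numeral_3_eq_3)
  then have "degree G \<noteq> 3" using nondegenerate_degree(3)[OF g] by (metis leading_coeff_0_iff)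
  then have "degree G = 2" using nondegenerate_degree(1,2)[OF g] by simp
  then show ?thesis using that g eq by blast
qed

text \<open>As a cubic form it has the roots 0, 1 and infinity.\<close>

abbreviation (input) split_form :: "'k::field poly" where
  "split_form \<equiv> [:0, 1:] * [:-1, 1:]"

lemma nondegenerate_split_form: "nondegenerate (split_form :: 'k::field poly)"
  by (simp add: nondegenerate_def form_disc_def cubic_disc_def coeff_pCons numeral_2_eq_2 numeral_3_eq_3)

lemma form_equiv_split:
  assumes F: "nondegenerate F" "degree F = 2" and r: "poly F r = 0"
  obtains c where "c \<noteq> 0" "form_equiv F (smult c split_form)"
proof -
  have F0: "F \<noteq> 0" using nondegenerate_degree(3)[OF F(1)] .
  have "[:-r, 1:] dvd F" using r poly_eq_0_iff_dvd by blast
  then obtain Q where Q: "F = [:-r, 1:] * Q" by (rule dvdE)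
  then have "Q \<noteq> 0" using F0 by auto
  then have "degree F = Suc (degree Q)" unfolding Q by (subst degree_mult_eq) auto
  then have "degree Q = 1" using F(2) by simp
  then have Qe: "Q = [:coeff Q 0, coeff Q 1:]"
    by (intro poly_eqI) (auto simp: coeff_pCons coeff_eq_0 split: nat.split)
  define u where "u = coeff Q 1"
  have u0: "u \<noteq> 0" using \<open>degree Q = 1\<close> \<open>Q \<noteq> 0\<close> unfolding u_def by (metis leading_coeff_0_iff)
  define s where "s = - coeff Q 0 / u"
  have "coeff Q 0 = - (s * u)" using u0 by (simp add: s_def)
  then have Fe: "F = [:r * s * u, - (r + s) * u, u, 0:]"
    unfolding Q by (subst Qe) (simp add: u_def algebra_simps)
  have "s \<noteq> r"
  proof
    assume "s = r"
    then have "F = smult u ([:-r, 1:] ^ 2)" unfolding Fe by (simp add: power2_eq_square algebra_simps)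
    then have "[:-r, 1:] ^ 2 dvd F" by (metis dvd_smult dvd_refl)
    then have "2 \<le> order r F" using F0 order_divides by blast
    then show False using nondegenerate_order_le_1[OF F(1), of r] by simp
  qed
  \<comment> \<open>\<open>X\<close> is replaced by \<open>r + (s - r) X\<close>, which takes 0 and
    1 to the two roots; each linear factor contributes one \<open>s - r\<close>.\<close>
  have "act (s - r) r 0 1 F = smult 1 (smult (u * (s - r) ^ 2) split_form)"
    unfolding Fe act_pCons by (simp add: power2_eq_square algebra_simps)
  then have "form_equiv F (smult (u * (s - r) ^ 2) split_form)"
    unfolding form_equiv_def using \<open>s \<noteq> r\<close>
    by (intro exI[of _ "s - r"] exI[of _ r] exI[of _ 0] exI[of _ 1]) auto
  moreover have "u * (s - r) ^ 2 \<noteq> 0" using u0 \<open>s \<noteq> r\<close> by simp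
  ultimately show ?thesis using that by blast
qed

text \<open>Over an algebraically closed field three distinct points can be moved to 0, 1 and
  infinity, and the remaining constant is a cube. Hence every nondegenerate form yields a
  bi-twist.\<close>

lemma alg_closed_presented_split:
  fixes e :: "'k::alg_closed_field \<Rightarrow> 'u::field"
  assumes p: "presented (e, K, L) F x y" and F: "nondegenerate F"
  obtains x' y' where "presented (e, K, L) split_form x' y'"
proof -
  obtain r where r: "poly F r = 0"
    using alg_closed_imp_poly_has_root[of F] nondegenerate_degree[OF F] by auto
  obtain G where G: "nondegenerate G" "degree G = 2" "form_equiv F G"
    by (rule form_equiv_root_to_infinity[OF F r])
  obtain x1 y1 where p1: "presented (e, K, L) G x1 y1" by (rule presented_form_equiv[OF p F G(3)])
  obtain s where s: "poly G s = 0"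
    using alg_closed_imp_poly_has_root[of G] G(2) by auto
  obtain c where c: "c \<noteq> 0" "form_equiv G (smult c split_form)"
    by (rule form_equiv_split[OF G(1,2) s])
  obtain x2 y2 where p2: "presented (e, K, L) (smult c split_form) x2 y2" by (rule presented_form_equiv[OF p1 G(1) c(2)])
  obtain l where l: "l ^ 3 = c" using nth_root_exists[of 3 c] by auto
  then have "l \<noteq> 0" using c(1) by auto
  then show ?thesis
    using presented_smult_cube[of e K L l split_form x2 y2] p2 l nondegenerate_split_form that by metis
qed

lemma presented_bi_twist:
  fixes M :: "('k::field, 'u::field) extn" and M0 :: "('k, 'v::field) extn"
  assumes p: "presented M F x y" and F: "nondegenerate F" and p0: "presented M0 split_form x0 y0"
  shows "bi_twist M M0"
proof -
  obtain e K L e0 K0 L0 where M: "M = (e, K, L)" "M0 = (e0, K0, L0)" by (metis prod_cases3)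
  obtain E K' L' where b: "base_change (e, K, L) (E, K', L')"
    and p': "presented (E, K', L') (ac_poly F) (to_ac x) (to_ac y)"
    using presented_base_change_exists p M by metis
  obtain E0 K0' L0' where b0: "base_change (e0, K0, L0) (E0, K0', L0')"
    and p0': "presented (E0, K0', L0') (ac_poly split_form) (to_ac x0) (to_ac y0)"
    using presented_base_change_exists p0 M by metis
  have g: "nondegenerate (ac_poly F)" "nondegenerate (ac_poly (split_form :: 'k poly))"
    using F nondegenerate_split_form nondegenerate_map_poly[OF hom_on_to_ac] by blast+
  obtain x1 y1 where p1: "presented (E, K', L') split_form x1 y1" by (rule alg_closed_presented_split[OF p' g(1)])
  obtain x2 y2 where p2: "presented (E0, K0', L0') split_form x2 y2" by (rule alg_closed_presented_split[OF p0' g(2)])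
  have "bi_isomorphic (E, K', L') (E0, K0', L0')"
    by (rule presented_bi_isomorphic[OF p1 p2 nondegenerate_split_form])
  then show ?thesis
    unfolding bi_twist_def M using b b0 presented_cubic_extension[OF _ F] p M by blast
qed

lemma presented_purely_cubic:
  assumes "presented M F x y" shows "purely_cubic M"
proof -
  obtain e K L where M: "M = (e, K, L)" by (metis prod_cases3)
  note D = presentedD[OF assms[unfolded M]]
  show ?thesis using D(4,11,12) unfolding M by auto
qed

section \<open>Galois extensions and cube roots of unity\<close>

lemma cube_root_of_unity_ne:
  fixes w :: "'a::field"
  assumes "w ^ 3 = 1" "w \<noteq> 1" shows "w ^ 2 \<noteq> 1" "w \<noteq> 0"
  using assms by (auto simp: power3_eq_cube power2_eq_square)

text \<open>If an automorphism over \<open>K\<close> moves \<open>y\<close>, then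
  \<open>\<sigma> y / y\<close> is a nontrivial cube root of unity in \<open>L\<close>; being
  algebraic over \<open>k\<close>, it lies in \<open>k\<close>. Conversely
  \<open>y \<mapsto> \<zeta> y\<close> defines an automorphism with fixed field
  \<open>K\<close>.\<close>

lemma presented_galois:
  fixes e :: "'k::field \<Rightarrow> 'u::field"
  assumes p: "presented (e, K, L) F x y" and F: "nondegenerate F"
  shows "is_galois (e, K, L) \<longleftrightarrow> (\<exists>\<zeta>::'k. \<zeta> ^ 3 = 1 \<and> \<zeta> \<noteq> 1)"
proof -
  note D = presentedD[OF p] and H = hom_onD[OF sfield_UNIV presentedD(1)[OF p]]
  define Fix where "Fix = {z \<in> L. \<forall>\<sigma>. hom_on L \<sigma> \<and> \<sigma> ` L = L \<longrightarrow> (\<forall>a\<in>K. \<sigma> a = a) \<longrightarrow> \<sigma> z = z}"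
  have gal: "is_galois (e, K, L) \<longleftrightarrow> Fix = K"
    unfolding Fix_def by (auto simp: ring_iso_sub_fld_iff[OF D(7)])
  have KF: "K \<subseteq> Fix" using D(8) unfolding Fix_def by auto
  have y0: "y \<noteq> 0" "y \<notin> K" using presented_not_in_base[OF p F] by auto
  show ?thesis
    unfolding gal
  proof
    assume "Fix = K"
    then have "y \<notin> Fix" using y0 by simp
    then obtain \<sigma> where \<sigma>: "hom_on L \<sigma>" "\<sigma> ` L = L" "\<forall>a\<in>K. \<sigma> a = a" "\<sigma> y \<noteq> y"
      unfolding Fix_def using D(11) by blast
    define w where "w = \<sigma> y / y"
    have "\<sigma> y ^ 3 = y ^ 3" using \<sigma>(3) D(12) hom_on_power[OF D(7) \<sigma>(1) D(11), of 3] by simp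
    then have w: "w ^ 3 = 1" "w \<noteq> 1" unfolding w_def using y0 \<sigma>(4) by (simp_all add: power_divide)
    have "\<sigma> y \<in> L" using \<sigma>(2) D(11) by blast
    then have "w \<in> L" unfolding w_def using D(11) sfield_divide[OF D(7)] by simp
    moreover have "ev e [:-1, 0, 0, 1:] w = 0"
      using w(1) by (simp add: ev_hom[OF D(1)] H power3_eq_cube mult.assoc)
    then have "\<not> transcendental_over e w"
      unfolding transcendental_over_def by (metis pCons_eq_0_iff one_neq_zero)
    ultimately obtain \<zeta> where z: "w = e \<zeta>" using presented_constants[OF p F] by blast
    have "\<zeta> ^ 3 = 1" "\<zeta> \<noteq> 1"
      using w unfolding z using H(11)[of "\<zeta> ^ 3" 1] by (auto simp: H)
    then show "\<exists>\<zeta>::'k. \<zeta> ^ 3 = 1 \<and> \<zeta> \<noteq> 1" by blast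
  next
    assume "\<exists>\<zeta>::'k. \<zeta> ^ 3 = 1 \<and> \<zeta> \<noteq> 1"
    then obtain \<zeta> :: 'k where z: "\<zeta> ^ 3 = 1" "\<zeta> \<noteq> 1" by blast
    define w where "w = e \<zeta>"
    have w: "w ^ 3 = 1" "w \<noteq> 1" unfolding w_def using z H(10)[of \<zeta> 3] H(11)[of \<zeta> 1] H(2) by auto
    have w0: "w \<noteq> 0" "w ^ 2 \<noteq> 1" using cube_root_of_unity_ne[OF w] by auto
    have wK: "w \<in> K" unfolding w_def using D(9) by auto
    have id: "hom_on K (\<lambda>a. a)" by (simp add: hom_on_def)
    have "poly (map_poly (\<lambda>a. a) [:- (y ^ 3), 0, 0, 1:]) (w * y) = w ^ 3 * y ^ 3 - y ^ 3"
      by (simp add: power3_eq_cube)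
    also have "\<dots> = 0" using w by simp
    finally obtain \<sigma> where \<sigma>: "hom_on (gen (insert y K)) \<sigma>" "\<And>a. a \<in> K \<Longrightarrow> \<sigma> a = a" "\<sigma> y = w * y"
      using hom_extend_simple[OF D(6) id cube_root_min_poly[OF D(6) presented_noncube[OF p F] D(12)]] by metis
    have hL: "hom_on L \<sigma>" using \<sigma>(1) D(4) by simp
    have "\<sigma> ` K = K" using \<sigma>(2) by force
    then have "\<sigma> ` L = gen (insert (w * y) K)"
      using hom_on_gen_image[OF \<sigma>(1)] \<sigma>(3) D(4) by simp
    also have "\<dots> = gen (insert y K)"
    proof (rule gen_insert_eq)
      show "w * y \<in> gen (insert y K)" by (intro sfield_mult[OF sfield_gen] gen_incl) (use wK in auto)
      have "w * y / w \<in> gen (insert (w * y) K)"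
        by (intro sfield_divide[OF sfield_gen] gen_incl) (use wK in auto)
      then show "y \<in> gen (insert (w * y) K)" using w0 by simp
    qed
    finally have \<sigma>L: "\<sigma> ` L = L" using D(4) by simp
    have "z \<in> K" if z: "z \<in> Fix" for z
    proof -
      have zL: "z \<in> L" and \<sigma>z: "\<sigma> z = z" using z hL \<sigma>L \<sigma>(2) by (auto simp: Fix_def)
      have "gen (insert y K) = {a + b * y + c * y ^ 2 |a b c. a \<in> K \<and> b \<in> K \<and> c \<in> K}"
        by (rule cube_root_gen[OF D(6) presented_noncube[OF p F] D(12)])
      then obtain a b c where abc: "a \<in> K" "b \<in> K" "c \<in> K" "z = a + b * y + c * y ^ 2"
        using zL D(4) by blast
      have mem: "a \<in> L" "b \<in> L" "c \<in> L" "y \<in> L" using abc D(8,11) by auto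
      note HL = hom_onD[OF D(7) hL] and SL = sfield_intros[OF D(7)] sfield_power[OF D(7)]
      have "\<sigma> z = a + b * (w * y) + c * (w * y) ^ 2"
        unfolding abc(4) using mem abc \<sigma> by (simp add: HL SL)
      \<comment> \<open>In \<open>\<sigma> z - z\<close> the coefficients are multiplied by
        \<open>w - 1\<close> and \<open>w ^ 2 - 1\<close>, both nonzero for a primitive cube root of
        unity.\<close>
      then have "0 + (b * (w - 1)) * y + (c * (w ^ 2 - 1)) * y ^ 2 = 0"
        using \<sigma>z abc(4) by (simp add: algebra_simps power_mult_distrib)
      moreover have "b * (w - 1) \<in> K" "c * (w ^ 2 - 1) \<in> K"
        using abc wK sfield_intros[OF D(6)] sfield_power[OF D(6)] by auto
      ultimately have "b * (w - 1) = 0 \<and> c * (w ^ 2 - 1) = 0"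
        using cube_root_independent[OF D(6) presented_noncube[OF p F] D(12) sfield_0[OF D(6)]] by blast
      then have "b = 0" "c = 0" using w w0 by auto
      then show "z \<in> K" using abc by simp
    qed
    then show "Fix = K" using KF by auto
  qed
qed

subsection \<open>Galois descent\<close>

text \<open>If the derivative also vanished at \<open>r\<close>, minimality would make it zero, so
  that only exponents divisible by the characteristic \<open>p\<close> occur. Over a perfect field
  \<open>f\<close> is then a \<open>p\<close>-th power \<open>g ^ p\<close>, and \<open>g\<close>
  has the root \<open>r\<close> and smaller degree.\<close>

lemma perfect_separable:
  fixes f :: "'k::field poly"
  assumes perf: "perfect_field TYPE('k)" and f: "f \<noteq> 0" "poly (ac_poly f) r = 0"
    and min: "\<And>g. g \<noteq> 0 \<Longrightarrow> poly (ac_poly g) r = 0 \<Longrightarrow> degree f \<le> degree g"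
  shows "poly (ac_poly (pderiv f)) r \<noteq> 0"
proof
  assume "poly (ac_poly (pderiv f)) r = 0"
  have df: "degree f > 0"
  proof (rule ccontr)
    assume "\<not> degree f > 0"
    then obtain c where "f = [:c:]" using degree_eq_zeroE by blast
    then show False using f by (simp add: map_poly_pCons)
  qed
  have "pderiv f = 0"
  proof (rule ccontr)
    assume "pderiv f \<noteq> 0"
    then have "degree f \<le> degree (pderiv f)" using min \<open>poly (ac_poly (pderiv f)) r = 0\<close> by blast
    moreover have "degree (pderiv f) \<le> degree f - 1"
      by (rule degree_le) (auto simp: coeff_pderiv coeff_eq_0)
    ultimately show False using df by simp
  qed
  have dv: "CHAR('k) dvd i" if "coeff f i \<noteq> 0" for i
  proof (cases i)
    case (Suc j)
    have "of_nat (Suc j) * coeff f (Suc j) = 0"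
      using \<open>pderiv f = 0\<close> coeff_pderiv[of f j] by simp
    then have "of_nat (Suc j) = (0::'k)" using that Suc by auto
    then show ?thesis using Suc of_nat_eq_0_iff_char_dvd by blast
  qed simp
  have lc: "coeff f (degree f) \<noteq> 0" using f(1) by simp
  then have "CHAR('k) \<noteq> 0" using dv[OF lc] df by auto
  then have pr: "prime CHAR('k)" by (intro prime_CHAR_semidom) simp
  have "surj (\<lambda>a::'k. a ^ CHAR('k))" using perf \<open>CHAR('k) \<noteq> 0\<close> by (simp add: perfect_field_def)
  then obtain rt where rt: "\<And>a::'k. rt a ^ CHAR('k) = a" by (metis surjD)
  define p where "p = CHAR('k)"
  have p0: "p > 0" using pr by (simp add: p_def prime_gt_0_nat)
  \<comment> \<open>Built from \<open>p\<close>-th roots of the surviving coefficients. The bound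
    \<open>degree f\<close> is generous: beyond \<open>degree f / p\<close> the terms are
    zero.\<close>
  define g where "g = (\<Sum>j\<le>degree f. monom (rt (coeff f (p * j))) j)"
  have "g ^ p = (\<Sum>j\<le>degree f. monom (rt (coeff f (p * j))) j ^ p)"
    unfolding g_def by (rule freshmans_dream_sum) (use pr in \<open>auto simp: p_def\<close>)
  also have "\<dots> = (\<Sum>j\<le>degree f. monom (coeff f (p * j)) (p * j))"
    by (intro sum.cong refl) (simp add: monom_power rt[folded p_def] mult.commute)
  also have "\<dots> = f"
  proof (rule poly_eqI)
    fix i
    have "coeff (\<Sum>j\<le>degree f. monom (coeff f (p * j)) (p * j)) i =
        (\<Sum>j\<le>degree f. if p * j = i then coeff f i else 0)"
      unfolding coeff_sum by (intro sum.cong refl) auto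
    also have "\<dots> = coeff f i"
    proof (cases "coeff f i = 0")
      case False
      then obtain j where j: "i = p * j" using dv by (auto simp: p_def)
      have "i \<le> degree f" using False by (rule le_degree)
      moreover have "j \<le> i" using j p0 by simp
      ultimately have "j \<le> degree f" by simp
      have "(\<Sum>j'\<le>degree f. if p * j' = i then coeff f i else 0) =
          (\<Sum>j'\<le>degree f. if j' = j then coeff f i else 0)"
        using p0 j by (intro sum.cong refl) auto
      then show ?thesis using \<open>j \<le> degree f\<close> by simp
    next
      case True
      then have "(\<lambda>j. if p * j = i then coeff f i else 0) = (\<lambda>_. 0)" by auto
      then show ?thesis using True by (simp only: sum.neutral_const)
    qed
    finally show "coeff (\<Sum>j\<le>degree f. monom (coeff f (p * j)) (p * j)) i = coeff f i" .
  qed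
  finally have gp: "g ^ p = f" .
  then have g0: "g \<noteq> 0" using f(1) p0 by auto
  have "poly (ac_poly g) r ^ p = 0" using f(2) unfolding gp[symmetric] by (simp add: map_poly_to_ac)
  then have "degree f \<le> degree g" using min[OF g0] by simp
  moreover have "degree f = p * degree g" using degree_power_eq[OF g0, of p] gp by simp
  moreover have "p \<ge> 2" using pr prime_ge_2_nat by (simp add: p_def)
  moreover from \<open>p \<ge> 2\<close> have "2 * degree g \<le> p * degree g" by (rule mult_le_mono1)
  ultimately show False using df by linarith
qed

lemma ac_minimal_exists:
  fixes r :: "'k::field alg_closure"
  obtains f :: "'k poly" where "f \<noteq> 0" "poly (ac_poly f) r = 0"
    "\<And>g. g \<noteq> 0 \<Longrightarrow> poly (ac_poly g) r = 0 \<Longrightarrow> degree f \<le> degree g"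
proof -
  obtain f0 :: "'k poly" where "f0 \<noteq> 0" "poly (ac_poly f0) r = 0" by (rule alg_closure_algebraic)
  then obtain f where "f \<noteq> 0 \<and> poly (ac_poly f) r = 0"
    "\<And>g. g \<noteq> 0 \<and> poly (ac_poly g) r = 0 \<Longrightarrow> degree f \<le> degree g"
    using ex_has_least_nat[of "\<lambda>f. f \<noteq> 0 \<and> poly (ac_poly f) r = 0" f0 degree] by blast
  then show ?thesis using that by blast
qed

lemma ac_poly_pderiv: "ac_poly (pderiv f) = pderiv (ac_poly f)"
  by (rule poly_eqI) (simp add: map_poly_to_ac coeff_pderiv)

section \<open>The compositum with the constants as a vector space\<close>

definition lincomb :: "('c::field \<Rightarrow> 'w::field) \<Rightarrow> 'w set \<Rightarrow> ('w \<Rightarrow> 'c) \<Rightarrow> 'w" where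
  "lincomb E B c = (\<Sum>l\<in>B. E (c l) * l)"

definition lspan :: "('c::field \<Rightarrow> 'w::field) \<Rightarrow> 'w set \<Rightarrow> 'w set" where
  "lspan E S = {lincomb E B c |B c. finite B \<and> B \<subseteq> S}"

lemma lspan_intros:
  assumes E: "hom_on UNIV E"
  shows lspan_add: "\<And>a b. a \<in> lspan E S \<Longrightarrow> b \<in> lspan E S \<Longrightarrow> a + b \<in> lspan E S"
    and lspan_single: "\<And>r l. l \<in> S \<Longrightarrow> E r * l \<in> lspan E S"
    and lspan_0: "0 \<in> lspan E S"
    and lspan_sum: "\<And>A f. (\<And>i::'i. i \<in> A \<Longrightarrow> f i \<in> lspan E S) \<Longrightarrow> sum f A \<in> lspan E S"
proof -
  note H = hom_onD[OF sfield_UNIV E]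
  show add: "a + b \<in> lspan E S" if "a \<in> lspan E S" "b \<in> lspan E S" for a b
  proof -
    from that obtain A B c d where a: "finite A" "A \<subseteq> S" "a = lincomb E A c"
      and b: "finite B" "B \<subseteq> S" "b = lincomb E B d" by (auto simp: lspan_def)
    define f where "f l = (if l \<in> A then c l else 0) + (if l \<in> B then d l else 0)" for l
    have "a = (\<Sum>l\<in>A \<union> B. E (if l \<in> A then c l else 0) * l)"
      unfolding a(3) lincomb_def by (rule sum.mono_neutral_cong_left) (use a b H in auto)
    moreover have "b = (\<Sum>l\<in>A \<union> B. E (if l \<in> B then d l else 0) * l)"
      unfolding b(3) lincomb_def by (rule sum.mono_neutral_cong_left) (use a b H in auto)
    ultimately have "a + b = lincomb E (A \<union> B) f"
      unfolding lincomb_def f_def by (simp add: H distrib_right sum.distrib)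
    then show ?thesis unfolding lspan_def using a b by blast
  qed
  show "E r * l \<in> lspan E S" if "l \<in> S" for r l
    unfolding lspan_def lincomb_def using that by (intro CollectI exI[of _ "{l}"] exI[of _ "\<lambda>_. r"]) auto
  show z: "0 \<in> lspan E S" unfolding lspan_def lincomb_def by (intro CollectI exI[of _ "{}"]) auto
  show "sum f A \<in> lspan E S" if "\<And>i::'i. i \<in> A \<Longrightarrow> f i \<in> lspan E S" for A f
    using that by (induction A rule: infinite_finite_induct) (auto intro: z add)
qed

text \<open>Only inverses are not obvious. An element involves finitely many constants, each
  algebraic over \<open>S\<close>; the field they generate over \<open>S\<close> consists of
  polynomial expressions in them and hence lies in the span.\<close>

lemma gen_Un_eq_lspan:
  fixes E :: "'c::field \<Rightarrow> 'w::field"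
  assumes E: "hom_on UNIV E" and S: "sfield S" and alg: "\<And>r. alg_over S (E r)"
  shows "gen (S \<union> range E) = lspan E S"
proof -
  note H = hom_onD[OF sfield_UNIV E] and T = lspan_intros[OF E, where S = S]
  have mult: "a * b \<in> lspan E S" if "a \<in> lspan E S" "b \<in> lspan E S" for a b
  proof -
    from that obtain A B c d where a: "finite A" "A \<subseteq> S" "a = lincomb E A c"
      and b: "finite B" "B \<subseteq> S" "b = lincomb E B d" by (auto simp: lspan_def)
    have "a * b = (\<Sum>l\<in>A. \<Sum>m\<in>B. E (c l) * l * (E (d m) * m))"
      unfolding a(3) b(3) lincomb_def sum_product ..
    also have "\<dots> = (\<Sum>l\<in>A. \<Sum>m\<in>B. E (c l * d m) * (l * m))" by (simp add: H ac_simps)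
    also have "\<dots> \<in> lspan E S"
      by (intro lspan_sum[OF E] lspan_single[OF E] sfield_mult[OF S]) (use a b in auto)
    finally show ?thesis .
  qed
  have SS: "S \<subseteq> lspan E S" using T(2)[of _ 1] by (auto simp: H)
  have ES: "E r \<in> lspan E S" for r using T(2)[OF sfield_1[OF S], of r] by simp
  have pw: "E r ^ i \<in> lspan E S" for r i using ES[of "r ^ i"] by (simp add: H)
  have fin: "gen (S \<union> E ` C) \<subseteq> lspan E S" if "finite C" for C
    using that
  proof (induction C)
    case empty
    then show ?case using gen_least[OF S order_refl] SS by auto
  next
    case (insert r C)
    let ?F = "gen (S \<union> E ` C)"
    have "S \<subseteq> ?F" by (auto intro: gen_incl)
    then have alg': "alg_over ?F (E r)" using alg alg_over_mono by blast
    have "gen (S \<union> E ` insert r C) = gen (insert (E r) ?F)"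
      by (simp add: gen_insert_gen)
    also have "\<dots> = {poly q (E r) |q. q \<in> polyF ?F}" by (rule simple_alg_extension[OF sfield_gen alg'])
    also have "\<dots> \<subseteq> lspan E S"
    proof clarify
      fix q assume "q \<in> polyF ?F"
      then have "coeff q i \<in> lspan E S" for i using polyFD insert.IH by blast
      then show "poly q (E r) \<in> lspan E S"
        unfolding poly_altdef by (intro lspan_sum[OF E] mult pw)
    qed
    finally show ?case .
  qed
  have "sfield (lspan E S)"
    unfolding sfield_def
  proof (intro conjI ballI)
    show "1 \<in> lspan E S" using SS sfield_1[OF S] by auto
    fix a assume a: "a \<in> lspan E S"
    then obtain A c where A: "finite A" "A \<subseteq> S" "a = lincomb E A c" by (auto simp: lspan_def)
    let ?G = "gen (S \<union> E ` (c ` A))"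
    have "a \<in> ?G"
      unfolding A(3) lincomb_def
      by (intro sfield_sum[OF sfield_gen] sfield_mult[OF sfield_gen] gen_incl) (use A in auto)
    then have "inverse a \<in> ?G" by (rule sfield_inverse[OF sfield_gen])
    then show "inverse a \<in> lspan E S" using fin[of "c ` A"] A(1) by blast
    fix b assume b: "b \<in> lspan E S"
    show "a * b \<in> lspan E S" by (rule mult[OF a b])
    have "E (- 1) * b \<in> lspan E S" by (rule mult[OF ES b])
    from T(1)[OF a this] show "a - b \<in> lspan E S" by (simp add: H)
  qed
  then have "gen (S \<union> range E) \<subseteq> lspan E S" by (rule gen_least) (use SS ES in auto)
  moreover have "lspan E S \<subseteq> gen (S \<union> range E)"
    unfolding lspan_def lincomb_def
    by (auto intro!: sfield_sum[OF sfield_gen] sfield_mult[OF sfield_gen] intro: gen_incl)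
  ultimately show ?thesis by blast
qed

text \<open>\<open>L\<close> has full constant field \<open>k\<close>, and \<open>E\<close> embeds
  the closure of \<open>k\<close> next to it. The extension \<open>LL / L\<close> then mirrors the
  closure of \<open>k\<close> over \<open>k\<close>, so descent can use embeddings of
  \<open>LL\<close> that fix \<open>L\<close>.\<close>

locale descent =
  fixes e :: "'k::field \<Rightarrow> 'u::field" and E :: "'k alg_closure \<Rightarrow> 'u alg_closure" and L :: "'u set"
  assumes perfect: "perfect_field TYPE('k)" and lift: "ac_lift e E"
    and L: "sfield L" "range e \<subseteq> L"
    and const: "\<And>z. z \<in> L \<Longrightarrow> \<not> transcendental_over e z \<Longrightarrow> z \<in> range e"
begin

lemma E: "hom_on UNIV E" and e: "hom_on UNIV e" and E_to_ac: "E (to_ac a) = to_ac (e a)"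
  using lift by (auto simp: ac_lift_def)

lemmas EH = hom_onD[OF sfield_UNIV E] and eH = hom_onD[OF sfield_UNIV e]

definition LL :: "'u alg_closure set" where "LL = gen (to_ac ` L \<union> range E)"

text \<open>Embeddings into the ambient closure; that they map the constants and \<open>LL\<close>
  onto themselves is proved later, and a group structure never enters.\<close>

definition Gal :: "('u alg_closure \<Rightarrow> 'u alg_closure) set" where
  "Gal = {\<sigma>. hom_on LL \<sigma> \<and> (\<forall>z\<in>L. \<sigma> (to_ac z) = to_ac z)}"

lemma sfield_LL: "sfield LL" by (simp add: LL_def)

lemma LL_incl: "z \<in> L \<Longrightarrow> to_ac z \<in> LL" "E r \<in> LL"
  by (auto simp: LL_def intro: gen_incl)

lemma ev_E_mem: "ev E (ac_poly f) (E r) = E (poly (ac_poly f) r)"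
  using ev_const[OF E] .

lemma map_E_ac: "map_poly E (ac_poly f) = map_poly to_ac (map_poly e f)"
  by (rule poly_eqI)
    (simp add: coeff_map_poly_hom[OF sfield_UNIV E] coeff_map_poly_hom[OF sfield_UNIV hom_on_to_ac]
      coeff_map_poly_hom[OF sfield_UNIV e] map_poly_to_ac E_to_ac)

lemma map_E_ac_mem:
  assumes "range e \<subseteq> S"
  shows "map_poly E (ac_poly f) \<in> polyF (to_ac ` S)"
  using assms by (auto simp: polyF_def map_E_ac map_poly_to_ac coeff_map_poly_hom[OF sfield_UNIV e])

lemma alg_over_E:
  assumes "range e \<subseteq> S"
  shows "alg_over (to_ac ` S) (E r)"
proof -
  obtain f where f: "f \<noteq> 0" "poly (ac_poly f) r = 0" by (rule alg_closure_algebraic)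
  have "map_poly E (ac_poly f) \<noteq> 0"
    using f(1) map_poly_hom_eq_0[OF sfield_UNIV E] by (simp add: map_poly_to_ac)
  moreover have "ev E (ac_poly f) (E r) = 0" using ev_E_mem f(2) EH(1) by simp
  ultimately show ?thesis unfolding alg_over_def using map_E_ac_mem[OF assms] by blast
qed

lemma sfield_to_ac: "sfield S \<Longrightarrow> sfield (to_ac ` S)"
  by (rule hom_on_image) auto

lemma gen_lspan:
  assumes "sfield S" "range e \<subseteq> S"
  shows "gen (to_ac ` S \<union> range E) = lspan E (to_ac ` S)"
  by (rule gen_Un_eq_lspan[OF E sfield_to_ac[OF assms(1)] alg_over_E[OF assms(2)]])

text \<open>The minimal polynomial of \<open>E r\<close> over \<open>L\<close> has degree above one,
  since otherwise \<open>r\<close> would come from a constant of \<open>L\<close> and lie in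
  \<open>k\<close>. It divides the separable minimal polynomial over \<open>k\<close>, so it has a
  second root; sending \<open>E r\<close> there extends to \<open>LL\<close> by
  algebraicity.\<close>

lemma Gal_moves:
  assumes r: "r \<notin> range to_ac"
  obtains \<sigma> where "\<sigma> \<in> Gal" "\<sigma> (E r) \<noteq> E r"
proof -
  let ?L = "to_ac ` L" and ?c = "E r"
  have SL: "sfield ?L" by (rule sfield_to_ac[OF L(1)])
  obtain f where f: "f \<noteq> 0" "poly (ac_poly f) r = 0"
    "\<And>g. g \<noteq> 0 \<Longrightarrow> poly (ac_poly g) r = 0 \<Longrightarrow> degree f \<le> degree g"
    by (rule ac_minimal_exists[of r]) blast
  define m where "m = map_poly E (ac_poly f)"
  have mL: "m \<in> polyF ?L" unfolding m_def by (rule map_E_ac_mem[OF L(2)])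
  have mc: "poly m ?c = 0" unfolding m_def using ev_E_mem f(2) EH(1) by simp
  have "map_poly E (ac_poly (pderiv f)) = pderiv m"
    unfolding m_def ac_poly_pderiv
    by (rule poly_eqI)
      (simp add: coeff_pderiv coeff_map_poly_hom[OF sfield_UNIV E] EH hom_of_nat[OF E])
  then have md: "poly (pderiv m) ?c \<noteq> 0"
    using ev_E_mem[of "pderiv f" r] perfect_separable[OF perfect f] EH(7) by auto
  obtain p where p: "min_poly_over ?L ?c p"
    by (rule min_poly_over_exists[OF SL alg_over_E[OF L(2)]])
  have pL: "p \<in> polyF ?L" "lead_coeff p = 1" "poly p ?c = 0" using p by (auto simp: min_poly_over_def)
  obtain s where s: "m = s * p" using min_poly_over_dvd[OF SL p mL mc] by metis
  have "degree p \<noteq> 1"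
  proof
    assume d: "degree p = 1"
    then have "p = [:coeff p 0, 1:]" using pL(2)
      by (intro poly_eqI) (auto simp: coeff_pCons coeff_eq_0 split: nat.split)
    then have "poly [:coeff p 0, 1:] ?c = 0" using pL(3) by simp
    then have "?c = - coeff p 0" by (simp add: eq_neg_iff_add_eq_0 add.commute)
    then have "?c \<in> ?L" using sfield_minus[OF SL polyFD[OF pL(1)]] by simp
    then obtain z where z: "z \<in> L" "?c = to_ac z" by auto
    have "to_ac (ev e f z) = 0" using ac_lift_ev[OF lift, of f z] ev_E_mem f(2) EH(1) z(2) by metis
    then have "\<not> transcendental_over e z" using f(1) by (auto simp: transcendental_over_def)
    then obtain t where "z = e t" using const z(1) by auto
    then have "E r = E (to_ac t)" using z(2) E_to_ac by simp
    then have "r = to_ac t" using EH(11) by simp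
    then show False using r by simp
  qed
  then have dp: "degree p > 1" using min_poly_over_degree_pos[OF p] by simp
  have "[:-?c, 1:] dvd p" using pL(3) poly_eq_0_iff_dvd by blast
  then obtain p2 where p2: "p = [:-?c, 1:] * p2" by (rule dvdE)
  have "p2 \<noteq> 0" using p2 dp by auto
  then have "degree p = Suc (degree p2)" unfolding p2 by (subst degree_mult_eq) auto
  then obtain c' where c': "poly p2 c' = 0" using alg_closed_imp_poly_has_root[of p2] dp by auto
  have "c' \<noteq> ?c"
  proof
    assume eq: "c' = ?c"
    have "pderiv m = pderiv s * p + s * (pderiv [:-?c, 1:] * p2 + [:-?c, 1:] * pderiv p2)"
      unfolding s p2 pderiv_mult by (simp add: algebra_simps)
    then have "poly (pderiv m) ?c = 0" using pL(3) c' eq by simp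
    then show False using md by simp
  qed
  have "poly (map_poly (\<lambda>a. a) p) c' = 0" using p2 c' by simp
  moreover have id: "hom_on ?L (\<lambda>a. a)" by (simp add: hom_on_def)
  ultimately obtain \<sigma>0 where s0: "hom_on (gen (insert ?c ?L)) \<sigma>0" "\<And>a. a \<in> ?L \<Longrightarrow> \<sigma>0 a = a" "\<sigma>0 ?c = c'"
    using hom_extend_simple[OF SL id p] by metis
  have sub: "?L \<subseteq> gen (insert ?c ?L)" by (auto intro: gen_incl)
  have "alg_over (gen (insert ?c ?L)) z" if "z \<in> range E" for z
    using that alg_over_mono[OF alg_over_E[OF L(2)] sub] by auto
  then obtain \<sigma> where \<sigma>: "hom_on (gen (gen (insert ?c ?L) \<union> range E)) \<sigma>"
    "\<And>a. a \<in> gen (insert ?c ?L) \<Longrightarrow> \<sigma> a = \<sigma>0 a"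
    using hom_extend_algebraic[OF sfield_gen s0(1)] by metis
  have "gen (gen (insert ?c ?L) \<union> range E) = LL"
    unfolding LL_def gen_gen_Un by (simp add: insert_absorb)
  then have "\<sigma> \<in> Gal"
    unfolding Gal_def using \<sigma> s0(2) sub by auto
  moreover have "\<sigma> ?c = c'" using \<sigma>(2)[of ?c] s0(3) gen_incl[of ?c "insert ?c ?L"] by simp
  ultimately show ?thesis using that \<open>c' \<noteq> ?c\<close> by simp
qed

lemma Gal_hom: "\<sigma> \<in> Gal \<Longrightarrow> hom_on LL \<sigma>" "\<sigma> \<in> Gal \<Longrightarrow> z \<in> L \<Longrightarrow> \<sigma> (to_ac z) = to_ac z"
  by (auto simp: Gal_def)

lemma Gal_ev:
  assumes \<sigma>: "\<sigma> \<in> Gal" and z: "z \<in> LL"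
  shows "\<sigma> (ev E (ac_poly f) z) = ev E (ac_poly f) (\<sigma> z)"
proof -
  have m: "map_poly E (ac_poly f) \<in> polyF (to_ac ` L)" by (rule map_E_ac_mem[OF L(2)])
  have "map_poly E (ac_poly f) \<in> polyF LL"
    using m polyF_mono[of "to_ac ` L" LL] LL_incl by blast
  then have "\<sigma> (ev E (ac_poly f) z) = poly (map_poly \<sigma> (map_poly E (ac_poly f))) (\<sigma> z)"
    by (rule hom_on_poly[OF sfield_LL Gal_hom(1)[OF \<sigma>] _ z])
  also have "map_poly \<sigma> (map_poly E (ac_poly f)) = map_poly E (ac_poly f)"
  proof (rule poly_eqI)
    fix i
    obtain u where "u \<in> L" "coeff (map_poly E (ac_poly f)) i = to_ac u" using polyFD[OF m, of i] by auto
    then show "coeff (map_poly \<sigma> (map_poly E (ac_poly f))) i = coeff (map_poly E (ac_poly f)) i"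
      using Gal_hom(2)[OF \<sigma>] by (simp add: coeff_map_poly_hom[OF sfield_LL Gal_hom(1)[OF \<sigma>]])
  qed
  finally show ?thesis .
qed

lemma Gal_root:
  assumes \<sigma>: "\<sigma> \<in> Gal" and f: "f \<noteq> 0" "poly (ac_poly f) r = 0"
  obtains s where "poly (ac_poly f) s = 0" "\<sigma> (E r) = E s"
proof -
  have "ev E (ac_poly f) (\<sigma> (E r)) = 0"
    using Gal_ev[OF \<sigma> LL_incl(2), of f r] ev_E_mem f(2) EH(1)
      hom_on_0[OF sfield_LL Gal_hom(1)[OF \<sigma>]] by simp
  then obtain s where s: "\<sigma> (E r) = E s"
    using alg_closed_root_in_range[OF E, of "ac_poly f"] f(1) by (auto simp: map_poly_to_ac)
  then have "E (poly (ac_poly f) s) = 0" using \<open>ev E (ac_poly f) (\<sigma> (E r)) = 0\<close> ev_E_mem by simp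
  then show ?thesis using that s EH(7) by simp
qed

lemma Gal_range_E:
  assumes \<sigma>: "\<sigma> \<in> Gal" shows "\<sigma> ` range E = range E"
proof
  show "\<sigma> ` range E \<subseteq> range E"
  proof clarify
    fix r :: "'k alg_closure"
    obtain f where "f \<noteq> 0" "poly (ac_poly f) r = 0" by (rule alg_closure_algebraic)
    then show "\<sigma> (E r) \<in> range E" using Gal_root[OF \<sigma>] by (metis rangeI)
  qed
  show "range E \<subseteq> \<sigma> ` range E"
  proof clarify
    fix r :: "'k alg_closure"
    obtain f where f: "f \<noteq> 0" "poly (ac_poly f) r = 0" by (rule alg_closure_algebraic)
    \<comment> \<open>\<open>\<sigma>\<close> is injective and maps the finite set of roots of
      \<open>f\<close> into itself, hence permutes it; this gives surjectivity on the
      constants.\<close>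
    let ?R = "E ` {s. poly (ac_poly f) s = 0}"
    have fin: "finite ?R" using poly_roots_finite[of "ac_poly f"] f(1) by (simp add: map_poly_to_ac)
    have "\<sigma> ` ?R \<subseteq> ?R" using Gal_root[OF \<sigma> f(1)] by (auto simp: image_iff)
    moreover have "inj_on \<sigma> ?R"
      using hom_on_inj[OF sfield_LL Gal_hom(1)[OF \<sigma>]] LL_incl(2) by (auto simp: inj_on_def)
    ultimately have "\<sigma> ` ?R = ?R" using fin by (metis endo_inj_surj)
    then show "E r \<in> \<sigma> ` range E" using f(2) by (metis (mono_tags, lifting) image_eqI image_mono mem_Collect_eq subsetD subset_UNIV)
  qed
qed

text \<open>The induced action on the closure of \<open>k\<close>, read through the injective
  \<open>E\<close>.\<close>

definition sact :: "('u alg_closure \<Rightarrow> 'u alg_closure) \<Rightarrow> 'k alg_closure \<Rightarrow> 'k alg_closure" where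
  "sact \<sigma> r = (SOME s. \<sigma> (E r) = E s)"

lemma sact: "\<sigma> \<in> Gal \<Longrightarrow> \<sigma> (E r) = E (sact \<sigma> r)"
  unfolding sact_def using Gal_range_E[of \<sigma>] by (intro someI_ex[of "\<lambda>s. \<sigma> (E r) = E s"]) blast

lemma sact_1: "\<sigma> \<in> Gal \<Longrightarrow> sact \<sigma> 1 = 1"
  using sact[of \<sigma> 1] hom_on_1[OF sfield_LL Gal_hom(1)[of \<sigma>]] EH(2) EH(11)[of "sact \<sigma> 1" 1] by simp

lemma Gal_lincomb:
  assumes \<sigma>: "\<sigma> \<in> Gal" and B: "B \<subseteq> to_ac ` L"
  shows "\<sigma> (lincomb E B c) = lincomb E B (\<lambda>l. sact \<sigma> (c l))"
proof -
  note H = hom_onD[OF sfield_LL Gal_hom(1)[OF \<sigma>]]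
  have mem: "l \<in> LL" if "l \<in> B" for l using that B LL_incl(1) by auto
  have "\<sigma> (lincomb E B c) = (\<Sum>l\<in>B. \<sigma> (E (c l) * l))"
    unfolding lincomb_def
    by (rule hom_on_sum[OF sfield_LL Gal_hom(1)[OF \<sigma>]]) (rule sfield_mult[OF sfield_LL LL_incl(2) mem])
  also have "\<dots> = (\<Sum>l\<in>B. E (sact \<sigma> (c l)) * l)"
  proof (rule sum.cong[OF refl])
    fix l assume l: "l \<in> B"
    then have "\<sigma> l = l" using B Gal_hom(2)[OF \<sigma>] by auto
    then show "\<sigma> (E (c l) * l) = E (sact \<sigma> (c l)) * l"
      using H(4)[OF LL_incl(2) mem[OF l]] sact[OF \<sigma>] by simp
  qed
  finally show ?thesis by (simp add: lincomb_def)
qed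

lemma lincomb_diff: "lincomb E B c - lincomb E B d = lincomb E B (\<lambda>l. c l - d l)"
  by (simp add: lincomb_def EH left_diff_distrib sum_subtractf)

lemma lincomb_scale: "E a * lincomb E B c = lincomb E B (\<lambda>l. a * c l)"
  by (simp add: lincomb_def EH sum_distrib_left mult.assoc)

lemma lincomb_remove:
  assumes "finite B" "j \<in> B" "c j = 0"
  shows "lincomb E B c = lincomb E (B - {j}) c"
  unfolding lincomb_def using assms by (simp add: sum.remove[of B j] EH)

text \<open>Artin's argument: take a coefficient outside \<open>k\<close> and an automorphism that
  moves it. As \<open>z\<close> is fixed, the differences of conjugate coefficients form a relation
  that is nonzero at this term and can be used to remove it. \<open>S\<close> may be any field
  between \<open>k\<close> and \<open>L\<close>; this freedom later identifies the descended
  fields.\<close>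

lemma Gal_fixed:
  assumes S: "sfield S" "range e \<subseteq> S" "S \<subseteq> L" and z: "z \<in> gen (to_ac ` S \<union> range E)"
    and fixed: "\<And>\<sigma>. \<sigma> \<in> Gal \<Longrightarrow> \<sigma> z = z"
  shows "z \<in> to_ac ` S"
proof -
  have main: "z \<in> to_ac ` S" if "finite B" "B \<subseteq> to_ac ` S" "z = lincomb E B c" for B c
    using that
  proof (induction "card B" arbitrary: B c rule: less_induct)
    case less
    note SS = sfield_to_ac[OF S(1)]
    show ?case
    proof (cases "\<forall>l\<in>B. c l \<in> range to_ac")
      case True
      have "E (c l) \<in> to_ac ` S" if "l \<in> B" for l using that True S(2) E_to_ac by force
      then show ?thesis unfolding less.prems(3) lincomb_def
        using less.prems(2) by (intro sfield_sum[OF SS] sfield_mult[OF SS]) auto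
    next
      case False
      then obtain j where j: "j \<in> B" "c j \<notin> range to_ac" by blast
      obtain \<sigma> where \<sigma>: "\<sigma> \<in> Gal" "\<sigma> (E (c j)) \<noteq> E (c j)" by (rule Gal_moves[OF j(2)])
      have BL: "B \<subseteq> to_ac ` L" using less.prems(2) S(3) by auto
      define d where "d l = sact \<sigma> (c l) - c l" for l
      have "lincomb E B d = 0"
        using Gal_lincomb[OF \<sigma>(1) BL, of c] fixed[OF \<sigma>(1)] less.prems(3)
          lincomb_diff[of B "\<lambda>l. sact \<sigma> (c l)" c] unfolding d_def by simp
      then have "z = lincomb E B c - E (c j / d j) * lincomb E B d" using less.prems(3) by simp
      also have "\<dots> = lincomb E B (\<lambda>l. c l - c j / d j * d l)" by (simp only: lincomb_scale lincomb_diff)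
      also have "\<dots> = lincomb E (B - {j}) (\<lambda>l. c l - c j / d j * d l)"
      proof (rule lincomb_remove[OF less.prems(1) j(1)])
        have "d j \<noteq> 0" using sact[OF \<sigma>(1), of "c j"] \<sigma>(2) by (auto simp: d_def)
        then show "c j - c j / d j * d j = 0" by simp
      qed
      finally have "z = lincomb E (B - {j}) (\<lambda>l. c l - c j / d j * d l)" .
      then show ?thesis
        using less.hyps[of "B - {j}"] less.prems(1,2) j(1) card_Diff1_less[OF less.prems(1) j(1)] by blast
    qed
  qed
  show ?thesis using z main unfolding gen_lspan[OF S(1,2)] lspan_def by blast
qed

text \<open>A Galois-stable subspace that is not contained in a line has a Galois-fixed vector outside it:
  among the vectors outside take one with as few terms as possible.\<close>

lemma stable_subspace_fixed_vector:
  assumes U: "U \<subseteq> LL" "\<And>a b. a \<in> U \<Longrightarrow> b \<in> U \<Longrightarrow> a - b \<in> U" "\<And>r a. a \<in> U \<Longrightarrow> E r * a \<in> U"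
    and stable: "\<And>\<sigma> u. \<sigma> \<in> Gal \<Longrightarrow> u \<in> U \<Longrightarrow> \<sigma> u \<in> U"
    and v: "v \<in> U" and ex: "u0 \<in> U" "\<And>r. u0 \<noteq> E r * v"
  obtains z where "z \<in> U" "z \<in> to_ac ` L" "\<And>r. z \<noteq> E r * v"
proof -
  define Q where "Q n \<longleftrightarrow> (\<exists>B c. finite B \<and> B \<subseteq> to_ac ` L \<and> card B = n \<and> lincomb E B c \<in> U \<and>
      (\<forall>r. lincomb E B c \<noteq> E r * v))" for n
  have "u0 \<in> lspan E (to_ac ` L)" using ex(1) U(1) gen_lspan[OF L] by (auto simp: LL_def)
  then have "\<exists>n. Q n" unfolding Q_def lspan_def using ex by blast
  then obtain n where n: "Q n" "\<And>m. m < n \<Longrightarrow> \<not> Q m" using exists_least_iff[of Q] by blast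
  then obtain B c where B: "finite B" "B \<subseteq> to_ac ` L" "card B = n" "lincomb E B c \<in> U"
    "\<And>r. lincomb E B c \<noteq> E r * v" unfolding Q_def by blast
  have small: "\<exists>r. lincomb E (B - {j}) d = E r * v" if "j \<in> B" "lincomb E (B - {j}) d \<in> U" for j d
  proof (rule ccontr)
    assume "\<not> ?thesis"
    then have "Q (card (B - {j}))" unfolding Q_def using B that by blast
    moreover have "card (B - {j}) < n" using card_Diff1_less[OF B(1) that(1)] B(3) by simp
    ultimately show False using n(2) by blast
  qed
  have "B \<noteq> {}"
  proof
    assume "B = {}"
    then have "lincomb E B c = E 0 * v" by (simp add: lincomb_def EH)
    then show False using B(5) by blast
  qed
  then obtain j where j: "j \<in> B" by blast
  have cj: "c j \<noteq> 0"
  proof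
    assume "c j = 0"
    then have "lincomb E B c = lincomb E (B - {j}) c" by (rule lincomb_remove[OF B(1) j])
    then show False using small[OF j, of c] B(4,5) by auto
  qed
  \<comment> \<open>With coefficient 1 at \<open>j\<close> this term cancels in
    \<open>\<sigma> z - z\<close>, which therefore has fewer terms and must be a multiple of
    \<open>v\<close>.\<close>
  define c1 where "c1 l = c l / c j" for l
  define z where "z = lincomb E B c1"
  have zs: "z = E (inverse (c j)) * lincomb E B c"
    unfolding z_def c1_def lincomb_scale by (simp add: divide_inverse mult.commute)
  have zU: "z \<in> U" unfolding zs by (rule U(3)[OF B(4)])
  have znv: "z \<noteq> E r * v" for r
  proof
    assume "z = E r * v"
    then have "E (c j) * z = E (c j) * (E r * v)" by simp
    moreover have "E (c j) * z = lincomb E B c" unfolding zs using cj by (simp add: EH)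
    ultimately have "lincomb E B c = E (c j * r) * v" by (simp add: EH)
    then show False using B(5) by blast
  qed
  have fixed: "\<sigma> z = z" if \<sigma>: "\<sigma> \<in> Gal" for \<sigma>
  proof (rule ccontr)
    assume ne: "\<sigma> z \<noteq> z"
    define d where "d l = sact \<sigma> (c1 l) - c1 l" for l
    have dz: "\<sigma> z - z = lincomb E B d"
      unfolding z_def d_def Gal_lincomb[OF \<sigma> B(2)] lincomb_diff ..
    have "d j = 0" using cj sact_1[OF \<sigma>] by (simp add: d_def c1_def)
    then have dz': "\<sigma> z - z = lincomb E (B - {j}) d" using dz lincomb_remove[OF B(1) j] by simp
    have "\<sigma> z - z \<in> U" by (rule U(2)[OF stable[OF \<sigma> zU] zU])
    then obtain r where r: "\<sigma> z - z = E r * v" using small[OF j] dz' by metis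
    then have r0: "r \<noteq> 0" using ne EH(1) by auto
    have "v = E (inverse r) * lincomb E (B - {j}) d"
      using r r0 unfolding dz'[symmetric] by (simp add: EH)
    then have vl: "v = lincomb E (B - {j}) (\<lambda>l. inverse r * d l)" by (simp add: lincomb_scale)
    have "\<exists>i\<in>B - {j}. d i \<noteq> 0"
    proof (rule ccontr)
      assume "\<not> ?thesis"
      then have "\<sigma> z - z = 0" unfolding dz' lincomb_def by (simp add: EH)
      then show False using ne by simp
    qed
    then obtain i where i: "i \<in> B" "i \<noteq> j" "d i \<noteq> 0" by blast
    have vB: "v = lincomb E B (\<lambda>l. inverse r * d l)"
      using vl lincomb_remove[OF B(1) j, of "\<lambda>l. inverse r * d l"] \<open>d j = 0\<close> by simp
    \<comment> \<open>If \<open>\<sigma>\<close> moves \<open>z\<close>, then \<open>v\<close> is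
      supported in \<open>B\<close> without \<open>j\<close>, and subtracting a multiple of
      \<open>v\<close> from \<open>z\<close> kills the term \<open>i\<close> instead. The result is
      too short to lie off the line of \<open>v\<close>, so \<open>z\<close> would lie on that
      line.\<close>
    define q where "q = c1 i / (inverse r * d i)"
    have "z - E q * v = lincomb E B (\<lambda>l. c1 l - q * (inverse r * d l))"
      unfolding z_def by (subst vB) (simp only: lincomb_scale lincomb_diff)
    also have "\<dots> = lincomb E (B - {i}) (\<lambda>l. c1 l - q * (inverse r * d l))"
      by (rule lincomb_remove[OF B(1) i(1)]) (use i(3) r0 in \<open>simp add: q_def\<close>)
    finally have zq: "z - E q * v = lincomb E (B - {i}) (\<lambda>l. c1 l - q * (inverse r * d l))" .
    have "z - E q * v \<in> U" by (rule U(2)[OF zU U(3)[OF v]])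
    then obtain r' where "z - E q * v = E r' * v" using small[OF i(1)] zq by metis
    then have "z = E (r' + q) * v" by (simp add: EH algebra_simps)
    then show False using znv by blast
  qed
  have "z \<in> to_ac ` L"
    by (rule Gal_fixed[OF L order_refl]) (use zU U(1) fixed in \<open>auto simp: LL_def\<close>)
  then show ?thesis using that zU znv by blast
qed

end

section \<open>The Galois-stable plane of a split presentation\<close>

lemma ev_split_form: "hom_on UNIV e \<Longrightarrow> ev e split_form x = x * (x - 1)"
  by (simp add: ev_hom hom_onD[OF sfield_UNIV] del: mult_pCons_left mult_pCons_right)

lemma ac_poly_split_form: "ac_poly (split_form :: 'k::field poly) = split_form"
  by (simp add: map_poly_to_ac map_poly_pCons del: mult_pCons_left mult_pCons_right)

context descent
begin

context
  fixes K :: "'u set" and KK t w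
  assumes char: "CHAR('k) \<noteq> 3" and K: "sfield K" "range e \<subseteq> K" "K \<subseteq> L"
    and KK: "KK = gen (to_ac ` K \<union> range E)" and pN: "presented (E, KK, LL) split_form t w"
begin

lemmas D = presentedD[OF pN]

lemma Gal_image_gen:
  assumes \<sigma>: "\<sigma> \<in> Gal" and S: "S \<subseteq> L"
  shows "\<sigma> ` gen (to_ac ` S \<union> range E) = gen (to_ac ` S \<union> range E)"
proof -
  have "gen (to_ac ` S \<union> range E) \<subseteq> LL"
    unfolding LL_def using S by (intro gen_mono) auto
  then have "hom_on (gen (to_ac ` S \<union> range E)) \<sigma>" using hom_on_subset[OF Gal_hom(1)[OF \<sigma>]] by blast
  from hom_on_gen_image[OF this]
  have "\<sigma> ` gen (to_ac ` S \<union> range E) = gen (\<sigma> ` to_ac ` S \<union> \<sigma> ` range E)" by (simp add: image_Un)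
  moreover have "\<sigma> ` to_ac ` S = to_ac ` S" using Gal_hom(2)[OF \<sigma>] S by force
  ultimately show ?thesis using Gal_range_E[OF \<sigma>] by simp
qed

lemma Gal_KK: "\<sigma> \<in> Gal \<Longrightarrow> \<sigma> ` KK = KK" and Gal_LL: "\<sigma> \<in> Gal \<Longrightarrow> \<sigma> ` LL = LL"
  using Gal_image_gen[OF _ K(3)] Gal_image_gen[OF _ order_refl] by (simp_all add: KK LL_def)

lemma t_w_LL: "t \<in> LL" "w \<in> LL"
  using D(8,10,11) by auto

lemma w_ne_0: "w \<noteq> 0"
  using presented_not_in_base(2)[OF pN nondegenerate_split_form] .

text \<open>An automorphism maps \<open>KK\<close> and \<open>LL\<close> onto themselves and leaves
  the integer coefficients of the form alone; the result is a second presentation of the same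
  extension by the same form, to be compared by \<open>presented_unique\<close>.\<close>

lemma presented_Gal:
  assumes \<sigma>: "\<sigma> \<in> Gal"
  shows "presented (E, KK, LL) split_form (\<sigma> t) (\<sigma> w)"
proof -
  note H = hom_onD[OF sfield_LL Gal_hom(1)[OF \<sigma>]]
  have "transcendental_over E (\<sigma> t)"
    unfolding transcendental_over_def
  proof (intro allI impI notI)
    fix P assume "P \<noteq> 0" "ev E P (\<sigma> t) = 0"
    then have "\<sigma> t \<in> range E" by (rule alg_closed_root_in_range[OF E])
    then have "\<sigma> t \<in> \<sigma> ` range E" using Gal_range_E[OF \<sigma>] by simp
    then obtain r where "\<sigma> t = \<sigma> (E r)" by auto
    then have "t = E r" using H(11)[OF t_w_LL(1) LL_incl(2)] by simp
    then have "ev E [:-r, 1:] t = 0" by (simp add: ev_hom[OF E] EH)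
    then show False using transcendentalD[OF D(2), of "[:-r, 1:]"] by simp
  qed
  moreover have "KK = gen (insert (\<sigma> t) (range E))"
  proof -
    have "hom_on (gen (insert t (range E))) \<sigma>"
      using hom_on_subset[OF Gal_hom(1)[OF \<sigma>] D(8)] D(3) by simp
    from hom_on_gen_image[OF this] show ?thesis
      using Gal_KK[OF \<sigma>] Gal_range_E[OF \<sigma>] D(3) by simp
  qed
  moreover have "LL = gen (insert (\<sigma> w) KK)"
  proof -
    have "hom_on (gen (insert w KK)) \<sigma>" using Gal_hom(1)[OF \<sigma>] D(4) by simp
    from hom_on_gen_image[OF this] show ?thesis
      using Gal_KK[OF \<sigma>] Gal_LL[OF \<sigma>] D(4) by simp
  qed
  moreover have "\<sigma> w ^ 3 = ev E split_form (\<sigma> t)"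
  proof -
    have "w ^ 3 = t * (t - 1)" using D(5) ev_split_form[OF E] by simp
    then have "\<sigma> w ^ 3 = \<sigma> (t * (t - 1))" using H(10)[OF t_w_LL(2)] by metis
    then show ?thesis
      using t_w_LL sfield_intros[OF sfield_LL] ev_split_form[OF E] by (simp add: H)
  qed
  ultimately show ?thesis using E by simp
qed

text \<open>On the genus one curve \<open>w ^ 3 = t (t - 1)\<close> these are the functions in
  \<open>1 / w\<close> times the rational function field with at most simple poles at the three
  ramified places, and no others.\<close>

definition UU :: "'u alg_closure set" where "UU = {(E a + E b * t) / w |a b. True}"

lemma UU_stable:
  assumes \<sigma>: "\<sigma> \<in> Gal" and u: "u \<in> UU"
  shows "\<sigma> u \<in> UU"
proof -
  note H = hom_onD[OF sfield_LL Gal_hom(1)[OF \<sigma>]] and S = sfield_intros[OF sfield_LL]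
  obtain a' b' where u: "u = (E a' + E b' * t) / w" using u by (auto simp: UU_def)
  have char': "CHAR('k alg_closure) \<noteq> 3" using char by simp
  obtain a b c d l v where m: "a * d - b * c \<noteq> 0" "E c * t + E d \<noteq> 0"
    "\<sigma> t * (E c * t + E d) = E a * t + E b" "l \<noteq> 0" "\<sigma> w * (E c * t + E d) = v * w"
    "v \<in> KK" "v ^ 3 = E l ^ 3"
    using presented_unique[OF char' presented_Gal[OF \<sigma>] pN nondegenerate_split_form nondegenerate_split_form] by metis
  \<comment> \<open>\<open>v\<close> is a cube root of a constant, hence itself a constant; only
    constants may enter the new coefficients.\<close>
  have "ev E [:- (l ^ 3), 0, 0, 1:] v = 0"
    using m(7) by (simp add: ev_hom[OF E] EH power3_eq_cube mult.assoc)
  then have "v \<in> range E" by (rule alg_closed_root_in_range[OF E, rotated]) simp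
  then obtain v' where v: "v = E v'" by auto
  have v0: "v \<noteq> 0" using m(4,7) EH(7)[of l] by auto
  then have v'0: "v' \<noteq> 0" using v EH(1) by auto
  define q where "q = E c * t + E d"
  have q0: "q \<noteq> 0" using m(2) by (simp add: q_def)
  have "\<sigma> u = (E (sact \<sigma> a') + E (sact \<sigma> b') * \<sigma> t) / \<sigma> w"
    unfolding u using t_w_LL LL_incl(2) S sact[OF \<sigma>] by (simp add: H)
  also have "\<sigma> t = (E a * t + E b) / q" using m(3) q0 unfolding q_def[symmetric] by (simp add: field_simps)
  also have "\<sigma> w = v * w / q" using m(5) q0 unfolding q_def[symmetric] by (simp add: field_simps)
  also have "(E (sact \<sigma> a') + E (sact \<sigma> b') * ((E a * t + E b) / q)) / (v * w / q) =
      (E (sact \<sigma> a') * q + E (sact \<sigma> b') * (E a * t + E b)) / (v * w)"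
  proof -
    have "(A + B * (C / q)) / (V / q) = (A * q + B * C) / V" for A B C V
    proof -
      have eq: "A + B * (C / q) = (A * q + B * C) / q" using q0 by (simp add: add_divide_distrib)
      show ?thesis unfolding eq using q0 by (simp add: distrib_right)
    qed
    then show ?thesis .
  qed
  \<comment> \<open>The denominators of \<open>\<sigma> t\<close> and \<open>\<sigma> w\<close> have
    cancelled, which leaves a linear numerator over \<open>w\<close>.\<close>
  also have "\<dots> = (E ((sact \<sigma> a' * d + sact \<sigma> b' * b) / v') + E ((sact \<sigma> a' * c + sact \<sigma> b' * a) / v') * t) / w"
  proof -
    have "(A * (c' * t + d') + B * (a' * t + b')) / (V * w) = ((A * d' + B * b') / V + (A * c' + B * a') / V * t) / w"
      if "V \<noteq> 0" for A B a' b' c' d' V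
      using that by (simp add: add_divide_distrib algebra_simps)
    then show ?thesis unfolding q_def v using v0 v by (simp add: EH)
  qed
  finally show ?thesis unfolding UU_def by blast
qed

lemma UU_subspace:
  "UU \<subseteq> LL" "a \<in> UU \<Longrightarrow> b \<in> UU \<Longrightarrow> a - b \<in> UU" "a \<in> UU \<Longrightarrow> E r * a \<in> UU" "0 \<in> UU"
proof -
  show "UU \<subseteq> LL"
    unfolding UU_def using t_w_LL LL_incl(2) sfield_intros[OF sfield_LL] by auto
  show "a - b \<in> UU" if "a \<in> UU" "b \<in> UU"
  proof -
    from that obtain p q r s where "a = (E p + E q * t) / w" "b = (E r + E s * t) / w" by (auto simp: UU_def)
    then have "a - b = (E (p - r) + E (q - s) * t) / w" by (simp add: EH diff_divide_distrib algebra_simps)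
    then show ?thesis unfolding UU_def by blast
  qed
  show "E r * a \<in> UU" if "a \<in> UU"
  proof -
    from that obtain p q where "a = (E p + E q * t) / w" by (auto simp: UU_def)
    then have "E r * a = (E (r * p) + E (r * q) * t) / w" by (simp add: EH algebra_simps)
    then show ?thesis unfolding UU_def by blast
  qed
  have "0 = (E 0 + E 0 * t) / w" by (simp add: EH)
  then show "0 \<in> UU" unfolding UU_def by blast
qed

lemma UU_fixed_vector:
  assumes "v \<in> UU" "u0 \<in> UU" "\<And>r. u0 \<noteq> E r * v"
  obtains z where "z \<in> UU" "z \<in> to_ac ` L" "\<And>r. z \<noteq> E r * v"
  apply (rule stable_subspace_fixed_vector[of UU v u0])
         apply (rule UU_subspace(1))
        apply (erule (1) UU_subspace(2))
       apply (erule UU_subspace(3))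
      apply (erule (1) UU_stable)
     apply (rule assms)+
  apply (erule (1) that)
  apply assumption
  done

text \<open>The plane contains \<open>1 / w\<close> and \<open>t / w\<close>, so it lies in no line.
  A descended vector is taken off the zero line and a second one off the line of the first; their
  independence is the nonvanishing determinant.\<close>

lemma UU_basis:
  obtains a1 b1 a2 b2 where "(E a1 + E b1 * t) / w \<in> to_ac ` L" "(E a2 + E b2 * t) / w \<in> to_ac ` L"
    "b1 * a2 - a1 * b2 \<noteq> 0"
proof -
  have lin0: "E a + E b * t = 0 \<Longrightarrow> a = 0 \<and> b = 0" for a b
    using transcendental_linear_ne_0[OF E D(2), of a b] by blast
  have one: "(E 1 + E 0 * t) / w \<in> UU" unfolding UU_def by blast
  have "(E 1 + E 0 * t) / w \<noteq> E r * 0" for r using w_ne_0 by (simp add: EH)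
  then obtain y1 where y1: "y1 \<in> UU" "y1 \<in> to_ac ` L" "\<And>r. y1 \<noteq> E r * 0"
    using UU_fixed_vector[OF UU_subspace(4) one] by metis
  then obtain a1 b1 where ab1: "y1 = (E a1 + E b1 * t) / w" by (auto simp: UU_def)
  have "y1 \<noteq> 0" using y1(3) by simp
  then have ab1': "a1 \<noteq> 0 \<or> b1 \<noteq> 0" using ab1 by (auto simp: EH)
  have "\<exists>u0\<in>UU. \<forall>r. u0 \<noteq> E r * y1"
  proof (cases "b1 = 0")
    case True
    have "(E 0 + E 1 * t) / w \<noteq> E r * y1" for r
    proof
      assume "(E 0 + E 1 * t) / w = E r * y1"
      then have "E (- (r * a1)) + E 1 * t = 0" using w_ne_0 True unfolding ab1 by (simp add: EH field_simps)
      from lin0[OF this] show False by simp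
    qed
    moreover have "(E 0 + E 1 * t) / w \<in> UU" unfolding UU_def by blast
    ultimately show ?thesis by blast
  next
    case False
    have "(E 1 + E 0 * t) / w \<noteq> E r * y1" for r
    proof
      assume "(E 1 + E 0 * t) / w = E r * y1"
      then have "E (r * a1 - 1) + E (r * b1) * t = 0" using w_ne_0 unfolding ab1 by (simp add: EH field_simps)
      from lin0[OF this] show False using False by auto
    qed
    then show ?thesis using one by blast
  qed
  then obtain u0 where "u0 \<in> UU" "\<And>r. u0 \<noteq> E r * y1" by blast
  then obtain y2 where y2: "y2 \<in> UU" "y2 \<in> to_ac ` L" "\<And>r. y2 \<noteq> E r * y1"
    using UU_fixed_vector[OF y1(1)] by metis
  then obtain a2 b2 where ab2: "y2 = (E a2 + E b2 * t) / w" by (auto simp: UU_def)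
  have "b1 * a2 - a1 * b2 \<noteq> 0"
  proof
    assume det: "b1 * a2 - a1 * b2 = 0"
    obtain r where "a2 = r * a1" "b2 = r * b1"
    proof (cases "b1 = 0")
      case True
      then show ?thesis using that[of "a2 / a1"] ab1' det by auto
    next
      case False
      then show ?thesis using that[of "b2 / b1"] det by (simp add: field_simps)
    qed
    then have "y2 = E r * y1" unfolding ab1 ab2 by (simp add: EH algebra_simps)
    then show False using y2(3) by blast
  qed
  then show ?thesis using that y1(2) y2(2) unfolding ab1 ab2 by blast
qed

lemma descended_presented:
  obtains F x y where "nondegenerate F" "presented (e, K, L) F x y"
proof -
  obtain a1 b1 a2 b2 where ab: "(E a1 + E b1 * t) / w \<in> to_ac ` L" "(E a2 + E b2 * t) / w \<in> to_ac ` L"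
    "b1 * a2 - a1 * b2 \<noteq> 0" by (rule UU_basis)
  define y1 y2 where "y1 = (E a1 + E b1 * t) / w" and "y2 = (E a2 + E b2 * t) / w"
  define dd where "dd = b1 * a2 - a1 * b2"
  have dd0: "dd \<noteq> 0" "E dd \<noteq> 0" using ab(3) EH(7)[of dd] by (auto simp: dd_def)
  have n0: "E a1 + E b1 * t \<noteq> 0"
    by (rule transcendental_linear_ne_0[OF E D(2)]) (use ab(3) in auto)
  define xx yy where "xx = y2 / y1" and "yy = 1 / y1"
  have SL: "sfield (to_ac ` L)" by (rule sfield_to_ac[OF L(1)])
  have XY_L: "xx \<in> to_ac ` L" "yy \<in> to_ac ` L"
    unfolding xx_def yy_def y1_def y2_def
    by (rule sfield_divide[OF SL ab(2,1)], rule sfield_divide[OF SL sfield_1[OF SL] ab(1)])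
  have Xeq: "xx = (E a2 + E b2 * t) / (E a1 + E b1 * t)" and Yeq: "yy = w / (E a1 + E b1 * t)"
    using w_ne_0 n0 by (auto simp: xx_def yy_def y1_def y2_def)
  have q: "E b1 * xx - E b2 = E dd / (E a1 + E b1 * t)"
    using n0 unfolding Xeq dd_def by (simp add: EH field_simps)
  have q0: "E b1 * xx + E (- b2) \<noteq> 0" using q dd0 n0 by (simp add: EH)
  have tX: "t * (E b1 * xx + E (- b2)) = E (- a1) * xx + E a2"
  proof -
    have "xx * (E a1 + E b1 * t) = E a2 + E b2 * t" using n0 by (simp add: Xeq)
    then show ?thesis by (simp add: EH algebra_simps)
  qed
  have XK: "xx \<in> KK" unfolding Xeq using D(9,10) sfield_intros[OF D(6)] by (auto simp: subset_iff)
  have xx_gen: "gen (insert xx (range E)) = KK"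
    unfolding D(3)
  proof (rule gen_insert_eq)
    show "xx \<in> gen (insert t (range E))" using XK D(3) by simp
    have "t = (E (- a1) * xx + E a2) / (E b1 * xx + E (- b2))" using tX q0 by (simp add: field_simps)
    moreover have "\<dots> \<in> gen (insert xx (range E))"
      by (intro sfield_intros[OF sfield_gen] gen_incl) auto
    ultimately show "t \<in> gen (insert xx (range E))" by simp
  qed
  have X_tr: "transcendental_over E xx"
    unfolding transcendental_over_def
  proof (intro allI impI notI)
    fix P assume "P \<noteq> 0" "ev E P xx = 0"
    then have "xx \<in> range E" by (rule alg_closed_root_in_range[OF E])
    then have "gen (insert xx (range E)) \<subseteq> range E" by (intro gen_least sfield_range[OF E]) auto
    then have "t \<in> range E" using xx_gen D(10) by auto
    then obtain r where "t = E r" by auto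
    then have "ev E [:-r, 1:] t = 0" by (simp add: ev_hom[OF E] EH)
    then show False using transcendentalD[OF D(2), of "[:-r, 1:]"] by simp
  qed
  \<comment> \<open>The matrix expresses \<open>t\<close> through \<open>xx\<close>. The factor
    \<open>dd ^ 3\<close> comes from \<open>b1 * xx - b2 = dd / (a1 + b1 t)\<close>, which makes the
    denominator of \<open>t\<close> times \<open>w\<close> equal to \<open>dd * yy\<close>.\<close>
  define P where "P = smult (inverse (dd ^ 3)) (act (- a1) a2 b1 (- b2) split_form)"
  have "nondegenerate (act (- a1) a2 b1 (- b2) split_form)"
    by (rule nondegenerate_act[OF nondegenerate_split_form]) (use ab(3) in \<open>simp add: algebra_simps\<close>)
  then have gP: "nondegenerate P" unfolding P_def using dd0 by (simp add: nondegenerate_smult)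
  have "ev E (act (- a1) a2 b1 (- b2) split_form) xx = (E b1 * xx + E (- b2)) ^ 3 * w ^ 3"
    using ev_act[OF E nondegenerate_degree(2)[OF nondegenerate_split_form] q0 tX] D(5) by simp
  also have "\<dots> = E dd ^ 3 * yy ^ 3"
    using q n0 unfolding Yeq by (simp add: EH power_divide)
  finally have YP: "yy ^ 3 = ev E P xx"
    unfolding P_def using dd0 by (simp add: ev_hom[OF E] EH)
  obtain x y where x: "x \<in> L" "xx = to_ac x" and y: "y \<in> L" "yy = to_ac y" using XY_L by auto
  have "x \<in> K"
  proof -
    have "xx \<in> to_ac ` K"
      by (rule Gal_fixed[OF K]) (use XK KK x Gal_hom(2) in auto)
    then show ?thesis using x(2) by auto
  qed
  \<comment> \<open>Applying an automorphism to \<open>yy ^ 3 = P(xx)\<close> fixes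
    \<open>xx\<close> and \<open>yy\<close>; as \<open>xx\<close> is transcendental,
    \<open>P\<close> equals its conjugate.\<close>
  have Pk: "coeff P i \<in> range to_ac" for i
  proof (rule ccontr)
    assume "coeff P i \<notin> range to_ac"
    then obtain \<sigma> where \<sigma>: "\<sigma> \<in> Gal" "\<sigma> (E (coeff P i)) \<noteq> E (coeff P i)" by (rule Gal_moves)
    note H = hom_onD[OF sfield_LL Gal_hom(1)[OF \<sigma>(1)]]
    have s0: "sact \<sigma> 0 = 0" using sact[OF \<sigma>(1), of 0] H(1) EH(1) EH(7)[of "sact \<sigma> 0"] by simp
    have XL: "xx \<in> LL" "yy \<in> LL" using x y LL_incl by auto
    have "map_poly E P \<in> polyF LL" using LL_incl(2) by (simp add: polyF_def coeff_map_poly_hom[OF sfield_UNIV E])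
    then have "\<sigma> (ev E P xx) = poly (map_poly \<sigma> (map_poly E P)) (\<sigma> xx)"
      by (rule hom_on_poly[OF sfield_LL Gal_hom(1)[OF \<sigma>(1)] _ XL(1)])
    also have "map_poly \<sigma> (map_poly E P) = map_poly E (map_poly (sact \<sigma>) P)"
      by (rule poly_eqI)
        (simp add: coeff_map_poly_hom[OF sfield_LL Gal_hom(1)[OF \<sigma>(1)]] coeff_map_poly_hom[OF sfield_UNIV E]
          coeff_map_poly s0 sact[OF \<sigma>(1)])
    also have "\<sigma> xx = xx" using x Gal_hom(2)[OF \<sigma>(1)] by simp
    finally have "\<sigma> (ev E P xx) = ev E (map_poly (sact \<sigma>) P) xx" .
    moreover have "\<sigma> (yy ^ 3) = yy ^ 3" using y Gal_hom(2)[OF \<sigma>(1)] H(10)[OF XL(2)] by simp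
    ultimately have "ev E P xx = ev E (map_poly (sact \<sigma>) P) xx" using YP by simp
    then have "P = map_poly (sact \<sigma>) P" by (simp only: ev_eq_iff[OF E X_tr])
    then have "coeff P i = sact \<sigma> (coeff P i)" using s0 by (metis coeff_map_poly)
    then show False using sact[OF \<sigma>(1)] \<sigma>(2) by simp
  qed
  define F where "F = map_poly of_ac P"
  have PF: "P = ac_poly F"
    by (rule poly_eqI) (use Pk in \<open>simp add: F_def map_poly_to_ac coeff_map_poly to_ac_of_ac\<close>)
  have gF: "nondegenerate F" using gP unfolding PF using nondegenerate_map_poly[OF hom_on_to_ac] by blast
  have yF: "y ^ 3 = ev e F x"
    using YP ac_lift_ev[OF lift, of F x] unfolding PF x(2) y(2) by (metis to_ac_eq_iff to_ac_power)
  have x_tr: "transcendental_over e x"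
    unfolding transcendental_over_def
  proof (intro allI impI notI)
    fix p assume p: "p \<noteq> 0" "ev e p x = 0"
    then have "ev E (ac_poly p) xx = 0" using ac_lift_ev[OF lift, of p x] x(2) by simp
    then show False using transcendentalD[OF X_tr, of "ac_poly p"] p(1) by (simp add: map_poly_to_ac)
  qed
  \<comment> \<open>That \<open>x\<close> generates the base field holds after base change;
    \<open>Gal_fixed\<close> for the subfield \<open>K2\<close> brings it down to \<open>K\<close>.
    The field \<open>L2\<close> below serves \<open>y\<close> and \<open>L\<close> in the same
    way.\<close>
  define K2 where "K2 = gen (insert x (range e))"
  have K2: "sfield K2" "range e \<subseteq> K2" "x \<in> K2" unfolding K2_def by (auto intro: gen_incl)
  have K2K: "K2 \<subseteq> K" unfolding K2_def by (rule gen_least) (use K \<open>x \<in> K\<close> in auto)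
  have "K \<subseteq> K2"
  proof
    fix z assume z: "z \<in> K"
    have "KK \<subseteq> gen (to_ac ` K2 \<union> range E)"
      unfolding xx_gen[symmetric] using K2(3) x(2) by (intro gen_mono) auto
    moreover have "to_ac z \<in> KK" unfolding KK using z by (auto intro: gen_incl)
    ultimately have "to_ac z \<in> to_ac ` K2"
      by (intro Gal_fixed[OF K2(1,2)]) (use K2K K(3) z Gal_hom(2) in auto)
    then show "z \<in> K2" by auto
  qed
  then have K2eq: "K = gen (insert x (range e))" using K2K K2_def by simp
  define L2 where "L2 = gen (insert y K)"
  have L2: "sfield L2" "K \<subseteq> L2" "y \<in> L2" unfolding L2_def by (auto intro: gen_incl)
  have L2L: "L2 \<subseteq> L" unfolding L2_def by (rule gen_least) (use L K y in auto)
  have "L \<subseteq> L2"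
  proof
    fix z assume z: "z \<in> L"
    let ?G = "gen (to_ac ` L2 \<union> range E)"
    have "KK \<subseteq> ?G" unfolding KK using L2(2) by (intro gen_mono) auto
    moreover have "w \<in> ?G"
    proof -
      have "w = yy * (E a1 + E b1 * t)" using n0 by (simp add: Yeq)
      moreover have "yy \<in> ?G" using L2(3) y(2) by (auto intro: gen_incl)
      moreover have "t \<in> ?G" using \<open>KK \<subseteq> ?G\<close> D(10) by auto
      moreover have "E a1 \<in> ?G" "E b1 \<in> ?G" by (auto intro: gen_incl)
      ultimately show ?thesis using sfield_intros[OF sfield_gen[of "to_ac ` L2 \<union> range E"]] by simp
    qed
    ultimately have "LL \<subseteq> ?G" unfolding D(4) by (intro gen_least) auto
    then have "to_ac z \<in> ?G" using LL_incl(1)[OF z] by auto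
    then have "to_ac z \<in> to_ac ` L2"
      by (intro Gal_fixed[OF L2(1)]) (use L2L L2(2) K(2) z Gal_hom(2) in auto)
    then show "z \<in> L2" by auto
  qed
  then have "L = gen (insert y K)" using L2L L2_def by simp
  then have "presented (e, K, L) F x y" using e x_tr K2eq yF by simp
  then show ?thesis using that gF by blast
qed

end

end

text \<open>The base change of a bi-twist inherits a split presentation through the isomorphism, and
  descent yields one over \<open>k\<close>. From here on bi-twists are studied through nondegenerate
  forms.\<close>

theorem bi_twist_presented:
  fixes M :: "('k::field, 'u::field) extn" and M0 :: "('k, 'v::field) extn"
  assumes perf: "perfect_field TYPE('k)" and char: "CHAR('k) \<noteq> 3"
    and p0: "presented M0 split_form x0 y0" and tw: "bi_twist M M0"
  obtains F x y where "nondegenerate F" "presented M F x y"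
proof -
  obtain e K L e0 K0 L0 where M: "M = (e, K, L)" "M0 = (e0, K0, L0)" by (metis prod_cases3)
  obtain E K' L' E0 K0' L0' where b: "base_change (e, K, L) (E, K', L')" "base_change (e0, K0, L0) (E0, K0', L0')"
    "bi_isomorphic (E, K', L') (E0, K0', L0')"
    using tw unfolding bi_twist_def M by (metis prod_cases3)
  have cub: "cubic_extension (e, K, L)" using tw unfolding bi_twist_def M by simp
  then have wf: "wf_extn (e, K, L)" by (rule cubic_extension_wf)
  then have e: "hom_on UNIV e" and KL: "sfield K" "sfield L" "range e \<subseteq> K" "K \<subseteq> L" by auto
  have lift: "ac_lift e E" by (rule base_change_ac_lift[OF b(1) e])
  have E: "hom_on UNIV E" using lift by (simp add: ac_lift_def)
  have K'L': "K' = gen (to_ac ` K \<union> range E)" "L' = gen (to_ac ` L \<union> range E)" using b(1) by auto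
  have "K' \<subseteq> L'" unfolding K'L' using KL(4) by (intro gen_mono) auto
  then have wfN: "wf_extn (E, K', L')" using E K'L' by (auto intro: gen_incl)
  have "presented (E0, K0', L0') split_form (to_ac x0) (to_ac y0)"
    using presented_base_change[OF p0[unfolded M] b(2)] by (simp only: ac_poly_split_form)
  then obtain t w where tw: "presented (E, K', L') split_form t w"
    using presented_bi_isomorphic_transfer[OF bi_isomorphic_sym[OF b(3) wfN]] by metis
  interpret descent e E L
    by unfold_locales (use perf lift KL cub in \<open>auto simp: function_field_def\<close>)
  have "LL = L'" by (simp add: LL_def K'L')
  then show ?thesis
    using descended_presented[OF char KL(1,3,4) K'L'(1)] tw that M by metis
qed

subsection \<open>Extensions of degree at most three\<close>

abbreviation base :: "'k::field alg_closure set" where "base \<equiv> range to_ac"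

lemma sfield_base: "sfield base"
  by (rule sfield_range) simp

lemma polyF_base_iff: "q \<in> polyF base \<longleftrightarrow> (\<exists>p. q = ac_poly p)"
proof
  assume q: "q \<in> polyF base"
  have "q = ac_poly (map_poly of_ac q)"
    by (rule poly_eqI) (use polyFD[OF q] in \<open>simp add: map_poly_to_ac coeff_map_poly to_ac_of_ac\<close>)
  then show "\<exists>p. q = ac_poly p" by blast
qed (auto simp: polyF_def map_poly_to_ac)

lemma is_min_poly_iff: "is_min_poly f \<alpha> \<longleftrightarrow> min_poly_over base \<alpha> (ac_poly f)"
proof
  assume "is_min_poly f \<alpha>"
  then show "min_poly_over base \<alpha> (ac_poly f)"
    unfolding is_min_poly_def min_poly_over_def
    by (auto simp: polyF_base_iff map_poly_to_ac)
next
  assume m: "min_poly_over base \<alpha> (ac_poly f)"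
  have "degree f \<le> degree h" if "h \<noteq> 0" "poly (ac_poly h) \<alpha> = 0" for h
  proof -
    have "ac_poly h \<in> polyF base" unfolding polyF_base_iff by blast
    then show ?thesis using m that unfolding min_poly_over_def
      by (metis map_poly_to_ac(4,5))
  qed
  moreover have "lead_coeff f = 1" "poly (ac_poly f) \<alpha> = 0"
    using m by (auto simp: min_poly_over_def map_poly_to_ac)
  ultimately show "is_min_poly f \<alpha>" unfolding is_min_poly_def by blast
qed

lemma is_min_polyD:
  assumes "is_min_poly f \<alpha>"
  shows "lead_coeff f = 1" "poly (ac_poly f) \<alpha> = 0" "f \<noteq> 0"
    "\<And>h. h \<noteq> 0 \<Longrightarrow> poly (ac_poly h) \<alpha> = 0 \<Longrightarrow> degree f \<le> degree h"
  using assms by (auto simp: is_min_poly_def)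

lemma is_min_poly_exists: obtains f where "is_min_poly f \<alpha>"
proof -
  obtain f where f: "f \<noteq> 0" "poly (ac_poly f) \<alpha> = 0"
    "\<And>g. g \<noteq> 0 \<Longrightarrow> poly (ac_poly g) \<alpha> = 0 \<Longrightarrow> degree f \<le> degree g"
    by (rule ac_minimal_exists[of \<alpha>]) blast
  have "is_min_poly (smult (inverse (lead_coeff f)) f) \<alpha>"
    unfolding is_min_poly_def using f by (auto simp: map_poly_to_ac)
  then show ?thesis by (rule that)
qed

lemma is_min_poly_dvd:
  assumes "is_min_poly f \<alpha>" "poly (ac_poly h) \<alpha> = 0"
  shows "f dvd h"
proof (rule ccontr)
  assume "\<not> f dvd h"
  then have n: "h mod f \<noteq> 0" by (simp add: dvd_eq_mod_eq_0)
  note m = is_min_polyD[OF assms(1)]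
  have "h mod f = h - h div f * f" by (simp add: minus_div_mult_eq_mod)
  then have "poly (ac_poly (h mod f)) \<alpha> = 0"
    using assms(2) m(2) by (simp add: ev_hom[OF hom_on_to_ac])
  then have "degree f \<le> degree (h mod f)" using m(4) n by blast
  then show False using degree_mod_less'[OF m(3) n] by simp
qed

lemma monic_dvd_eq:
  fixes f h :: "'k::field poly"
  assumes "lead_coeff f = 1" "lead_coeff h = 1" "f dvd h" "degree h \<le> degree f"
  shows "f = h"
proof -
  obtain s where s: "h = f * s" using assms(3) by (rule dvdE)
  have nz: "f \<noteq> 0" "s \<noteq> 0" using assms(1,2) s by auto
  then have "degree h = degree f + degree s" unfolding s by (rule degree_mult_eq)
  then have "degree s = 0" using assms(4) by simp
  then obtain c where c: "s = [:c:]" using degree_eq_zeroE by blast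
  then have "h = smult c f" using s by simp
  then have "c = 1" using assms(1,2) by (metis lead_coeff_smult mult.right_neutral)
  then show ?thesis using \<open>h = smult c f\<close> by simp
qed

lemma is_min_poly_unique:
  assumes "is_min_poly f \<alpha>" "is_min_poly h \<alpha>" shows "f = h"
  using monic_dvd_eq[of f h] is_min_polyD[OF assms(1)] is_min_polyD[OF assms(2)]
    is_min_poly_dvd[OF assms(1)] by blast

text \<open>Irreducibility: if the minimal polynomial of \<beta> were a proper factor of
  \<open>f\<close>, then \<alpha> would be a root of it or of the cofactor, both of smaller
  degree.\<close>

lemma is_min_poly_conjugate:
  assumes f: "is_min_poly f \<alpha>" and \<beta>: "poly (ac_poly f) \<beta> = 0"
  shows "is_min_poly f \<beta>"
proof -
  obtain h where h: "is_min_poly h \<beta>" by (rule is_min_poly_exists)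
  obtain s where s: "f = h * s" using is_min_poly_dvd[OF h \<beta>] by (rule dvdE)
  note F = is_min_polyD[OF f] and Hm = is_min_polyD[OF h]
  have s0: "s \<noteq> 0" using F(3) s by auto
  have deg: "degree f = degree h + degree s" unfolding s using Hm(3) s0 by (rule degree_mult_eq)
  have "poly (ac_poly h) \<alpha> = 0 \<or> poly (ac_poly s) \<alpha> = 0"
    using F(2) unfolding s by (simp add: map_poly_to_ac)
  then have "degree f \<le> degree h"
  proof
    assume "poly (ac_poly s) \<alpha> = 0"
    then have "degree h = 0" using F(4)[OF s0] deg by simp
    then obtain c where "h = [:c:]" using degree_eq_zeroE by blast
    then show ?thesis using Hm(2,3) by (simp add: map_poly_pCons)
  qed (rule F(4)[OF Hm(3)])
  then have "h = f" using monic_dvd_eq[OF Hm(1) F(1)] s by simp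
  then show ?thesis using h by simp
qed

lemma is_min_poly_degree_1:
  assumes f: "is_min_poly f \<alpha>" shows "degree f \<ge> 1" "degree f = 1 \<longleftrightarrow> \<alpha> \<in> base"
proof -
  show "degree f \<ge> 1"
    using min_poly_over_degree_pos[OF f[unfolded is_min_poly_iff]] by (simp add: map_poly_to_ac)
  show "degree f = 1 \<longleftrightarrow> \<alpha> \<in> base"
  proof
    assume "degree f = 1"
    then have "f = [:coeff f 0, 1:]"
      using is_min_polyD(1)[OF f] by (intro poly_eqI) (auto simp: coeff_pCons coeff_eq_0 split: nat.split)
    then have "poly (ac_poly [:coeff f 0, 1:]) \<alpha> = 0" using is_min_polyD(2)[OF f] by simp
    then have "\<alpha> = to_ac (- coeff f 0)" by (simp add: map_poly_pCons eq_neg_iff_add_eq_0 add.commute)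
    then show "\<alpha> \<in> base" by blast
  next
    assume "\<alpha> \<in> base"
    then obtain a where "\<alpha> = to_ac a" by auto
    then have "poly (ac_poly [:-a, 1:]) \<alpha> = 0" by (simp add: map_poly_pCons)
    then have "degree f \<le> degree [:-a, 1:]" by (intro is_min_polyD(4)[OF f]) auto
    then show "degree f = 1" using \<open>degree f \<ge> 1\<close> by simp
  qed
qed

lemma gen_base_elem:
  assumes f: "is_min_poly f \<alpha>" and \<beta>: "\<beta> \<in> gen (insert \<alpha> base)"
  obtains q where "degree q < degree f" "\<beta> = poly (ac_poly q) \<alpha>"
proof -
  have "alg_over base \<alpha>"
    using f unfolding is_min_poly_iff alg_over_def min_poly_over_def by (metis leading_coeff_0_iff zero_neq_one)
  then obtain h where h: "\<beta> = poly (ac_poly h) \<alpha>"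
    using \<beta> unfolding simple_alg_extension[OF sfield_base \<open>alg_over base \<alpha>\<close>] polyF_base_iff by blast
  note m = is_min_polyD[OF f]
  have "h mod f = h - h div f * f" by (simp add: minus_div_mult_eq_mod)
  then have "poly (ac_poly (h mod f)) \<alpha> = \<beta>"
    using h m(2) by (simp add: ev_hom[OF hom_on_to_ac])
  moreover have "degree (h mod f) < degree f"
    using is_min_poly_degree_1(1)[OF f] degree_mod_less'[OF m(3), of h] by (cases "h mod f = 0") auto
  ultimately show ?thesis using that by metis
qed

text \<open>All roots are conjugate and, by perfectness, simple; the discriminant is
  \<open>u ^ 4\<close> times the squared differences of the finite roots. In degree two a single
  difference remains, the root at infinity contributing only to the power of
  \<open>u\<close>.\<close>

lemma is_min_poly_nondegenerate:
  fixes f :: "'k::field poly"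
  assumes perf: "perfect_field TYPE('k)" and f: "is_min_poly f \<alpha>" and d: "degree f = 2 \<or> degree f = 3"
  shows "nondegenerate f"
proof -
  let ?f = "ac_poly f"
  have simple: "poly (pderiv ?f) \<beta> \<noteq> 0" if "poly ?f \<beta> = 0" for \<beta>
    using perfect_separable[OF perf is_min_polyD(3,2)[OF is_min_poly_conjugate[OF f that]]]
      is_min_polyD(4)[OF is_min_poly_conjugate[OF f that]]
    by (simp add: ac_poly_pderiv)
  have factor: "\<exists>r g. p = [:-r, 1:] * g \<and> degree p = Suc (degree g)" if dp: "degree p > 0" for p :: "'k alg_closure poly"
  proof -
    obtain r where "poly p r = 0" using alg_closed_imp_poly_has_root[OF dp] by blast
    then have "[:-r, 1:] dvd p" using poly_eq_0_iff_dvd by blast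
    then obtain g where g: "p = [:-r, 1:] * g" by (rule dvdE)
    then have "g \<noteq> 0" using dp by auto
    then have "degree p = Suc (degree g)" unfolding g by (subst degree_mult_eq) auto
    then show ?thesis using g by blast
  qed
  have ne: "r \<noteq> s" if "?f = [:-r, 1:] * ([:-s, 1:] * g)" for r s g
  proof
    assume "r = s"
    then have "poly (pderiv ?f) r = 0" unfolding that pderiv_mult by simp
    moreover have "poly ?f r = 0" unfolding that by simp
    ultimately show False using simple by blast
  qed
  obtain r g where g: "?f = [:-r, 1:] * g" "degree ?f = Suc (degree g)"
  proof -
    have "degree ?f > 0" using d by (auto simp: map_poly_to_ac)
    then show ?thesis using factor that by blast
  qed
  obtain s h where h: "g = [:-s, 1:] * h" "degree g = Suc (degree h)"
  proof -
    have "degree g > 0" using d g(2) by (auto simp: map_poly_to_ac)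
    then show ?thesis using factor that by blast
  qed
  have rs: "r \<noteq> s" using ne[of r s h] g(1) h(1) by simp
  have "h \<noteq> 0" using is_min_polyD(3)[OF f] g(1) h(1) by (metis map_poly_to_ac(4) mult_zero_right)
  have "form_disc ?f \<noteq> 0"
  proof (cases "degree f = 2")
    case True
    then have "degree h = 0" using g(2) h(2) by (simp add: map_poly_to_ac)
    then obtain u where u: "h = [:u:]" using degree_eq_zeroE by blast
    have fe: "?f = [:r * s * u, - (r + s) * u, u:]" unfolding g(1) h(1) u by (simp add: algebra_simps)
    have "form_disc ?f = u ^ 4 * (r - s) ^ 2"
      unfolding fe form_disc_def cubic_disc_def
      by (simp add: coeff_pCons numeral_2_eq_2 numeral_3_eq_3) Groebner_Basis.algebra
    then show ?thesis using rs u \<open>h \<noteq> 0\<close> by simp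
  next
    case False
    then have "degree h = 1" using g(2) h(2) d by (simp add: map_poly_to_ac)
    then have "degree h > 0" by simp
    then obtain q h' where h': "h = [:-q, 1:] * h'" "degree h = Suc (degree h')" using factor by blast
    then obtain u where u: "h' = [:u:]" using \<open>degree h = 1\<close> degree_eq_zeroE by (metis One_nat_def nat.inject)
    have "?f = [:-s, 1:] * ([:-q, 1:] * ([:-r, 1:] * h'))" "?f = [:-r, 1:] * ([:-q, 1:] * ([:-s, 1:] * h'))"
      unfolding g(1) h(1) h'(1) by (simp_all only: ac_simps)
    then have sq: "s \<noteq> q" "r \<noteq> q" using ne by blast+
    have fe: "?f = [:- (r * s * q * u), (r * s + s * q + r * q) * u, - (r + s + q) * u, u:]"
      unfolding g(1) h(1) h'(1) u by (simp add: algebra_simps)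
    have "form_disc ?f = u ^ 4 * (r - s) ^ 2 * (s - q) ^ 2 * (r - q) ^ 2"
      unfolding fe form_disc_def cubic_disc_def
      by (simp add: coeff_pCons numeral_2_eq_2 numeral_3_eq_3) Groebner_Basis.algebra
    moreover have "u \<noteq> 0" using u h'(1) \<open>h \<noteq> 0\<close> by auto
    ultimately show ?thesis using rs sq by simp
  qed
  then have "nondegenerate ?f" using d by (auto simp: nondegenerate_def map_poly_to_ac)
  then show ?thesis using nondegenerate_map_poly[OF hom_on_to_ac] by blast
qed

section \<open>Isomorphism classes of extensions and their generators\<close>

lemma small_extsD:
  assumes "l \<in> small_exts"
  shows "sfield l" "base \<subseteq> l" "\<exists>n\<le>3. ring.dimension amb n base l"
  using assms by (auto simp: small_exts_def subfield_amb_iff)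

lemma base_small: "(base :: 'k::field alg_closure set) \<in> small_exts"
proof -
  interpret R: Ring.ring "amb :: 'k alg_closure ring" by (rule ring_amb)
  have "R.dimension 1 base base"
    by (rule R.dimension_one) (simp add: subfield_amb_iff sfield_base)
  then show ?thesis
    by (auto simp: small_exts_def subfield_amb_iff sfield_base intro!: exI[of _ 1])
qed

lemma gen_base_small:
  assumes "is_min_poly f \<alpha>" "degree f \<le> 3"
  shows "gen (insert \<alpha> base) \<in> small_exts"
  using dimension_simple_extension[OF sfield_base assms(1)[unfolded is_min_poly_iff]] assms(2)
  by (auto simp: small_exts_def subfield_amb_iff map_poly_to_ac intro: gen_incl)

lemma dimension_mono:
  assumes K: "sfield K" and "ring.dimension amb n K V" "ring.dimension amb m K W" "V \<subseteq> W"
  shows "n \<le> m"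
proof -
  interpret R: Ring.ring "amb :: 'a ring" by (rule ring_amb)
  have K': "subfield K (amb :: 'a ring)" using K by (simp add: subfield_amb_iff)
  obtain Vs where Vs: "R.independent K Vs" "length Vs = n" "R.Span K Vs = V"
    using R.exists_base[OF K' assms(2)] by blast
  have "set Vs \<subseteq> V" using R.Span_base_incl[OF K', of Vs] Vs(3) by simp
  then show ?thesis using R.independent_length_le_dimension[OF K' assms(3) Vs(1)] Vs(2) assms(4) by auto
qed

text \<open>\<alpha> has degree at least two, so an element of \<open>l\<close> outside its field
  would give dimension at least four.\<close>

lemma small_ext_generated:
  assumes l: "l \<in> small_exts" and \<alpha>: "\<alpha> \<in> l" "\<alpha> \<notin> base" and f: "is_min_poly f \<alpha>"
  shows "l = gen (insert \<alpha> base)" "degree f = 2 \<or> degree f = 3"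
proof -
  interpret R: Ring.ring "amb :: 'a alg_closure ring" by (rule ring_amb)
  let ?F = "gen (insert \<alpha> base)"
  note D = small_extsD[OF l]
  obtain n where n: "n \<le> 3" "R.dimension n base l" using D(3) by blast
  have dF: "R.dimension (degree f) base ?F"
    using dimension_simple_extension[OF sfield_base f[unfolded is_min_poly_iff]] by (simp add: map_poly_to_ac)
  have Fl: "?F \<subseteq> l" by (rule gen_least[OF D(1)]) (use D(2) \<alpha> in auto)
  have d2: "degree f \<ge> 2" using is_min_poly_degree_1[OF f] \<alpha>(2) by linarith
  have d3: "degree f \<le> 3" using dimension_mono[OF sfield_base dF n(2) Fl] n(1) by simp
  show "degree f = 2 \<or> degree f = 3" using d2 d3 by linarith
  show "l = ?F"
  proof (rule ccontr)
    assume "l \<noteq> ?F"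
    then obtain \<beta> where \<beta>: "\<beta> \<in> l" "\<beta> \<notin> ?F" using Fl by blast
    let ?W = "R.line_extension ?F \<beta> ?F"
    have sF: "subfield ?F amb" "subfield base (amb :: 'a alg_closure ring)"
      by (simp_all add: subfield_amb_iff sfield_base)
    have "R.dimension (Suc 1) ?F ?W"
      by (rule R.Suc_dim) (use \<beta> R.dimension_one[OF sF(1)] in auto)
    then have "R.dimension (degree f * Suc 1) base ?W"
      by (rule R.telescopic_base[OF sF(2,1) dF])
    moreover have "?W \<subseteq> l"
      using Fl \<beta>(1) sfield_add[OF D(1)] sfield_mult[OF D(1)]
      by (auto simp: R.line_extension_mem_iff subset_iff)
    ultimately have "degree f * Suc 1 \<le> n" using dimension_mono[OF sfield_base _ n(2)] by blast
    then show False using d2 n(1) by simp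
  qed
qed

lemma ext_iso_rel_iff:
  "(l, m) \<in> ext_iso_rel \<longleftrightarrow> l \<in> small_exts \<and> m \<in> small_exts \<and>
     (\<exists>h. hom_on l h \<and> h ` l = m \<and> (\<forall>a. h (to_ac a) = to_ac a))"
  using ring_iso_sub_fld_iff[OF small_extsD(1), of l]
  unfolding ext_iso_rel_def by blast

lemma equiv_ext_iso_rel: "equiv (small_exts :: 'k::field alg_closure set set) ext_iso_rel"
proof (rule equivI)
  let ?R = "ext_iso_rel :: ('k alg_closure set \<times> 'k alg_closure set) set"
  show "?R \<subseteq> small_exts \<times> small_exts" by (auto simp: ext_iso_rel_def)
  show "refl_on small_exts ?R"
    unfolding refl_on_def ext_iso_rel_iff by (auto simp: hom_on_def intro!: exI[of _ "\<lambda>x. x"])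
  show "sym ?R"
  proof (rule symI)
    fix l m :: "'k alg_closure set" assume "(l, m) \<in> ext_iso_rel"
    then obtain h where h: "l \<in> small_exts" "m \<in> small_exts" "hom_on l h" "h ` l = m"
      "\<And>a. h (to_ac a) = to_ac a" unfolding ext_iso_rel_iff by blast
    note D = small_extsD[OF h(1)]
    have inj: "inj_on h l" using hom_onD(11)[OF D(1) h(3)] by (auto simp: inj_on_def)
    have "inv_into l h (to_ac a) = to_ac a" for a
      using inv_into_f_f[OF inj, of "to_ac a"] D(2) h(5) by auto
    moreover have "inv_into l h ` m = l" using inj h(4) inv_into_image_cancel[OF inj order_refl] by simp
    ultimately show "(m, l) \<in> ext_iso_rel"
      unfolding ext_iso_rel_iff using hom_on_inv_into[OF D(1) h(3)] h(1,2,4) by blast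
  qed
  show "trans ?R"
  proof (rule transI)
    fix l m n :: "'k alg_closure set" assume "(l, m) \<in> ext_iso_rel" "(m, n) \<in> ext_iso_rel"
    then obtain h h' where h: "l \<in> small_exts" "n \<in> small_exts" "hom_on l h" "h ` l = m"
      "\<And>a. h (to_ac a) = to_ac a" "hom_on m h'" "h' ` m = n" "\<And>a. h' (to_ac a) = to_ac a"
      unfolding ext_iso_rel_iff by blast
    have "hom_on l (\<lambda>z. h' (h z))" using hom_on_comp[OF h(3,6)] h(4) by simp
    moreover have "(\<lambda>z. h' (h z)) ` l = n" using h(4,7) by (auto simp flip: image_image)
    ultimately show "(l, n) \<in> ext_iso_rel" unfolding ext_iso_rel_iff using h by auto
  qed
qed

lemma ext_class_eq:
  assumes "C \<in> ext_classes" "C' \<in> ext_classes" "l \<in> C" "m \<in> C'" "(l, m) \<in> ext_iso_rel"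
  shows "C = C'"
  using quotient_eqI[OF equiv_ext_iso_rel] assms unfolding ext_classes_def by blast

lemma ext_class_small: "C \<in> ext_classes \<Longrightarrow> l \<in> C \<Longrightarrow> l \<in> small_exts"
  using in_quotient_imp_subset[OF equiv_ext_iso_rel] unfolding ext_classes_def by blast

lemma ext_class_iso: "C \<in> ext_classes \<Longrightarrow> l \<in> C \<Longrightarrow> m \<in> C \<Longrightarrow> (l, m) \<in> ext_iso_rel"
  using in_quotient_imp_in_rel[OF equiv_ext_iso_rel] unfolding ext_classes_def by blast

lemma ext_iso_base: "(base, l) \<in> ext_iso_rel \<Longrightarrow> l = base"
  unfolding ext_iso_rel_iff by (force simp: image_image)

lemma conjugate_ext_iso:
  assumes f: "is_min_poly f \<alpha>" "is_min_poly f \<beta>" and "degree f \<le> 3"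
  shows "(gen (insert \<alpha> base), gen (insert \<beta> base)) \<in> ext_iso_rel"
proof -
  have id: "hom_on base (\<lambda>a. a)" by (simp add: hom_on_def)
  have "poly (map_poly (\<lambda>a. a) (ac_poly f)) \<beta> = 0" using is_min_polyD(2)[OF f(2)] by simp
  then obtain h where h: "hom_on (gen (insert \<alpha> base)) h" "\<And>a. a \<in> base \<Longrightarrow> h a = a" "h \<alpha> = \<beta>"
    using hom_extend_simple[OF sfield_base id f(1)[unfolded is_min_poly_iff]] by metis
  have "h ` base = base" using h(2) by force
  then have "h ` gen (insert \<alpha> base) = gen (insert \<beta> base)"
    using hom_on_gen_image[OF h(1)] h(3) by simp
  then show ?thesis
    unfolding ext_iso_rel_iff using h(1,2) gen_base_small[OF f(1) assms(3)] gen_base_small[OF f(2) assms(3)]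
    by auto
qed

text \<open>An isomorphism over \<open>k\<close> sends the generator to a root of the same
  polynomial, so every field of a class has a generator conjugate to the chosen one.\<close>

lemma ext_iso_generator:
  assumes iso: "(gen (insert \<alpha> base), l) \<in> ext_iso_rel" and f: "is_min_poly f \<alpha>"
  obtains \<beta> where "is_min_poly f \<beta>" "l = gen (insert \<beta> base)"
proof -
  let ?G = "gen (insert \<alpha> base)"
  obtain h where h: "hom_on ?G h" "h ` ?G = l" "\<And>a. h (to_ac a) = to_ac a"
    using iso unfolding ext_iso_rel_iff by blast
  have "h ` base = base" using h(3) by (force simp: image_image)
  then have "l = gen (insert (h \<alpha>) base)" using hom_on_gen_image[OF h(1)] h(2) by simp
  moreover have "poly (ac_poly f) (h \<alpha>) = 0"
  proof -
    have "ac_poly f \<in> polyF ?G" by (auto simp: polyF_def map_poly_to_ac intro: gen_incl)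
    from hom_on_poly[OF sfield_gen h(1) this, of \<alpha>]
    have "poly (map_poly h (ac_poly f)) (h \<alpha>) = h 0"
      using is_min_polyD(2)[OF f] gen_incl[of \<alpha> "insert \<alpha> base"] by simp
    moreover have "map_poly h (ac_poly f) = ac_poly f"
      by (rule poly_eqI) (simp add: coeff_map_poly_hom[OF sfield_gen h(1)] map_poly_to_ac h(3))
    ultimately show ?thesis using hom_on_0[OF sfield_gen h(1)] by simp
  qed
  ultimately show ?thesis using that is_min_poly_conjugate[OF f] by blast
qed

lemma generator_choice_exists: "\<exists>g. generator_choice (g :: 'k::field alg_closure set set \<Rightarrow> 'k alg_closure)"
proof -
  have "\<exists>\<alpha>. gen (insert \<alpha> base) \<in> C" if C: "C \<in> ext_classes" for C :: "'k alg_closure set set"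
  proof -
    obtain l where l: "l \<in> C"
      using C in_quotient_imp_non_empty[OF equiv_ext_iso_rel] unfolding ext_classes_def by blast
    have ls: "l \<in> small_exts" by (rule ext_class_small[OF C l])
    show ?thesis
    proof (cases "l = base")
      case True
      have "gen (insert 0 base) = (base :: 'k alg_closure set)"
        using gen_least[OF sfield_base, of "insert 0 base"] gen_superset[of "insert 0 base"]
          sfield_0[OF sfield_base] by auto
      then show ?thesis using l True by metis
    next
      case False
      then obtain \<alpha> where "\<alpha> \<in> l" "\<alpha> \<notin> base" using small_extsD(2)[OF ls] by blast
      then show ?thesis using small_ext_generated(1)[OF ls] is_min_poly_exists l by metis
    qed
  qed
  then have "generator_choice (\<lambda>C. SOME \<alpha>. gen (insert \<alpha> base) \<in> (C :: 'k alg_closure set set))"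
    unfolding generator_choice_def using someI_ex by metis
  then show ?thesis by blast
qed

lemma act_smult: "act a b c d (smult r F) = smult r (act a b c d F)"
  by (rule poly_eqI) (simp add: act_def homogenize_def coeff_sum sum_distrib_left mult.assoc)

text \<open>The four elements \<open>1\<close>, \<alpha>, \<beta>, \<open>\<alpha> \<beta>\<close>
  lie in a space of dimension at most three, and a linear relation between them is a Moebius
  transformation; here the bound on the degree is essential. In degree two \<beta> is affine in
  \<alpha>; \<open>c = 0\<close> is recorded since it keeps infinity fixed.\<close>

lemma moebius_of_generators:
  assumes f: "is_min_poly f \<alpha>" and d: "degree f = 2 \<or> degree f = 3"
    and \<beta>: "\<beta> \<in> gen (insert \<alpha> base)" "\<beta> \<notin> base"
  obtains a b c d where "a * d - b * c \<noteq> 0" "to_ac c * \<alpha> + to_ac d \<noteq> 0"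
    "\<beta> * (to_ac c * \<alpha> + to_ac d) = to_ac a * \<alpha> + to_ac b" "degree f = 2 \<longrightarrow> c = 0"
proof -
  note result = that
  obtain q where q: "degree q < degree f" "\<beta> = poly (ac_poly q) \<alpha>" by (rule gen_base_elem[OF f \<beta>(1)])
  define b0 b1 b2 where b: "b0 = coeff q 0" "b1 = coeff q 1" "b2 = coeff q 2"
  have "q = [:b0, b1, b2:]"
    using q(1) d unfolding b by (intro poly_eqI) (auto simp: coeff_pCons coeff_eq_0 numeral_2_eq_2 split: nat.split)
  then have \<beta>e: "\<beta> = to_ac b0 + to_ac b1 * \<alpha> + to_ac b2 * \<alpha> ^ 2"
    using q(2) by (simp add: map_poly_pCons power2_eq_square algebra_simps)
  have b2: "degree f = 2 \<Longrightarrow> b2 = 0" using q(1) unfolding b by (simp add: coeff_eq_0)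
  have irr: "\<alpha> \<notin> base" using is_min_poly_degree_1(2)[OF f] d by auto
  have lin: "to_ac r * \<alpha> + to_ac s \<noteq> 0" if "r \<noteq> 0 \<or> s \<noteq> 0" for r s
  proof
    assume eq: "to_ac r * \<alpha> + to_ac s = 0"
    have "r \<noteq> 0" using that eq by auto
    then have "\<alpha> = to_ac (- s / r)" using eq by (simp add: field_simps eq_neg_iff_add_eq_0)
    then show False using irr by blast
  qed
  have nc: "b1 \<noteq> 0 \<or> b2 \<noteq> 0" using \<beta>(2) \<beta>e by auto
  have main: ?thesis if cd: "c \<noteq> 0 \<or> d' \<noteq> 0"
    and eq: "\<beta> * (to_ac c * \<alpha> + to_ac d') = to_ac a * \<alpha> + to_ac b'" and c0: "degree f = 2 \<longrightarrow> c = 0"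
    for a b' c d'
  proof -
    have n0: "to_ac c * \<alpha> + to_ac d' \<noteq> 0" by (rule lin[OF cd])
    have "a * d' - b' * c \<noteq> 0"
    proof
      assume det: "a * d' - b' * c = 0"
      have "\<beta> \<in> base"
      proof (cases "c = 0")
        case True
        then have "d' \<noteq> 0" "a = 0" using cd det by auto
        then have "\<beta> = to_ac (b' / d')" using eq True by (simp add: field_simps)
        then show ?thesis by blast
      next
        case False
        then have "b' = a * d' / c" using det by (simp add: field_simps)
        then have "to_ac a * \<alpha> + to_ac b' = to_ac (a / c) * (to_ac c * \<alpha> + to_ac d')"
          using False by (simp add: distrib_left)
        then have "\<beta> = to_ac (a / c)" using eq n0 by (metis mult_right_cancel)
        then show ?thesis by blast
      qed
      then show False using \<beta>(2) by blast
    qed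
    then show ?thesis using result n0 eq c0 by blast
  qed
  show ?thesis
  proof (cases "degree f = 2")
    case True
    then show ?thesis
      using main[of 0 1 b1 b0] \<beta>e b2 by simp
  next
    case False
    then have "degree f = 3" using d by simp
    define f0 f1 f2 where f012: "f0 = coeff f 0" "f1 = coeff f 1" "f2 = coeff f 2"
    have "coeff f 3 = 1" using is_min_polyD(1)[OF f] \<open>degree f = 3\<close> by simp
    then have "f = [:f0, f1, f2, 1:]"
      using degree_le_3_eq[of f] \<open>degree f = 3\<close> by (simp add: f012)
    then have f\<alpha>: "to_ac f0 + to_ac f1 * \<alpha> + to_ac f2 * \<alpha> ^ 2 + \<alpha> ^ 3 = 0"
      using is_min_polyD(2)[OF f] by (simp add: map_poly_pCons power2_eq_square power3_eq_cube algebra_simps)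
    \<comment> \<open>The value for which the terms in \<open>\<alpha> ^ 2\<close> of
      \<open>\<beta> (b2 \<alpha> + d)\<close> cancel after reducing \<open>\<alpha> ^ 3\<close>.
      For \<open>b2 = 0\<close> it is \<open>- b1\<close>, which is then nonzero.\<close>
    let ?d = "b2 * f2 - b1"
    have "b2 \<noteq> 0 \<or> ?d \<noteq> 0" using nc by auto
    moreover have "\<beta> * (to_ac b2 * \<alpha> + to_ac ?d) =
        to_ac (b2 * b0 - b2 * b2 * f1 + ?d * b1) * \<alpha> + to_ac (?d * b0 - b2 * b2 * f0)"
      unfolding \<beta>e to_ac_add to_ac_diff to_ac_mult using f\<alpha> by Groebner_Basis.algebra
    ultimately show ?thesis using main False by blast
  qed
qed

subsection \<open>Classification\<close>

abbreviation rat_var :: "'k::field ratfun_ac" where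
  "rat_var \<equiv> to_ac (to_fract [:0, 1:])"

lemma hom_on_const_emb: "hom_on UNIV (const_emb :: 'k::field \<Rightarrow> 'k ratfun_ac)"
proof -
  have "const_emb (a + b) = const_emb a + const_emb b" for a b :: 'k
    unfolding const_emb_def to_ac_add[symmetric] to_fract_add[symmetric] by simp
  moreover have "const_emb (a * b) = const_emb a * const_emb b" for a b :: 'k
    unfolding const_emb_def to_ac_mult[symmetric] to_fract_mult[symmetric] by simp
  moreover have "const_emb (1::'k) = 1"
    unfolding const_emb_def by (simp flip: one_pCons)
  ultimately show ?thesis by (simp add: hom_on_def)
qed

lemma ev_const_emb: "ev const_emb p rat_var = to_ac (to_fract p)"
proof (induction p)
  case 0
  then show ?case by simp
next
  case (pCons a p)
  have "pCons a p = [:a:] + [:0, 1:] * p" by simp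
  then have "to_ac (to_fract (pCons a p)) = const_emb a + rat_var * to_ac (to_fract p)"
    by (metis const_emb_def to_ac_add to_ac_mult to_fract_add to_fract_mult)
  then show ?case using pCons.IH by (simp add: ev_hom[OF hom_on_const_emb])
qed

lemma transcendental_rat_var: "transcendental_over const_emb rat_var"
  by (simp add: transcendental_over_def ev_const_emb)

text \<open>This identifies the base field of \<open>cbrt_extn\<close> with \<open>k(x)\<close>, as
  a presentation requires.\<close>

lemma range_to_ac_ratfun:
  "range (to_ac :: 'k::field poly fract \<Rightarrow> 'k ratfun_ac) = gen (insert rat_var (range const_emb))"
proof
  show "gen (insert rat_var (range const_emb)) \<subseteq> range (to_ac :: 'k poly fract \<Rightarrow> _)"
    by (rule gen_least[OF sfield_base]) (auto simp: const_emb_def)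
  show "range (to_ac :: 'k poly fract \<Rightarrow> _) \<subseteq> gen (insert rat_var (range const_emb))"
  proof clarify
    fix z :: "'k poly fract"
    obtain p q where "z = Fract p q" by (cases z)
    then have "to_ac z = ev const_emb p rat_var / ev const_emb q rat_var"
      by (simp add: Fract_conv_to_fract ev_const_emb)
    then show "to_ac z \<in> gen (insert rat_var (range const_emb))"
      using ev_mem_gen[OF hom_on_const_emb] sfield_divide[OF sfield_gen] by metis
  qed
qed

lemma defined_by_cube_presented:
  assumes "defined_by_cube M h"
  obtains y where "presented M h rat_var y"
proof -
  obtain y where y: "y ^ 3 = to_ac (to_fract h)" "M = cbrt_extn y"
    using assms by (auto simp: defined_by_cube_def)
  have "presented M h rat_var y"
    unfolding y(2) cbrt_extn_def
    using hom_on_const_emb transcendental_rat_var range_to_ac_ratfun y(1)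
    by (simp add: ev_const_emb)
  then show ?thesis by (rule that)
qed

lemma defined_by_cube_exists: "\<exists>M. defined_by_cube M h"
proof -
  obtain y where "y ^ 3 = to_ac (to_fract h)" using nth_root_exists[of 3 "to_ac (to_fract h)"] by auto
  then show ?thesis unfolding defined_by_cube_def by blast
qed

section \<open>Classes of constants modulo cubes, and twist polynomials\<close>

lemma equiv_cube_rel: "equiv {c::'k::field. c \<noteq> 0} cube_rel"
proof (rule equivI)
  let ?R = "cube_rel :: ('k \<times> 'k) set"
  show "?R \<subseteq> {c. c \<noteq> 0} \<times> {c. c \<noteq> 0}" by (auto simp: cube_rel_def)
  show "refl_on {c. c \<noteq> 0} ?R" by (auto simp: refl_on_def cube_rel_def intro!: exI[of _ 1])
  show "sym ?R"
  proof (rule symI)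
    fix c d :: 'k assume "(c, d) \<in> cube_rel"
    then obtain b where b: "c \<noteq> 0" "d \<noteq> 0" "b \<noteq> 0" "d = c * b ^ 3" by (auto simp: cube_rel_def)
    then have "c = d * inverse b ^ 3" by (simp add: power_inverse)
    then show "(d, c) \<in> cube_rel" unfolding cube_rel_def using b by (auto intro!: exI[of _ "inverse b"])
  qed
  show "trans ?R"
  proof (rule transI)
    fix c d f :: 'k assume "(c, d) \<in> cube_rel" "(d, f) \<in> cube_rel"
    then obtain a b where "c \<noteq> 0" "a \<noteq> 0" "d = c * a ^ 3" "f \<noteq> 0" "b \<noteq> 0" "f = d * b ^ 3"
      by (auto simp: cube_rel_def)
    then have "f = c * (a * b) ^ 3" "a * b \<noteq> 0" by (simp_all add: power_mult_distrib)
    then show "(c, f) \<in> cube_rel" using \<open>c \<noteq> 0\<close> \<open>f \<noteq> 0\<close> unfolding cube_rel_def by blast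
  qed
qed

lemma cube_class_nonzero: "D \<in> cube_classes \<Longrightarrow> c \<in> D \<Longrightarrow> c \<noteq> 0"
  using in_quotient_imp_subset[OF equiv_cube_rel] unfolding cube_classes_def by blast

lemma cube_class_nonempty: "D \<in> cube_classes \<Longrightarrow> \<exists>c. c \<in> D"
  using in_quotient_imp_non_empty[OF equiv_cube_rel] unfolding cube_classes_def by blast

lemma cube_class_rel:
  assumes "D \<in> cube_classes" "c \<in> D" "c' \<in> D"
  obtains b where "b \<noteq> 0" "c' = c * b ^ 3"
proof -
  have "(c, c') \<in> cube_rel"
    using in_quotient_imp_in_rel[OF equiv_cube_rel] assms unfolding cube_classes_def by blast
  then show ?thesis using that by (auto simp: cube_rel_def)
qed

lemma cube_class_eq:
  assumes "D \<in> cube_classes" "D' \<in> cube_classes" "c \<in> D" "c' \<in> D'" "b \<noteq> 0" "c' = c * b ^ 3"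
  shows "D = D'"
proof -
  have "(c, c') \<in> cube_rel"
    using assms cube_class_nonzero[OF assms(1,3)] cube_class_nonzero[OF assms(2,4)] by (auto simp: cube_rel_def)
  then show ?thesis
    using quotient_eqI[OF equiv_cube_rel] assms unfolding cube_classes_def by blast
qed

lemma cube_class_exists:
  assumes "c \<noteq> 0" obtains D where "D \<in> cube_classes" "c \<in> D"
proof -
  have "cube_rel `` {c} \<in> cube_classes" unfolding cube_classes_def using assms by (intro quotientI) simp
  moreover have "c \<in> cube_rel `` {c}" using equiv_class_self[OF equiv_cube_rel] assms by simp
  ultimately show ?thesis by (rule that)
qed

lemma ext_class_exists:
  assumes "l \<in> small_exts" obtains C where "C \<in> ext_classes" "l \<in> C"
proof -
  have "ext_iso_rel `` {l} \<in> ext_classes" unfolding ext_classes_def using assms by (intro quotientI)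
  moreover have "l \<in> ext_iso_rel `` {l}" using equiv_class_self[OF equiv_ext_iso_rel] assms by simp
  ultimately show ?thesis by (rule that)
qed

lemma gen_base: "gen base = base"
  by (rule antisym[OF gen_least[OF sfield_base order_refl] gen_superset])

lemma twist_poly_exists: obtains f where "twist_poly g C f"
proof (cases "base \<in> C")
  case True
  then show ?thesis using that[of split_form] by (simp only: twist_poly_def if_True)
next
  case False
  obtain f where "is_min_poly f (g C)" by (rule is_min_poly_exists)
  then show ?thesis using that[of f] False by (simp only: twist_poly_def if_False)
qed

lemma twist_poly_unique: "twist_poly g C f \<Longrightarrow> twist_poly g C h \<Longrightarrow> f = h"
  using is_min_poly_unique unfolding twist_poly_def by (auto split: if_splits)

lemma generator_choiceD:
  assumes "generator_choice g" "C \<in> ext_classes"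
  shows "gen (insert (g C) base) \<in> C"
  using assms by (auto simp: generator_choice_def)

lemma nontrivial_twist_poly:
  assumes g: "generator_choice g" and C: "C \<in> ext_classes" "base \<notin> C" and f: "twist_poly g C f"
  shows "is_min_poly f (g C)" "g C \<notin> base" "degree f = 2 \<or> degree f = 3"
proof -
  show m: "is_min_poly f (g C)" using f C(2) by (simp add: twist_poly_def)
  have G: "gen (insert (g C) base) \<in> C" by (rule generator_choiceD[OF g C(1)])
  show n: "g C \<notin> base"
  proof
    assume "g C \<in> base"
    then have "gen (insert (g C) base) = base"
      using gen_base by (simp add: insert_absorb)
    then show False using G C(2) by simp
  qed
  have "g C \<in> gen (insert (g C) base)" by (simp add: gen_incl)
  then show "degree f = 2 \<or> degree f = 3"
    using small_ext_generated(2)[OF ext_class_small[OF C(1) G] _ n m] by blast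
qed

lemma twist_poly_nondegenerate:
  fixes g :: "'k::field alg_closure set set \<Rightarrow> 'k alg_closure"
  assumes "perfect_field TYPE('k)" "generator_choice g" "C \<in> ext_classes" "twist_poly g C f"
  shows "nondegenerate f"
proof (cases "base \<in> C")
  case True
  then show ?thesis using assms(4) nondegenerate_split_form by (simp add: twist_poly_def)
next
  case False
  then show ?thesis
    using is_min_poly_nondegenerate[OF assms(1)] nontrivial_twist_poly[OF assms(2,3) False assms(4)] by blast
qed

text \<open>A matrix over \<open>k\<close> cannot relate an irrational root to infinity, so the
  inverse Moebius transform of \<alpha> is a finite root of the other form; both generate the same
  field over \<open>k\<close>.\<close>

lemma form_equiv_irrational_root:
  assumes eq: "act a b c d F = smult m G" "m \<noteq> 0" and det: "a * d - b * c \<noteq> 0" and F: "degree F \<le> 3"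
    and \<alpha>: "poly (ac_poly F) \<alpha> = 0" "\<alpha> \<notin> base"
  obtains z where "z \<notin> base" "gen (insert z base) = gen (insert \<alpha> base)" "poly (ac_poly G) z = 0"
proof -
  define n where "n = to_ac a - to_ac c * \<alpha>"
  have n0: "n \<noteq> 0"
  proof
    assume eq0: "n = 0"
    have "c \<noteq> 0" using eq0 det by (auto simp: n_def)
    then have "\<alpha> = to_ac (a / c)" using eq0 by (simp add: n_def field_simps)
    then show False using \<alpha>(2) by blast
  qed
  define z where "z = (to_ac d * \<alpha> - to_ac b) / n"
  have detu: "to_ac a * to_ac d - to_ac b * to_ac c \<noteq> 0"
    using det by (simp flip: to_ac_mult to_ac_diff)
  have D1: "to_ac c * z + to_ac d = (to_ac a * to_ac d - to_ac b * to_ac c) / n"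
    using n0 unfolding z_def n_def by (simp add: field_simps)
  have D0: "to_ac c * z + to_ac d \<noteq> 0" using D1 detu n0 by simp
  have \<alpha>z: "\<alpha> * (to_ac c * z + to_ac d) = to_ac a * z + to_ac b"
    unfolding D1 using n0 unfolding z_def n_def by (simp add: field_simps)
  have "ev to_ac (act a b c d F) z = 0"
    using ev_act[OF hom_on_to_ac F D0 \<alpha>z] \<alpha>(1) by simp
  then have "poly (ac_poly G) z = 0" using eq by (simp add: map_poly_to_ac)
  moreover have "gen (insert z base) = gen (insert \<alpha> base)"
  proof (rule gen_insert_eq)
    show "z \<in> gen (insert \<alpha> base)"
      unfolding z_def n_def by (intro sfield_intros[OF sfield_gen] gen_incl) auto
    have "\<alpha> = (to_ac a * z + to_ac b) / (to_ac c * z + to_ac d)" using \<alpha>z D0 by (metis nonzero_eq_divide_eq)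
    moreover have "\<dots> \<in> gen (insert z base)"
      by (intro sfield_intros[OF sfield_gen] gen_incl) auto
    ultimately show "\<alpha> \<in> gen (insert z base)" by simp
  qed
  moreover have "z \<notin> base"
  proof
    assume "z \<in> base"
    then have "gen (insert z base) \<subseteq> base" by (intro gen_least[OF sfield_base]) auto
    then show False using \<open>gen (insert z base) = gen (insert \<alpha> base)\<close> gen_incl[of \<alpha> "insert \<alpha> base"] \<alpha>(2) by auto
  qed
  ultimately show ?thesis using that by blast
qed

lemma split_form_roots: "poly (ac_poly split_form) z = 0 \<Longrightarrow> z \<in> base"
proof -
  assume "poly (ac_poly split_form) z = 0"
  then have "z = 0 \<or> z = 1" using ev_split_form[OF hom_on_to_ac, of z] by simp
  then show "z \<in> base" using sfield_0[OF sfield_base] sfield_1[OF sfield_base] by auto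
qed

text \<open>The root \<open>g C\<close> of \<open>f\<close> is moved to an irrational root of
  \<open>f'\<close> with the same field. The split form has only rational roots, so
  \<open>C'\<close> is nontrivial and \<open>f'\<close> is the minimal polynomial of that root;
  conjugate generators give isomorphic fields.\<close>

lemma twist_form_equiv_class:
  assumes g: "generator_choice g" and C: "C \<in> ext_classes" "C' \<in> ext_classes" "base \<notin> C"
    and f: "twist_poly g C f" "twist_poly g C' f'" and r: "r \<noteq> 0" "r' \<noteq> 0"
    and eq: "form_equiv (smult r f) (smult r' f')"
  shows "C = C'"
proof -
  note N = nontrivial_twist_poly[OF g C(1,3) f(1)]
  obtain a b c d l where m: "a * d - b * c \<noteq> 0" "l \<noteq> 0" "act a b c d (smult r f) = smult (l ^ 3) (smult r' f')"
    using eq unfolding form_equiv_def by blast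
  then have m3: "act a b c d (smult r f) = smult (l ^ 3 * r') f'" by simp
  have "poly (ac_poly (smult r f)) (g C) = 0" using is_min_polyD(2)[OF N(1)] by (simp add: map_poly_to_ac)
  moreover have "degree (smult r f) \<le> 3" using N(3) by auto
  moreover have "l ^ 3 * r' \<noteq> 0" using m(2) r(2) by simp
  ultimately obtain z where z: "z \<notin> base" "gen (insert z base) = gen (insert (g C) base)" "poly (ac_poly f') z = 0"
    using form_equiv_irrational_root[OF m3 _ m(1) _ _ N(2)] by blast
  have C': "base \<notin> C'"
  proof
    assume "base \<in> C'"
    then have "f' = split_form" using f(2) by (simp only: twist_poly_def if_True)
    then show False using z(1,3) split_form_roots by blast
  qed
  note N' = nontrivial_twist_poly[OF g C(2) C' f(2)]
  have "is_min_poly f' z" by (rule is_min_poly_conjugate[OF N'(1) z(3)])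
  then have "(gen (insert z base), gen (insert (g C') base)) \<in> ext_iso_rel"
    using conjugate_ext_iso[OF _ N'(1)] N'(3) by auto
  then show ?thesis
    using ext_class_eq[OF C(1,2)] generator_choiceD[OF g C(1)] generator_choiceD[OF g C(2)] z(2) by simp
qed

text \<open>Comparing discriminants: \<open>det\<^sup>6 = m\<^sup>4\<close>, so \<open>m = (det\<^sup>2 / m)\<^sup>3\<close> is a cube.\<close>

lemma form_equiv_smult_cube_class:
  assumes f: "nondegenerate f" and r: "r \<noteq> 0" "r' \<noteq> 0" and eq: "form_equiv (smult r f) (smult r' f)"
  obtains b where "b \<noteq> 0" "r' = r * b ^ 3"
proof -
  obtain a b c d l where m: "a * d - b * c \<noteq> 0" "l \<noteq> 0" "act a b c d (smult r f) = smult (l ^ 3) (smult r' f)"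
    using eq unfolding form_equiv_def by blast
  define n where "n = l ^ 3 * r' / r"
  have n0: "n \<noteq> 0" using m(2) r by (simp add: n_def)
  have "smult r (act a b c d f) = smult r (smult n f)"
    using m(3) r by (simp add: act_smult n_def)
  then have "smult (inverse r) (smult r (act a b c d f)) = smult (inverse r) (smult r (smult n f))" by simp
  then have "act a b c d f = smult n f" using r(1) by (simp flip: mult.assoc)
  then have "(a * d - b * c) ^ 6 * form_disc f = n ^ 4 * form_disc f"
    using form_disc_act[OF nondegenerate_degree(2)[OF f]] form_disc_smult by metis
  then have n4: "(a * d - b * c) ^ 6 = n ^ 4" using f by (simp add: nondegenerate_def)
  \<comment> \<open>\<open>n\<close> is the multiplier in the discriminant comparison, so the cube
    of \<open>det ^ 2 / n\<close> is \<open>n\<close>; dividing by \<open>l\<close> removes the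
    factor \<open>l ^ 3\<close> from \<open>n = l ^ 3 * r' / r\<close>.\<close>
  define q where "q = (a * d - b * c) ^ 2 / n / l"
  have "((a * d - b * c) ^ 2) ^ 3 = n ^ 4" using n4 by (simp flip: power_mult)
  then have "(l * q) ^ 3 = n"
    using m(2) n0 by (simp add: q_def power_divide) (simp add: power_numeral_reduce)
  then have "l ^ 3 * q ^ 3 * r = l ^ 3 * r'" using r(1) by (simp add: n_def power_mult_distrib)
  then have "r' = r * q ^ 3" using m(2) by (simp add: mult.commute)
  moreover have "q \<noteq> 0" using m n0 by (simp add: q_def)
  ultimately show ?thesis using that by blast
qed

text \<open>A relation, because neither the representative \<open>c\<close> nor the cube root that
  defines the extension is canonical; \<open>twist_models_bi_isomorphic\<close> shows that these
  choices do not matter.\<close>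

definition twist_model ::
    "('k::field alg_closure set set \<Rightarrow> 'k alg_closure) \<Rightarrow> 'k alg_closure set set \<Rightarrow> 'k set \<Rightarrow>
      ('k, 'k ratfun_ac) extn \<Rightarrow> bool" where
  "twist_model g C D M \<longleftrightarrow> (\<exists>c\<in>D. \<exists>f. twist_poly g C f \<and> defined_by_cube M (smult c f))"

lemma twist_model_exists:
  assumes "D \<in> cube_classes" shows "\<exists>M. twist_model g C D M"
proof -
  obtain f where "twist_poly g C f" by (rule twist_poly_exists)
  then show ?thesis
    using cube_class_nonempty[OF assms] defined_by_cube_exists unfolding twist_model_def by metis
qed

section \<open>The classification for a fixed choice of generators\<close>

context
  fixes g :: "'k::field alg_closure set set \<Rightarrow> 'k alg_closure"
  assumes perf: "perfect_field TYPE('k)" and char: "CHAR('k) \<noteq> 3" and g: "generator_choice g"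
begin

lemma twist_model_presented:
  assumes C: "C \<in> ext_classes" and D: "D \<in> cube_classes" and M: "twist_model g C D M"
  obtains c f y where "c \<in> D" "c \<noteq> 0" "twist_poly g C f" "nondegenerate f" "presented M (smult c f) rat_var y"
proof -
  obtain c f where cf: "c \<in> D" "twist_poly g C f" "defined_by_cube M (smult c f)"
    using M unfolding twist_model_def by blast
  obtain y where "presented M (smult c f) rat_var y" by (rule defined_by_cube_presented[OF cf(3)])
  then show ?thesis
    using that cf(1,2) cube_class_nonzero[OF D cf(1)] twist_poly_nondegenerate[OF perf g C cf(2)] by blast
qed

lemma twist_models_bi_isomorphic:
  assumes C: "C \<in> ext_classes" and D: "D \<in> cube_classes"
    and M: "twist_model g C D M" "twist_model g C D M'"
  shows "bi_isomorphic M M'"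
proof -
  obtain c f y where m: "c \<in> D" "c \<noteq> 0" "twist_poly g C f" "nondegenerate f" "presented M (smult c f) rat_var y"
    by (rule twist_model_presented[OF C D M(1)])
  obtain c' f' y' where m': "c' \<in> D" "c' \<noteq> 0" "twist_poly g C f'" "nondegenerate f'" "presented M' (smult c' f') rat_var y'"
    by (rule twist_model_presented[OF C D M(2)])
  have ff: "f' = f" using twist_poly_unique m(3) m'(3) by blast
  obtain b where b: "b \<noteq> 0" "c = c' * b ^ 3" by (rule cube_class_rel[OF D m'(1) m(1)])
  have "form_equiv (smult (b ^ 3) (smult c' f)) (smult c' f)"
    using form_equiv_smult_cube[OF nondegenerate_smult[OF m'(2) m(4)] b(1)] .
  moreover have "smult (b ^ 3) (smult c' f) = smult c f" using b(2) by (simp add: mult.commute)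
  ultimately show ?thesis
    using presented_form_equiv_iff[OF char m(5) m'(5)] nondegenerate_smult m m' ff by metis
qed

lemma twist_models_distinct:
  assumes C: "C \<in> ext_classes" "C' \<in> ext_classes" and D: "D \<in> cube_classes" "D' \<in> cube_classes"
    and M: "twist_model g C D M" "twist_model g C' D' M'" and iso: "bi_isomorphic M M'"
  shows "C = C' \<and> D = D'"
proof -
  obtain c f y where m: "c \<in> D" "c \<noteq> 0" "twist_poly g C f" "nondegenerate f" "presented M (smult c f) rat_var y"
    by (rule twist_model_presented[OF C(1) D(1) M(1)])
  obtain c' f' y' where m': "c' \<in> D'" "c' \<noteq> 0" "twist_poly g C' f'" "nondegenerate f'" "presented M' (smult c' f') rat_var y'"
    by (rule twist_model_presented[OF C(2) D(2) M(2)])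
  have gs: "nondegenerate (smult c f)" "nondegenerate (smult c' f')" using nondegenerate_smult m m' by auto
  have eq: "form_equiv (smult c f) (smult c' f')"
    using presented_form_equiv_iff[OF char m(5) m'(5) gs] iso by simp
  have eq': "form_equiv (smult c' f') (smult c f)"
    using presented_form_equiv_iff[OF char m'(5) m(5) gs(2,1)] bi_isomorphic_sym[OF iso presented_wf[OF m(5)]] by simp
  have CC: "C = C'"
  proof (cases "base \<in> C")
    case False
    then show ?thesis using twist_form_equiv_class[OF g C False m(3) m'(3) m(2) m'(2) eq] by simp
  next
    case True
    show ?thesis
    proof (cases "base \<in> C'")
      case False
      then show ?thesis using twist_form_equiv_class[OF g C(2,1) False m'(3) m(3) m'(2) m(2) eq'] by simp
    next
      case b': True
      show ?thesis by (rule ext_class_eq[OF C True b' ext_class_iso[OF C(1) True True]])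
    qed
  qed
  then have "f' = f" using twist_poly_unique m(3) m'(3) by blast
  then obtain b where "b \<noteq> 0" "c' = c * b ^ 3"
    using form_equiv_smult_cube_class[OF m(4,2) m'(2)] eq by metis
  then have "D = D'" using cube_class_eq[OF D m(1) m'(1)] by blast
  then show ?thesis using CC by simp
qed

text \<open>Without a rational root \<open>F\<close> is a multiple of the minimal polynomial
  \<open>h\<close> of a root \<alpha>. The chosen generator has a conjugate in the field of
  \<alpha>, and the Moebius transformation between the two turns the twist polynomial into one
  divisible by \<open>h\<close>; a comparison of degrees makes it a multiple.\<close>

lemma irreducible_form_model:
  assumes F: "nondegenerate F" and nr: "\<And>r. poly F r \<noteq> 0"
  obtains C f c where "C \<in> ext_classes" "twist_poly g C f" "c \<noteq> 0" "form_equiv (smult c f) F"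
proof -
  obtain \<alpha> where \<alpha>: "poly (ac_poly F) \<alpha> = 0"
    using alg_closed_imp_poly_has_root[of "ac_poly F"] nondegenerate_degree(1)[OF F] by (auto simp: map_poly_to_ac)
  obtain h where h: "is_min_poly h \<alpha>" by (rule is_min_poly_exists)
  have irr: "\<alpha> \<notin> base"
  proof
    assume "\<alpha> \<in> base"
    then obtain r where "\<alpha> = to_ac r" by auto
    then have "to_ac (poly F r) = 0" using \<alpha> ev_const[OF hom_on_to_ac, of F r] by metis
    then show False using nr by simp
  qed
  obtain s where s: "F = h * s" using is_min_poly_dvd[OF h \<alpha>] by (rule dvdE)
  have nz: "h \<noteq> 0" "s \<noteq> 0" using nondegenerate_degree(3)[OF F] s by auto
  have deg: "degree F = degree h + degree s" unfolding s using nz by (rule degree_mult_eq)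
  have h2: "degree h \<ge> 2" using is_min_poly_degree_1[OF h] irr by linarith
  have "degree s \<noteq> 1"
  proof
    assume "degree s = 1"
    then have se: "s = [:coeff s 0, coeff s 1:]"
      by (intro poly_eqI) (auto simp: coeff_pCons coeff_eq_0 split: nat.split)
    have s1: "coeff s 1 \<noteq> 0" using \<open>degree s = 1\<close> nz(2) by (metis leading_coeff_0_iff)
    have "poly s (- coeff s 0 / coeff s 1) = 0" by (subst se) (use s1 in simp)
    then show False using nr s by (metis mult_zero_right poly_mult)
  qed
  then have "degree s = 0" using deg h2 nondegenerate_degree(2)[OF F] by linarith
  then obtain u where u: "s = [:u:]" using degree_eq_zeroE by blast
  have u0: "u \<noteq> 0" using nz u by auto
  have Fh: "F = smult u h" using s u by simp
  have dh: "degree h = 2 \<or> degree h = 3"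
    using deg \<open>degree s = 0\<close> nondegenerate_degree[OF F] by linarith
  let ?l = "gen (insert \<alpha> base)"
  have ls: "?l \<in> small_exts" using gen_base_small[OF h] dh by auto
  obtain C where C: "C \<in> ext_classes" "?l \<in> C" by (rule ext_class_exists[OF ls])
  have bC: "base \<notin> C"
  proof
    assume "base \<in> C"
    then have "?l = base" using ext_iso_base ext_class_iso[OF C(1) _ C(2)] by blast
    then show False using irr gen_incl[of \<alpha> "insert \<alpha> base"] by auto
  qed
  obtain f where f: "twist_poly g C f" by (rule twist_poly_exists)
  note N = nontrivial_twist_poly[OF g C(1) bC f]
  obtain \<beta> where \<beta>: "is_min_poly f \<beta>" "?l = gen (insert \<beta> base)"
    by (rule ext_iso_generator[OF ext_class_iso[OF C(1) generator_choiceD[OF g C(1)] C(2)] N(1)])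
  have "\<beta> \<in> ?l" using \<beta>(2) gen_incl[of \<beta> "insert \<beta> base"] by simp
  moreover have \<beta>b: "\<beta> \<notin> base" using is_min_poly_degree_1(2)[OF \<beta>(1)] N(3) by auto
  ultimately obtain a b c d where m: "a * d - b * c \<noteq> 0" "to_ac c * \<alpha> + to_ac d \<noteq> 0"
    "\<beta> * (to_ac c * \<alpha> + to_ac d) = to_ac a * \<alpha> + to_ac b" "degree h = 2 \<longrightarrow> c = 0"
    using moebius_of_generators[OF h dh] by metis
  have gf: "nondegenerate f" by (rule twist_poly_nondegenerate[OF perf g C(1) f])
  define P where "P = act a b c d f"
  have gP: "nondegenerate P" unfolding P_def by (rule nondegenerate_act[OF gf m(1)])
  have "poly (ac_poly P) \<alpha> = 0"
    unfolding P_def using ev_act[OF hom_on_to_ac nondegenerate_degree(2)[OF gf] m(2,3)] is_min_polyD(2)[OF \<beta>(1)] by simp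
  then obtain v where v: "P = h * v" using is_min_poly_dvd[OF h] by (metis dvdE)
  have v0: "v \<noteq> 0" using v nondegenerate_degree(3)[OF gP] by auto
  have dv: "degree P = degree h + degree v" unfolding v using nz(1) v0 by (rule degree_mult_eq)
  \<comment> \<open>In the quadratic case a form of degree three would leave room for a linear
    cofactor; \<open>c = 0\<close> prevents this by keeping the root at infinity.\<close>
  have "degree v = 0"
  proof (cases "degree h = 2")
    case True
    have "degree f = degree h"
    proof -
      have "is_min_poly f \<beta>" "\<beta> \<in> ?l" using \<beta>(1) \<open>\<beta> \<in> ?l\<close> by auto
      interpret R: Ring.ring "amb :: 'k alg_closure ring" by (rule ring_amb)
      have "R.dimension (degree f) base ?l" "R.dimension (degree h) base ?l"
        using dimension_simple_extension[OF sfield_base \<beta>(1)[unfolded is_min_poly_iff]] \<beta>(2)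
          dimension_simple_extension[OF sfield_base h[unfolded is_min_poly_iff]]
        by (simp_all add: map_poly_to_ac)
      then show ?thesis using dimension_mono[OF sfield_base] by (meson le_antisym order_refl)
    qed
    then have "degree f = 2" using True by simp
    then have "coeff f 3 = 0" by (simp add: coeff_eq_0)
    then have "f = [:coeff f 0, coeff f 1, coeff f 2, 0:]" using degree_le_3_eq[OF nondegenerate_degree(2)[OF gf]] by simp
    then have "coeff P 3 = 0"
      using act_pCons[of a b c d "coeff f 0" "coeff f 1" "coeff f 2" 0] m(4) True
      unfolding P_def by (simp add: coeff_pCons numeral_2_eq_2 numeral_3_eq_3)
    then have "degree P \<noteq> 3" using nondegenerate_degree(3)[OF gP] by (metis leading_coeff_0_iff)
    then show ?thesis using dv True nondegenerate_degree(2)[OF gP] by linarith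
  next
    case False
    then show ?thesis using dv dh nondegenerate_degree(2)[OF gP] by linarith
  qed
  then obtain w where w: "v = [:w:]" using degree_eq_zeroE by blast
  have w0: "w \<noteq> 0" using v0 w by auto
  have "P = smult w h" using v w by simp
  \<comment> \<open>\<open>u / w\<close> compares \<open>F = u h\<close> with the transformed twist
    polynomial \<open>P = w h\<close>.\<close>
  then have "act a b c d (smult (u / w) f) = smult (1 ^ 3) F"
    using w0 by (simp add: act_smult P_def[symmetric] Fh)
  then have "form_equiv (smult (u / w) f) F"
    unfolding form_equiv_def using m(1) by (metis one_neq_zero)
  moreover have "u / w \<noteq> 0" using u0 w0 by simp
  ultimately show ?thesis using that C(1) f by blast
qed

text \<open>A rational root is moved to infinity, which leaves a quadratic polynomial that either
  splits or is irreducible; a form without rational root is irreducible from the start.\<close>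

lemma presented_twist_model:
  fixes M :: "('k, 'u::field) extn"
  assumes p: "presented M F x y" and F: "nondegenerate F"
  obtains C D M' where "C \<in> ext_classes" "D \<in> cube_classes" "twist_model g C D M'" "bi_isomorphic M M'"
proof -
  note result = that
  obtain e K L where M: "M = (e, K, L)" by (metis prod_cases3)
  have fin: ?thesis
    if C: "C \<in> ext_classes" and f: "twist_poly g C f" and c: "c \<noteq> 0"
      and G: "nondegenerate G" "presented M G x1 y1" and eq: "form_equiv (smult c f) G"
    for C :: "'k alg_closure set set" and f c G x1 y1
  proof -
    obtain D where D: "D \<in> cube_classes" "c \<in> D" by (rule cube_class_exists[OF c])
    obtain M' where M': "defined_by_cube M' (smult c f)" using defined_by_cube_exists by blast
    obtain y' where y': "presented M' (smult c f) rat_var y'" by (rule defined_by_cube_presented[OF M'])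
    have "nondegenerate (smult c f)" using nondegenerate_smult[OF c twist_poly_nondegenerate[OF perf g C f]] .
    then have "bi_isomorphic M' M" using presented_form_equiv_iff[OF char y' G(2)] eq G(1) by simp
    then have "bi_isomorphic M M'" by (rule bi_isomorphic_sym[OF _ presented_wf[OF y']])
    moreover have "twist_model g C D M'" unfolding twist_model_def using D(2) f M' by blast
    ultimately show ?thesis using result C D(1) by blast
  qed
  have deg2: ?thesis if G: "nondegenerate G" "degree G = 2" "presented M G x1 y1" for G x1 y1
  proof (cases "\<exists>r. poly G r = 0")
    case True
    then obtain r where r: "poly G r = 0" by blast
    obtain c where c: "c \<noteq> 0" "form_equiv G (smult c split_form)" by (rule form_equiv_split[OF G(1,2) r])
    obtain x2 y2 where p2: "presented M (smult c split_form) x2 y2"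
      using presented_form_equiv[of e K L G x1 y1] G(1,3) c(2) M by metis
    obtain C :: "'k alg_closure set set" where C: "C \<in> ext_classes" "base \<in> C"
      by (rule ext_class_exists[OF base_small])
    have f: "twist_poly g C split_form" using C(2) by (simp add: twist_poly_def)
    have gs: "nondegenerate (smult c (split_form :: 'k poly))" by (rule nondegenerate_smult[OF c(1) nondegenerate_split_form])
    have "form_equiv (smult c split_form) (smult c (split_form :: 'k poly))"
      using form_equiv_smult_cube[OF gs, of 1] by simp
    then show ?thesis using fin[OF C(1) f c(1) gs p2] by blast
  next
    case False
    then obtain C f c where "C \<in> ext_classes" "twist_poly g C f" "c \<noteq> 0" "form_equiv (smult c f) G"
      using irreducible_form_model[OF G(1)] by metis
    then show ?thesis using fin G(1,3) by blast
  qed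
  show ?thesis
  proof (cases "\<exists>r. poly F r = 0")
    case True
    then obtain r where r: "poly F r = 0" by blast
    obtain G where G: "nondegenerate G" "degree G = 2" "form_equiv F G" by (rule form_equiv_root_to_infinity[OF F r])
    obtain x1 y1 where "presented M G x1 y1" using presented_form_equiv[of e K L F x y G] p F G(3) M by metis
    then show ?thesis using deg2 G by blast
  next
    case False
    then obtain C f c where "C \<in> ext_classes" "twist_poly g C f" "c \<noteq> 0" "form_equiv (smult c f) F"
      using irreducible_form_model[OF F] by metis
    then show ?thesis using fin F p by blast
  qed
qed

text \<open>\<open>\<Phi>\<close> sends a pair to the class of an arbitrarily chosen model.
  Independence of the choice, injectivity and surjectivity are
  \<open>twist_models_bi_isomorphic\<close>, \<open>twist_models_distinct\<close> and
  \<open>presented_twist_model\<close>.\<close>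

lemma twist_classification:
  fixes M0 :: "('k, 'k ratfun_ac) extn"
  assumes p0: "presented M0 split_form x0 y0"
  shows "\<exists>\<Phi>. bij_betw \<Phi> (ext_classes \<times> cube_classes)
      ((bi_twists M0 :: ('k, 'k ratfun_ac) extn set) // bi_iso_rel M0) \<and>
    (\<forall>C\<in>ext_classes. \<forall>D\<in>cube_classes. \<forall>M. twist_model g C D M \<longrightarrow> M \<in> \<Phi> (C, D))"
proof -
  let ?T = "bi_twists M0 :: ('k, 'k ratfun_ac) extn set"
  have twist_wf: "wf_extn M" if "M \<in> ?T" for M
    using that cubic_extension_wf[of M] unfolding bi_twists_def bi_twist_def by blast
  have eqv: "equiv ?T (bi_iso_rel M0)"
  proof (rule equivI)
    let ?R = "bi_iso_rel M0 :: (('k, 'k ratfun_ac) extn \<times> ('k, 'k ratfun_ac) extn) set"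
    show "?R \<subseteq> ?T \<times> ?T" by (auto simp: bi_iso_rel_def)
    show "refl_on ?T ?R"
    proof (rule refl_onI)
      fix M assume M: "M \<in> ?T"
      then have "bi_twist M M0" by (simp add: bi_twists_def)
      then obtain F x y where "nondegenerate F" "presented M F x y" by (rule bi_twist_presented[OF perf char p0])
      then have "bi_isomorphic M M" using presented_bi_isomorphic by (metis prod_cases3)
      then show "(M, M) \<in> ?R" using M by (simp add: bi_iso_rel_def)
    qed
    show "sym ?R" by (rule symI) (auto simp: bi_iso_rel_def simp del: bi_isomorphic.simps intro: bi_isomorphic_sym twist_wf)
    show "trans ?R" by (rule transI) (auto simp: bi_iso_rel_def simp del: bi_isomorphic.simps intro: bi_isomorphic_trans twist_wf)
  qed
  have model_twist: "M \<in> ?T" if m: "C \<in> ext_classes" "D \<in> cube_classes" "twist_model g C D M" for C D M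
  proof -
    obtain c f y where "c \<noteq> 0" "nondegenerate f" "presented M (smult c f) rat_var y"
      using twist_model_presented[OF m] by metis
    then have "bi_twist M M0" using presented_bi_twist[OF _ nondegenerate_smult p0] by blast
    then show ?thesis by (simp add: bi_twists_def)
  qed
  define rep where "rep = (\<lambda>(C, D). SOME M. twist_model g C D M)"
  have rep: "twist_model g C D (rep (C, D))" if "D \<in> cube_classes" for C D
    unfolding rep_def using someI_ex[OF twist_model_exists[OF that]] by simp
  define \<Phi> where "\<Phi> CD = bi_iso_rel M0 `` {rep CD}" for CD
  have mem: "M \<in> \<Phi> (C, D)" if C: "C \<in> ext_classes" and D: "D \<in> cube_classes" and M: "twist_model g C D M" for C D M
    unfolding \<Phi>_def bi_iso_rel_def
    using model_twist[OF C D M] model_twist[OF C D rep[OF D]] twist_models_bi_isomorphic[OF C D rep[OF D] M]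
    by blast
  have "bij_betw \<Phi> (ext_classes \<times> cube_classes) (?T // bi_iso_rel M0)"
    unfolding bij_betw_def
  proof
    show "inj_on \<Phi> (ext_classes \<times> cube_classes)"
    proof (rule inj_onI, clarify)
      fix C D C' D'
      assume C: "C \<in> ext_classes" "C' \<in> ext_classes" and D: "D \<in> cube_classes" "D' \<in> cube_classes"
        and eq: "\<Phi> (C, D) = \<Phi> (C', D')"
      have "rep (C', D') \<in> \<Phi> (C, D)" unfolding eq by (rule mem[OF C(2) D(2) rep[OF D(2)]])
      then have "bi_isomorphic (rep (C, D)) (rep (C', D'))" by (auto simp: \<Phi>_def bi_iso_rel_def simp del: bi_isomorphic.simps)
      then show "C = C' \<and> D = D'"
        using twist_models_distinct[OF C D rep[OF D(1)] rep[OF D(2)]] by blast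
    qed
    show "\<Phi> ` (ext_classes \<times> cube_classes) = ?T // bi_iso_rel M0"
    proof
      show "\<Phi> ` (ext_classes \<times> cube_classes) \<subseteq> ?T // bi_iso_rel M0"
        unfolding \<Phi>_def by (auto intro!: quotientI model_twist[OF _ _ rep])
      show "?T // bi_iso_rel M0 \<subseteq> \<Phi> ` (ext_classes \<times> cube_classes)"
      proof
        fix A assume "A \<in> ?T // bi_iso_rel M0"
        then obtain M where M: "M \<in> ?T" "A = bi_iso_rel M0 `` {M}" by (auto elim: quotientE)
        have "bi_twist M M0" using M(1) by (simp add: bi_twists_def)
        then obtain F x y where p: "nondegenerate F" "presented M F x y" by (rule bi_twist_presented[OF perf char p0])
        obtain C D M' where C: "C \<in> ext_classes" "D \<in> cube_classes" "twist_model g C D M'" "bi_isomorphic M M'"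
          by (rule presented_twist_model[OF p(2,1)])
        have "(M, M') \<in> bi_iso_rel M0"
          using M(1) C(4) model_twist[OF C(1-3)] by (simp add: bi_iso_rel_def del: bi_isomorphic.simps)
        moreover have "(rep (C, D), M') \<in> bi_iso_rel M0" using mem[OF C(1-3)] by (simp add: \<Phi>_def)
        ultimately have "A = \<Phi> (C, D)"
          unfolding M(2) \<Phi>_def by (metis equiv_class_eq[OF eqv])
        then show "A \<in> \<Phi> ` (ext_classes \<times> cube_classes)" using C(1,2) by blast
      qed
    qed
  qed
  then show ?thesis using mem by blast
qed

end

theorem theorem3p8:
  fixes M0 :: "('k::field, 'k ratfun_ac) extn"
  assumes "perfect_field TYPE('k)" and "CHAR('k) \<noteq> 3"
    and "defined_by_cube M0 ([:0, 1:] * [:-1, 1:])"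
  shows "(\<exists>g :: 'k alg_closure set set \<Rightarrow> 'k alg_closure. generator_choice g) \<and>
    (\<forall>g :: 'k alg_closure set set \<Rightarrow> 'k alg_closure. generator_choice g \<longrightarrow>
      (\<exists>\<Phi>. bij_betw \<Phi> (ext_classes \<times> cube_classes)
               ((bi_twists M0 :: ('k, 'k ratfun_ac) extn set) // bi_iso_rel M0) \<and>
        (\<forall>C\<in>ext_classes. \<forall>D\<in>cube_classes. \<forall>c\<in>D. \<forall>f M.
           twist_poly g C f \<and> defined_by_cube M (smult c f) \<longrightarrow> M \<in> \<Phi> (C, D)))) \<and>
    (\<forall>M :: ('k, 'u::field) extn. bi_twist M M0 \<longrightarrow>
      (\<exists>M' :: ('k, 'k ratfun_ac) extn. bi_twist M' M0 \<and> bi_isomorphic M M') \<and>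
      purely_cubic M \<and>
      (is_galois M \<longleftrightarrow> (\<exists>\<zeta>::'k. \<zeta> ^ 3 = 1 \<and> \<zeta> \<noteq> 1)))"
proof (intro conjI allI impI)
  show "\<exists>g :: 'k alg_closure set set \<Rightarrow> 'k alg_closure. generator_choice g"
    by (rule generator_choice_exists)
next
  fix g :: "'k alg_closure set set \<Rightarrow> 'k alg_closure"
  assume g: "generator_choice g"
  obtain y0 where "presented M0 split_form rat_var y0" by (rule defined_by_cube_presented[OF assms(3)])
  from twist_classification[OF assms(1,2) g this]
  show "\<exists>\<Phi>. bij_betw \<Phi> (ext_classes \<times> cube_classes)
               ((bi_twists M0 :: ('k, 'k ratfun_ac) extn set) // bi_iso_rel M0) \<and>
        (\<forall>C\<in>ext_classes. \<forall>D\<in>cube_classes. \<forall>c\<in>D. \<forall>f M.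
           twist_poly g C f \<and> defined_by_cube M (smult c f) \<longrightarrow> M \<in> \<Phi> (C, D))"
    unfolding twist_model_def by blast
next
  fix M :: "('k, 'u) extn" assume tw: "bi_twist M M0"
  obtain y0 where p0: "presented M0 split_form rat_var y0" by (rule defined_by_cube_presented[OF assms(3)])
  obtain F x y where F: "nondegenerate F" "presented M F x y" by (rule bi_twist_presented[OF assms(1,2) p0 tw])
  obtain e K L where M: "M = (e, K, L)" by (metis prod_cases3)
  \<comment> \<open>The form \<open>F\<close> that presents \<open>M\<close> also defines an
    extension \<open>y ^ 3 = F(x)\<close> inside the fixed universe, so restricting the quotient to
    that universe loses no class.\<close>
  obtain M' :: "('k, 'k ratfun_ac) extn" where M': "defined_by_cube M' F" using defined_by_cube_exists by blast
  obtain y' where y': "presented M' F rat_var y'" by (rule defined_by_cube_presented[OF M'])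
  obtain e' K' L' where M'e: "M' = (e', K', L')" by (metis prod_cases3)
  have "bi_isomorphic M M'"
    using presented_bi_isomorphic[of e K L F x y e' K' L' rat_var y'] F y' M M'e by simp
  then show "\<exists>M' :: ('k, 'k ratfun_ac) extn. bi_twist M' M0 \<and> bi_isomorphic M M'"
    using presented_bi_twist[OF y' F(1) p0] by blast
  show "purely_cubic M" by (rule presented_purely_cubic[OF F(2)])
  show "is_galois M \<longleftrightarrow> (\<exists>\<zeta>::'k. \<zeta> ^ 3 = 1 \<and> \<zeta> \<noteq> 1)"
    using presented_galois[of e K L F x y] F M by simp
qed

end
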